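(* Let $2\le k\le n$ and $\sigma\in S^k_n$. Assume that for at least one pair $1\le i<j\le k$, $\mathrm{sign}(a_{\mathbf{e}_{\sigma(j)}}a_{\mathbf{e}_{\sigma(i)}})=-1$, while $\mathrm{sign}(a_{\mathbf{e}_{\sigma(i_1)}+\mathbf{e}_{\sigma(i_2)}})\,\mathrm{sign}(a_{\mathbf{e}_{\sigma(j_1)}+\mathbf{e}_{\sigma(j_2)}})=1$ for all $1\le i_1\le i_2\le k$, $1\le j_1\le j_2\le k$. Consider on the closed cell $\overline{\mathcal{M}_{k,\sigma}}$ the one-parametric (normal form) vector field $\Theta+v(\mathbf{r},\theta,\nu_0)$ given by $$\Theta+\sum_{i=1}^n\Big(\nu_0+\sum_{j=1}^na_{\mathbf{e}_j}(x_j^2+y_j^2)+\sum_{1\le j\le l\le n}a_{\mathbf{e}_j+\mathbf{e}_l}(x_j^2+y_j^2)(x_l^2+y_l^2)\Big)\Big(x_i\frac{\partial}{\partial x_i}+y_i\frac{\partial}{\partial y_i}\Big).$$ Then there is a primary cell-bifurcation variety given by $T_{2Pch}=\{\nu_0:\nu_0=0\}$. 1. A secondary flow-invariant toral CW complex associated with the CW complex $\overline{\Gamma^{k,\sigma,+}_{a_1}}$ bifurcates from the origin exactly when $\nu_0a_{2\mathbf{e}_{\sigma(k)}}<0$. There exist a natural number $l<k$, $\gamma_+\in S^{l,\sigma}_n$ and $\gamma_-\in S^{k-l,\sigma}_n$ so that its toral CW decomposition is homeomorphic to $$\{\mathbb{T}_j\times\mathbb{S}^{j-1,\bar\gamma}_{>0}:\bar\gamma\in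 S^{j,\gamma_+}_n\}_{j=1}^{l}\ \sqcup\ \{(\mathbb{T}_j\times\Gamma^{j,\bar\gamma,+}_{a_1})\sqcup(\mathbb{T}_j\times\Gamma^{j,\bar\gamma}_{a_1}):\bar\gamma\in S^{j,\sigma}_n\setminus(S^{j,\gamma_+}_n\cup S^{j,\gamma_-}_n)\}_{j=1}^k.$$ This manifold is unbounded when $|\nu_0|$ approaches infinity with $\nu_0a_{2\mathbf{e}_{\sigma(k)}}<0$. This toral manifold, when it exists, is asymptotically stable for $a_{2\mathbf{e}_{\sigma(k)}}<0$ and is unstable otherwise. 2. For $\nu_0a_{2\mathbf{e}_{\sigma(k)}}\ge0$, there is no flow-invariant hypertorus for the system on leaves with $C\in\overline{\Gamma^{k,\sigma,+}_{a_1}}$.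
   Context: $S^k_n$ is the set of permutations $\sigma$ of $\{1,\dots,n\}$ with $\sigma(i)<\sigma(j)$ for $i<j\le k$ and for $k<i<j\le n$; for $\sigma\in S^k_n$, $l\le k$, $S^{l,\sigma}_n=\{\gamma\in S^l_n:\{\sigma(i):i>k\}\subseteq\{\gamma(i):i>l\}\}$, and $S^{j,\gamma}_n=\emptyset$ if $\gamma\in S^l_n$ and $j>l$. For $\gamma\in S^l_n$, $\mathbb{S}^{l-1,\gamma}_{>0}=\{(c_i)\in\mathbb{R}^n:\sum_{i\le l}c_{\gamma(i)}^2=1,\ c_{\gamma(i)}>0\ (i\le l),\ c_{\gamma(i)}=0\ (i>l)\}$. $\mathcal{M}_{k,\sigma}=\{\mathbf{x}=(x_1,y_1,\dots,x_n,y_n):(x_{\sigma(i)},y_{\sigma(i)})\ne0\ (i\le k),\ =0\ (i>k)\}$; its invariant leaf $\mathcal{M}^C_{k,\sigma}$, $C\in\mathbb{S}^{k-1,\sigma}_{>0}$, consists of its points with $(\|(x_1,y_1)\|,\dots,\|(x_n,y_n)\|)$ a positive multiple of $C$ (similarly for the cells $\mathcal{M}_{l,\gamma}\subset\overline{\mathcal{M}_{k,\sigma}}$, $\gamma\in S_n^{l,\sigma}$). $\Theta=\sum_i\omega_i(-y_i\partial_{x_i}+x_i\partial_{y_i})$, all $\omega_i\ne0$, $\omega_i/\omega_j\notin\mathbb{Q}$ for $i<j$; $a_{\mathbf{e}_j},a_{\mathbf{e}_j+\mathbf{e}_l}$ are real constants, $\nu_0$ a real parameter, $(\mathbf{r},\theta)$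 polar (action-angle) coordinates. For $\gamma\in S^{l,\sigma}_n$, $$\Gamma^{l,\gamma}_{a_1}=\{C\in\mathbb{S}^{l-1,\gamma}_{>0}:\langle\mathrm{diag}(a_{\mathbf{e}_{\sigma(i)}})C,C\rangle=0\},\quad \Gamma^{l,\gamma,\pm}_{a_1}=\{C\in\mathbb{S}^{l-1,\gamma}_{>0}:\mathrm{sign}(a_{2\mathbf{e}_{\sigma(1)}}\langle\mathrm{diag}(a_{\mathbf{e}_{\sigma(i)}})C,C\rangle)=\pm1\},$$ with $\mathrm{diag}(a_{\mathbf{e}_{\sigma(i)}})$ the $n\times n$ diagonal matrix with $\sigma(i)$-th entry $a_{\mathbf{e}_{\sigma(i)}}$ ($i\le k$) and zeros elsewhere. A cell-bifurcation variety is the set of parameters at which the qualitative dynamics on $\overline{\mathcal{M}_{k,\sigma}}$ changes. Secondary toral CW complexes are those bifurcating from the origin. Toral CW complex: a Hausdorff space $X$ with a finite partition into open toral cells, associated with a regular CW complex $\tilde X$, such that the following hold. (i) Each toral cell $\mathfrak{C}$ corresponds to an open CW cell $e$ of $\tilde X$, of dimension $d$ say, and there is a homeomorphism $g:\mathfrak{C}\to T\times e$, where $T=\mathbb{T}_{d+1}$ (odd-dimensional toral cell) or $T=\mathbb{T}_{d+2}$ (even-dimensional toral cell). (ii) Let $\tilde\Phi:\overline{\mathbb{B}^d}\to\bar e$ be the attaching homeomorphism of $e$. There is an attaching homeomorphism $\Phi:\overline{T\times\mathbb{B}^d}\to\overline{\mathfrak{C}}\subseteq X$ with $\Phi(\partial(T\times\mathbb{B}^d))$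 contained in the union of the toral cells of lower dimension and $g(\Phi(s,y))=(s,\tilde\Phi(y))$ for $(s,y)\in T\times\mathbb{B}^d$. Here $\overline{T\times\mathbb{B}^d}$ is a space which, as a set, is the disjoint union, over the cells $e'\subseteq\bar e$ of $\tilde X$, of $T_{e'}\times\tilde\Phi^{-1}(e')$, where $T_{e'}$ is the torus fiber of the toral cell over $e'$. It carries a metrizable topology which is the product topology on each piece, in which $T\times\mathbb{B}^d$ is a dense, relatively compact, open subset, in which no sequence in one piece converges to a point of another piece of equal or higher dimension, and in which a sequence $(s^{x_j},x_j)$ in a higher dimensional piece converges to $(s^y,y)$ in a lower dimensional piece when $x_j\to y$ in $\overline{\mathbb{B}^d}$ and those circle components of $s^{x_j}$ that correspond to the circle components of the fiber over $y$ converge to $s^y$, the remaining circle components collapsing to a point.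
   Formalization: Asymptotic stability (and instability) is stated for the dynamics on the union of leaves with C in the closure of Γ⁺; on the whole closed cell asymptotic stability fails, since nearby leaves with C in Γ⁻ carry their own invariant tori. *)

theory Defs
  imports "HOL-Analysis.Analysis"
begin

section \<open>Cells, leaves and the sets \<open>\<Gamma>\<close>\<close>

text \<open>
  A finite linearly ordered index type \<open>'n\<close> plays the role of \<open>{1,\<dots>,n}\<close>, with \<open>n = CARD('n)\<close>.
  A permutation of \<open>{1,\<dots>,n}\<close> is a bijection from the positions \<open>{1..CARD('n)}\<close> to the
  indices \<open>'n\<close>, made extensional so that it is determined by its values on \<open>{1..CARD('n)}\<close>.
  Phase space is \<open>(real \<times> real)^'n\<close>; the \<open>i\<close>-th entry of a point is the pair \<open>(x\<^sub>i, y\<^sub>i)\<close>,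
  whose norm is the Euclidean one.
\<close>

definition shuffles_S :: "nat \<Rightarrow> (nat \<Rightarrow> 'n::{finite,linorder}) set" where
  "shuffles_S k = {\<sigma> \<in> extensional {1..CARD('n)}.
     bij_betw \<sigma> {1..CARD('n)} UNIV \<and>
     (\<forall>i j. 1 \<le> i \<and> i < j \<and> j \<le> k \<longrightarrow> \<sigma> i < \<sigma> j) \<and>
     (\<forall>i j. k < i \<and> i < j \<and> j \<le> CARD('n) \<longrightarrow> \<sigma> i < \<sigma> j)}"

text \<open>
  \<open>subshuffles_S l k \<sigma>\<close> is \<open>S\<^sup>l\<^sup>,\<^sup>\<sigma>\<close> for \<open>\<sigma> \<in> S\<^sup>k\<close>. The number \<open>k\<close> is an argument because it cannot be
  recovered from the function \<open>\<sigma>\<close>. The set is empty for \<open>l > k\<close>.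
\<close>

definition subshuffles_S ::
    "nat \<Rightarrow> nat \<Rightarrow> (nat \<Rightarrow> 'n::{finite,linorder}) \<Rightarrow> (nat \<Rightarrow> 'n) set" where
  "subshuffles_S l k \<sigma> =
     {\<gamma> \<in> shuffles_S l. l \<le> k \<and> \<sigma> ` {k<..CARD('n)} \<subseteq> \<gamma> ` {l<..CARD('n)}}"

definition pos_sphere :: "nat \<Rightarrow> (nat \<Rightarrow> 'n::{finite,linorder}) \<Rightarrow>
      (real^'n::{finite,linorder}) set" where
  "pos_sphere l \<gamma> = {C. (\<Sum>i\<in>{1..l}. (C $ \<gamma> i)\<^sup>2) = 1 \<and>
     (\<forall>i\<in>{1..l}. C $ \<gamma> i > 0) \<and> (\<forall>i\<in>{l<..CARD('n)}. C $ \<gamma> i = 0)}"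

definition cell_M :: "nat \<Rightarrow> (nat \<Rightarrow> 'n::{finite,linorder}) \<Rightarrow>
      ((real \<times> real)^'n::{finite,linorder}) set" where
  "cell_M k \<sigma> = {p. (\<forall>i\<in>{1..k}. p $ \<sigma> i \<noteq> 0) \<and> (\<forall>i\<in>{k<..CARD('n)}. p $ \<sigma> i = 0)}"

text \<open>
  For \<open>C \<in> pos_sphere l \<gamma>\<close> the condition below forces the points to lie in \<open>cell_M l \<gamma>\<close>, so the
  leaf depends on \<open>C\<close> only.
\<close>

definition leaf :: "real^'n \<Rightarrow> ((real \<times> real)^'n) set" where
  "leaf C = {p. \<exists>\<rho>>0. \<forall>i. norm (p $ i) = \<rho> * C $ i}"

text \<open>
  The coefficients form one family \<open>a\<close> indexed by multi-indices in \<open>nat^'n\<close>; \<open>unit_mi j\<close> is the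
  multi-index \<open>\<^bold>e\<^sub>j\<close>, and \<open>unit_mi j + unit_mi j\<close> is \<open>2\<^bold>e\<^sub>j\<close>.
\<close>

definition unit_mi :: "'n::finite \<Rightarrow> nat^'n" where
  "unit_mi j = axis j 1"

definition diag_a ::
    "(nat^'n::{finite,linorder} \<Rightarrow> real) \<Rightarrow> nat \<Rightarrow> (nat \<Rightarrow> 'n::{finite,linorder}) \<Rightarrow>
      real^'n::{finite,linorder}^'n::{finite,linorder}" where
  "diag_a a k \<sigma> = (\<chi> i j. if i = j \<and> i \<in> \<sigma> ` {1..k} then a (unit_mi i) else 0)"

text \<open>
  \<open>Gamma_zero a k \<sigma> l \<gamma>\<close> and \<open>Gamma_sign a k \<sigma> s l \<gamma>\<close>, \<open>s = \<plusminus>1\<close>, are the sets \<open>\<Gamma>\<^sup>l\<^sup>,\<^sup>\<gamma>\<close> and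
  \<open>\<Gamma>\<^sup>l\<^sup>,\<^sup>\<gamma>\<^sup>,\<^sup>\<plusminus>\<close> for \<open>\<gamma> \<in> S\<^sup>l\<^sup>,\<^sup>\<sigma>\<close>; both depend on \<open>k\<close> and \<open>\<sigma>\<close> through the quadratic form.
\<close>

definition Gamma_zero ::
    "(nat^'n::{finite,linorder} \<Rightarrow> real) \<Rightarrow> nat \<Rightarrow> (nat \<Rightarrow> 'n::{finite,linorder}) \<Rightarrow> nat \<Rightarrow>
      (nat \<Rightarrow> 'n) \<Rightarrow> (real^'n::{finite,linorder}) set"
  where
  "Gamma_zero a k \<sigma> l \<gamma> = {C \<in> pos_sphere l \<gamma>. (diag_a a k \<sigma> *v C) \<bullet> C = 0}"

definition Gamma_sign ::
    "(nat^'n::{finite,linorder} \<Rightarrow> real) \<Rightarrow> nat \<Rightarrow> (nat \<Rightarrow> 'n::{finite,linorder}) \<Rightarrow> real \<Rightarrow>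
      nat \<Rightarrow> (nat \<Rightarrow> 'n)
      \<Rightarrow> (real^'n::{finite,linorder}) set" where
  "Gamma_sign a k \<sigma> s l \<gamma> = {C \<in> pos_sphere l \<gamma>.
     sgn (a (unit_mi (\<sigma> 1) + unit_mi (\<sigma> 1)) * ((diag_a a k \<sigma> *v C) \<bullet> C)) = s}"


section \<open>The vector field and its solutions\<close>

definition normal_form ::
    "('n \<Rightarrow> real) \<Rightarrow> (nat^'n::{finite,linorder} \<Rightarrow> real) \<Rightarrow> real \<Rightarrow>
      (real \<times> real)^'n::{finite,linorder} \<Rightarrow> (real \<times> real)^'n::{finite,linorder}"
  where
  "normal_form \<omega> a \<nu> p = (\<chi> i.
     (- \<omega> i * snd (p $ i), \<omega> i * fst (p $ i)) +
     (\<nu> + (\<Sum>j\<in>UNIV. a (unit_mi j) * ((fst (p $ j))\<^sup>2 + (snd (p $ j))\<^sup>2))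
        + (\<Sum>(j, l)\<in>{(j, l). j \<le> l}. a (unit_mi j + unit_mi l) *
             ((fst (p $ j))\<^sup>2 + (snd (p $ j))\<^sup>2) * ((fst (p $ l))\<^sup>2 + (snd (p $ l))\<^sup>2)))
     *\<^sub>R (p $ i))"

definition solution_on :: "('a::real_normed_vector \<Rightarrow> 'a) \<Rightarrow> real set \<Rightarrow> (real \<Rightarrow> 'a) \<Rightarrow> bool" where
  "solution_on F I u \<longleftrightarrow>
     is_interval I \<and> (\<forall>t\<in>I. (u has_vector_derivative F (u t)) (at t within I))"

definition flow_invariant :: "('a::real_normed_vector \<Rightarrow> 'a) \<Rightarrow> 'a set \<Rightarrow> bool" where
  "flow_invariant F X \<longleftrightarrow>
     (\<forall>I u. solution_on F I u \<and> 0 \<in> I \<and> u 0 \<in> X \<longrightarrow> u ` I \<subseteq> X)"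

text \<open>
  Stability of \<open>A\<close> for the dynamics restricted to an invariant set \<open>W\<close>. For locally Lipschitz
  fields \<open>u\<close> is the unique solution from \<open>p\<close>; its existence for all \<open>t \<ge> 0\<close> is part of stability.
\<close>

definition stable_within ::
    "'a set \<Rightarrow> ('a::real_normed_vector \<Rightarrow> 'a) \<Rightarrow> 'a set \<Rightarrow> bool" where
  "stable_within W F A \<longleftrightarrow>
     (\<forall>\<epsilon>>0. \<exists>\<delta>>0. \<forall>p\<in>W. infdist p A < \<delta> \<longrightarrow>
        (\<exists>u. solution_on F {0..} u \<and> u 0 = p \<and> (\<forall>t\<ge>0. infdist (u t) A < \<epsilon>)))"

definition asymptotically_stable_within ::
    "'a set \<Rightarrow> ('a::real_normed_vector \<Rightarrow> 'a) \<Rightarrow> 'a set \<Rightarrow> bool" where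
  "asymptotically_stable_within W F A \<longleftrightarrow> stable_within W F A \<and>
     (\<exists>\<delta>>0. \<forall>p\<in>W. infdist p A < \<delta> \<longrightarrow>
        (\<exists>u. solution_on F {0..} u \<and> u 0 = p \<and> ((\<lambda>t. infdist (u t) A) \<longlongrightarrow> 0) at_top))"


section \<open>Bifurcation varieties\<close>

text \<open>
  \<open>h\<close> sends every solution segment of \<open>F\<close> in \<open>U\<close> to a solution segment of \<open>G\<close> in \<open>V\<close>, up to the
  increasing change of time \<open>\<tau>\<close>. Working with segments avoids assuming that solutions are complete.
\<close>

definition maps_orbits ::
    "'a set \<Rightarrow> ('a::real_normed_vector \<Rightarrow> 'a) \<Rightarrow> 'a set \<Rightarrow> ('a \<Rightarrow> 'a) \<Rightarrow> ('a \<Rightarrow> 'a) \<Rightarrow> bool" where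
  "maps_orbits U F V G h \<longleftrightarrow>
     (\<forall>T u. T > 0 \<and> solution_on F {0..T} u \<and> u ` {0..T} \<subseteq> U \<longrightarrow>
        (\<exists>T' v \<tau>. T' > 0 \<and> solution_on G {0..T'} v \<and> v ` {0..T'} \<subseteq> V \<and>
           continuous_on {0..T} \<tau> \<and> strict_mono_on {0..T} \<tau> \<and> \<tau> 0 = 0 \<and> \<tau> T = T' \<and>
           (\<forall>t\<in>{0..T}. h (u t) = v (\<tau> t))))"

definition topologically_equivalent ::
    "'a set \<Rightarrow> ('a::real_normed_vector \<Rightarrow> 'a) \<Rightarrow> ('a \<Rightarrow> 'a) \<Rightarrow> bool" where
  "topologically_equivalent M F G \<longleftrightarrow>
     (\<exists>h h'. homeomorphism M M h h' \<and> maps_orbits M F M G h \<and> maps_orbits M G M F h')"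

definition locally_equivalent_at ::
    "'a \<Rightarrow> 'a set \<Rightarrow> ('a::real_normed_vector \<Rightarrow> 'a) \<Rightarrow> ('a \<Rightarrow> 'a) \<Rightarrow> bool" where
  "locally_equivalent_at p M F G \<longleftrightarrow>
     (\<exists>U V h h'. openin (top_of_set M) U \<and> openin (top_of_set M) V \<and> p \<in> U \<and> p \<in> V \<and>
        homeomorphism U V h h' \<and> h p = p \<and> maps_orbits U F V G h \<and> maps_orbits V G U F h')"

definition bifurcation_variety ::
    "'a set \<Rightarrow> (real \<Rightarrow> 'a::real_normed_vector \<Rightarrow> 'a) \<Rightarrow> real set" where
  "bifurcation_variety M F =
     {\<nu>. \<forall>\<delta>>0. \<exists>\<mu>. \<bar>\<mu> - \<nu>\<bar> < \<delta> \<and> \<not> topologically_equivalent M (F \<nu>) (F \<mu>)}"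

text \<open>
  A bifurcation value is primary if the change of the qualitative dynamics takes place at the
  primary invariant object, the equilibrium at the origin.
\<close>

definition primary_bifurcation_variety ::
    "'a set \<Rightarrow> (real \<Rightarrow> 'a::real_normed_vector \<Rightarrow> 'a) \<Rightarrow> real set" where
  "primary_bifurcation_variety M F =
     {\<nu> \<in> bifurcation_variety M F.
        \<forall>\<delta>>0. \<exists>\<mu>. \<bar>\<mu> - \<nu>\<bar> < \<delta> \<and> \<not> locally_equivalent_at 0 M (F \<nu>) (F \<mu>)}"

text \<open>
  The family \<open>X\<close>, defined for parameters in \<open>P\<close>, emanates from the origin at the parameter \<open>\<nu>\<^sub>0\<close>.
\<close>

definition bifurcates_from_origin ::
    "(real \<Rightarrow> 'a::real_normed_vector set) \<Rightarrow> real set \<Rightarrow> real \<Rightarrow> bool" where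
  "bifurcates_from_origin X P \<nu>\<^sub>0 \<longleftrightarrow> \<nu>\<^sub>0 islimpt P \<and>
     (\<forall>\<nu>\<in>P. X \<nu> \<noteq> {} \<and> 0 \<notin> X \<nu>) \<and>
     (\<forall>\<epsilon>>0. \<exists>\<delta>>0. \<forall>\<nu>\<in>P. \<bar>\<nu> - \<nu>\<^sub>0\<bar> < \<delta> \<longrightarrow> X \<nu> \<subseteq> ball 0 \<epsilon>)"


section \<open>Regular CW complexes and toral CW complexes\<close>

definition unit_disc :: "nat \<Rightarrow> (nat \<Rightarrow> real) topology" where
  "unit_disc d = subtopology (Euclidean_space d) {x. (\<Sum>i<d. (x i)\<^sup>2) \<le> 1}"

definition open_disc :: "nat \<Rightarrow> (nat \<Rightarrow> real) set" where
  "open_disc d = {x \<in> topspace (Euclidean_space d). (\<Sum>i<d. (x i)\<^sup>2) < 1}"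

text \<open>
  Finite regular CW complexes: \<open>E\<close> is the set of open cells, \<open>d e\<close> the dimension of \<open>e\<close> and
  \<open>\<phi> e\<close> its attaching homeomorphism. Closure finiteness and the weak topology are automatic,
  since there are finitely many cells.
\<close>

definition regular_CW_complex ::
    "'b topology \<Rightarrow> 'b set set \<Rightarrow> ('b set \<Rightarrow> nat) \<Rightarrow> ('b set \<Rightarrow> (nat \<Rightarrow> real) \<Rightarrow> 'b) \<Rightarrow> bool" where
  "regular_CW_complex Y E d \<phi> \<longleftrightarrow>
     Hausdorff_space Y \<and> finite E \<and> partition_on (topspace Y) E \<and>
     (\<forall>e\<in>E. homeomorphic_map (unit_disc (d e)) (subtopology Y (Y closure_of e)) (\<phi> e) \<and>
        \<phi> e ` open_disc (d e) = e \<and>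
        \<phi> e ` (topspace (unit_disc (d e)) - open_disc (d e)) \<subseteq> \<Union>{e' \<in> E. d e' < d e})"

text \<open>
  The torus whose circle components are labelled by \<open>J\<close>. For toral cells over \<open>e'\<close> and \<open>e\<close> with
  \<open>e'\<close> in the closure of \<open>e\<close>, equal labels say which circle components correspond to each other.
\<close>

definition torus :: "'i set \<Rightarrow> ('i \<Rightarrow> complex) topology" where
  "torus J = product_topology (\<lambda>_. top_of_set (sphere 0 1)) J"

definition toral_piece ::
    "('b set \<Rightarrow> nat) \<Rightarrow> ('b set \<Rightarrow> (nat \<Rightarrow> real) \<Rightarrow> 'b) \<Rightarrow> ('b set \<Rightarrow> 'i set) \<Rightarrow> 'b set \<Rightarrow> 'b set
      \<Rightarrow> (('i \<Rightarrow> complex) \<times> (nat \<Rightarrow> real)) set" where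
  "toral_piece d \<phi> J e e' =
     topspace (torus (J e')) \<times> {y \<in> topspace (unit_disc (d e)). \<phi> e y \<in> e'}"

definition toral_dim :: "('b set \<Rightarrow> nat) \<Rightarrow> ('b set \<Rightarrow> 'i set) \<Rightarrow> 'b set \<Rightarrow> nat" where
  "toral_dim d J e = card (J e) + d e"

text \<open>
  \<open>Z\<close> is a space \<open>closure (T \<times> B)\<close> for the cell \<open>e\<close>. In the last condition nothing is
  required of the components \<open>s m i\<close> with \<open>i \<notin> J e''\<close>: these are the circles that collapse.
\<close>

definition closed_toral_ball ::
    "'b topology \<Rightarrow> 'b set set \<Rightarrow> ('b set \<Rightarrow> nat) \<Rightarrow> ('b set \<Rightarrow> (nat \<Rightarrow> real) \<Rightarrow> 'b) \<Rightarrow>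
      ('b set \<Rightarrow> 'i set) \<Rightarrow> 'b set \<Rightarrow> (('i \<Rightarrow> complex) \<times> (nat \<Rightarrow> real)) topology \<Rightarrow> bool" where
  "closed_toral_ball Y E d \<phi> J e Z \<longleftrightarrow>
     (let faces = {e' \<in> E. e' \<subseteq> Y closure_of e};
          piece = toral_piece d \<phi> J e;
          TB = topspace (torus (J e)) \<times> open_disc (d e)
      in topspace Z = (\<Union>e'\<in>faces. piece e') \<and>
         metrizable_space Z \<and>
         (\<forall>e'\<in>faces. subtopology Z (piece e') =
            prod_topology (torus (J e'))
              (subtopology (unit_disc (d e)) {y. \<phi> e y \<in> e'})) \<and>
         openin Z TB \<and> Z closure_of TB = topspace Z \<and> compactin Z (Z closure_of TB) \<and>
         (\<forall>e'\<in>faces. \<forall>e''\<in>faces. e' \<noteq> e'' \<and> toral_dim d J e' \<le> toral_dim d J e'' \<longrightarrow>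
            (\<forall>z p. range z \<subseteq> piece e' \<and> p \<in> piece e'' \<longrightarrow> \<not> limitin Z z p sequentially)) \<and>
         (\<forall>e'\<in>faces. \<forall>e''\<in>faces. toral_dim d J e'' < toral_dim d J e' \<longrightarrow>
            (\<forall>s x t y. (\<forall>m. (s m, x m) \<in> piece e') \<and> (t, y) \<in> piece e'' \<and>
               limitin (unit_disc (d e)) x y sequentially \<and>
               (\<forall>i\<in>J e''. (\<lambda>m. s m i) \<longlonglongrightarrow> t i) \<longrightarrow>
               limitin Z (\<lambda>m. (s m, x m)) (t, y) sequentially)))"

text \<open>
  \<open>c e\<close> is the open toral cell of \<open>X\<close> that corresponds to the cell \<open>e\<close> of the regular CW complex
  \<open>(Y, E, d, \<phi>)\<close>, \<open>J e\<close> labels the circle components of its torus fiber and \<open>g e\<close> trivializes it.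
\<close>

definition toral_CW_complex ::
    "'a topology \<Rightarrow> ('b set \<Rightarrow> 'a set) \<Rightarrow> ('b set \<Rightarrow> 'i set) \<Rightarrow>
      ('b set \<Rightarrow> 'a \<Rightarrow> ('i \<Rightarrow> complex) \<times> 'b) \<Rightarrow>
      'b topology \<Rightarrow> 'b set set \<Rightarrow> ('b set \<Rightarrow> nat) \<Rightarrow> ('b set \<Rightarrow> (nat \<Rightarrow> real) \<Rightarrow> 'b) \<Rightarrow> bool" where
  "toral_CW_complex X c J g Y E d \<phi> \<longleftrightarrow>
     Hausdorff_space X \<and> regular_CW_complex Y E d \<phi> \<and>
     inj_on c E \<and> partition_on (topspace X) (c ` E) \<and>
     (\<forall>e\<in>E. finite (J e) \<and> card (J e) \<in> {d e + 1, d e + 2} \<and>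
        (\<forall>e'\<in>E. e' \<subseteq> Y closure_of e \<longrightarrow> J e' \<subseteq> J e) \<and>
        homeomorphic_map (subtopology X (c e))
          (prod_topology (torus (J e)) (subtopology Y e)) (g e) \<and>
        (\<exists>Z \<Phi>. closed_toral_ball Y E d \<phi> J e Z \<and>
           homeomorphic_map Z (subtopology X (X closure_of c e)) \<Phi> \<and>
           \<Phi> ` (Z frontier_of (topspace (torus (J e)) \<times> open_disc (d e)))
             \<subseteq> \<Union>(c ` {e' \<in> E. toral_dim d J e' < toral_dim d J e}) \<and>
           (\<forall>s\<in>topspace (torus (J e)). \<forall>y\<in>open_disc (d e).
              \<Phi> (s, y) \<in> c e \<and> g e (\<Phi> (s, y)) = (s, \<phi> e y))))"


section \<open>Invariant toral objects of the flow\<close>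

text \<open>
  A flow-invariant toral CW complex \<open>X\<close> in phase space, with toral cells \<open>c e\<close>, associated with
  the set of leaves \<open>K\<close>, decomposed into the cells \<open>E\<close>. The trivialization of a toral cell
  records the leaf: the torus fiber over \<open>C\<close> consists of points of \<open>leaf C\<close>.
\<close>

definition invariant_toral_complex ::
    "((real \<times> real)^'n \<Rightarrow> (real \<times> real)^'n) \<Rightarrow> (real^'n) set \<Rightarrow> (real^'n) set set \<Rightarrow>
      ((real \<times> real)^'n) set \<Rightarrow> ((real^'n) set \<Rightarrow> ((real \<times> real)^'n) set) \<Rightarrow> bool" where
  "invariant_toral_complex F K E X c \<longleftrightarrow> flow_invariant F X \<and>
     (\<exists>(J :: (real^'n) set \<Rightarrow> 'n set) g d \<phi>.
        toral_CW_complex (top_of_set X) c J g (top_of_set K) E d \<phi> \<and>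
        (\<forall>e\<in>E. \<forall>p\<in>c e. p \<in> leaf (snd (g e p))))"

definition hypertorus :: "'a::topological_space set \<Rightarrow> bool" where
  "hypertorus H \<longleftrightarrow> (\<exists>m\<ge>1. top_of_set H homeomorphic_space torus {1..m::nat})"

text \<open>
  The pairs \<open>(j, e)\<close> such that \<open>\<^bold>T\<^sub>j \<times> e\<close> occurs in the asserted decomposition. Sets \<open>e\<close> of
  the list that happen to be empty (possible if some \<open>a (unit_mi i)\<close> vanish) are no cells.
\<close>

definition toral_decomposition ::
    "(nat^'n::{finite,linorder} \<Rightarrow> real) \<Rightarrow> nat \<Rightarrow> (nat \<Rightarrow> 'n::{finite,linorder}) \<Rightarrow> nat \<Rightarrow>
      (nat \<Rightarrow> 'n) \<Rightarrow> (nat \<Rightarrow> 'n)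
      \<Rightarrow> (nat \<times> (real^'n::{finite,linorder}) set) set" where
  "toral_decomposition a k \<sigma> l \<gamma>\<^sub>p \<gamma>\<^sub>m =
     {(j, e). e \<noteq> {} \<and>
       ((j \<in> {1..l} \<and> (\<exists>\<gamma>\<in>subshuffles_S j l \<gamma>\<^sub>p. e = pos_sphere j \<gamma>)) \<or>
        (j \<in> {1..k} \<and>
          (\<exists>\<gamma>\<in>subshuffles_S j k \<sigma> - (subshuffles_S j l \<gamma>\<^sub>p \<union> subshuffles_S j (k - l) \<gamma>\<^sub>m).
             e = Gamma_sign a k \<sigma> 1 j \<gamma> \<or> e = Gamma_zero a k \<sigma> j \<gamma>)))}"

end

theory Submission
  imports Defs
begin

text \<open>
  The field commutes with the rotations of the coordinate planes and stretches all planes by the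
  same factor, the growth rate \<open>\<nu> + q(p) + w(p)\<close> with \<open>q\<close> quadratic and \<open>w\<close> quartic in the norms of the
  coordinate pairs. So a solution is a rotation of the angles composed with a positive scaling
  (\<open>solution_of_radial\<close>, \<open>solution_norms\<close>), every leaf is invariant, and on the leaf of \<open>C\<close> the distance
  \<open>\<rho>\<close> to the origin satisfies \<open>\<rho>' = \<rho> (\<nu> + q(C) \<rho>\<^sup>2 + w(C) \<rho>\<^sup>4)\<close>.

  Let \<open>s\<close> be the common sign of the quartic coefficients. Then \<open>s w(C) > 0\<close> on the cell, and the
  closure of \<open>\<Gamma>\<^sup>+\<close> consists of the directions \<open>C\<close> with \<open>s q(C) \<ge> 0\<close>. For these \<open>C\<close> the factor
  \<open>s (\<nu> + q(C) \<rho>\<^sup>2 + w(C) \<rho>\<^sup>4)\<close> increases strictly with \<open>\<rho>\<close>. It has a unique positive zero, depending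
  continuously on \<open>C\<close>, if \<open>s \<nu> < 0\<close>, and it is positive for all \<open>\<rho> > 0\<close> if \<open>s \<nu> \<ge> 0\<close>. In the first
  case the zeros form the invariant set, a family of tori over the closure of \<open>\<Gamma>\<^sup>+\<close>; it attracts
  within the leaves if \<open>s = -1\<close> and repels if \<open>s = 1\<close>, and its size is read off from the equation of
  the zero. In the second case no leaf contains a nonempty compact invariant set: a point of least
  norm would be moved closer to the origin, in forward or in backward time
  (\<open>no_compact_invariant_set\<close>). A toral CW complex over the closure of \<open>\<Gamma>\<^sup>+\<close> meets each of its leaves
  in such a set, so this also excludes toral complexes.

  The cell structure becomes visible in the coordinates \<open>C\<^sub>i\<^sup>2\<close>. There the closure of \<open>\<Gamma>\<^sup>+\<close> is the polytope
  that the half-space \<open>\<Sum> s a\<^sub>i u\<^sub>i \<ge> 0\<close> cuts out of a simplex, and the cells in the list are the relative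
  interiors of its faces, if \<open>\<gamma>\<^sub>+\<close> enumerates the indices with \<open>s a\<^sub>i \<ge> 0\<close> and \<open>\<gamma>\<^sub>-\<close> those with
  \<open>s a\<^sub>i < 0\<close>. A finite partition into convex, relatively open pieces in which every piece that meets the
  closure of another one lies in that closure is a regular CW complex (\<open>convex_cells.regular_CW\<close>), and a
  bundle of tori over it, with the circles collapsing where \<open>C\<^sub>i = 0\<close>, is a toral CW complex
  (\<open>toral_cells.toral_CW_bundle\<close>).

  For the bifurcation variety, let \<open>\<nu> \<noteq> 0\<close> and let \<open>\<mu>\<close> be close to \<open>\<nu>\<close>. Near the origin both growth
  rates have the sign of \<open>\<nu>\<close>, so the orbits differ in their timing only. Keeping all norms and turning
  each point by the difference of the times that the two flows need to reach a fixed sphere is a local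
  equivalence (\<open>locally_equivalent_nonzero\<close>). At \<open>\<nu> = 0\<close> a coordinate plane with \<open>a\<^sub>i > 0\<close> contains
  solutions that emanate from the origin, whereas for \<open>\<mu> < 0\<close> the norm of every solution near the
  origin decreases (\<open>not_locally_equivalent_at_0\<close>).
\<close>


section \<open>Convex sets and closed discs\<close>

definition lin_disc :: "(nat \<Rightarrow> 'a::real_vector) \<Rightarrow> nat \<Rightarrow> (nat \<Rightarrow> real) \<Rightarrow> 'a" where
  "lin_disc b d x = (\<Sum>i<d. x i *\<^sub>R b i)"

lemma compact_space_unit_disc: "compact_space (unit_disc d)"
proof -
  let ?B = "\<lambda>i. if i < d then {-1..1} else {0::real}"
  have "compactin (powertop_real UNIV) (PiE UNIV ?B)"
    by (subst compactin_PiE) (auto simp: )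
  moreover have "closedin (powertop_real UNIV)
      {x \<in> topspace (powertop_real UNIV). (\<Sum>i<d. (x i)\<^sup>2) \<in> {..1}}"
    by (intro closedin_continuous_map_preimage[where Y=euclideanreal] continuous_map_sum
        continuous_map_real_pow continuous_map_product_projection) auto
  ultimately have "compactin (powertop_real UNIV)
      (PiE UNIV ?B \<inter> {x \<in> topspace (powertop_real UNIV). (\<Sum>i<d. (x i)\<^sup>2) \<in> {..1}})"
    by (rule compact_Int_closedin)
  moreover have "PiE UNIV ?B \<inter> {x \<in> topspace (powertop_real UNIV). (\<Sum>i<d. (x i)\<^sup>2) \<in> {..1}}
      = {x. \<forall>i\<ge>d. x i = 0} \<inter> {x. (\<Sum>i<d. (x i)\<^sup>2) \<le> 1}" (is "?L = ?R")
  proof (intro set_eqI iffI)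
    fix x assume "x \<in> ?L" then show "x \<in> ?R"
      by (auto simp: PiE_iff) (metis (mono_tags) not_le singletonD)
  next
    fix x assume x: "x \<in> ?R"
    have "\<bar>x i\<bar> \<le> 1" if "i < d" for i
    proof -
      have "(x i)\<^sup>2 \<le> (\<Sum>i<d. (x i)\<^sup>2)" using that by (intro member_le_sum) auto
      also have "\<dots> \<le> 1" using x by simp
      finally show ?thesis by (simp add: abs_square_le_1)
    qed
    then show "x \<in> ?L" using x by (auto simp: PiE_iff abs_le_iff)
  qed
  ultimately show ?thesis
    by (simp add: unit_disc_def Euclidean_space_def subtopology_subtopology compact_space_subtopology)
qed

lemma unit_disc_eq:
  "unit_disc d = top_of_set {x. (\<forall>i\<ge>d. x i = 0) \<and> (\<Sum>i<d. (x i)\<^sup>2) \<le> 1}"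
  by (simp add: unit_disc_def Euclidean_space_def subtopology_subtopology
      euclidean_product_topology Collect_conj_eq)

lemma topspace_unit_disc:
  "topspace (unit_disc d) = {x. (\<forall>i\<ge>d. x i = 0) \<and> (\<Sum>i<d. (x i)\<^sup>2) \<le> 1}"
  by (auto simp: unit_disc_def topspace_Euclidean_space)

lemma open_disc_eq: "open_disc d = {x. (\<forall>i\<ge>d. x i = 0) \<and> (\<Sum>i<d. (x i)\<^sup>2) < 1}"
  by (auto simp: open_disc_def topspace_Euclidean_space)

text \<open>
  An orthonormal basis of the subspace gives a linear isometry. This carries statements about balls
  over to the discs of real sequences on which attaching maps are defined.
\<close>
lemma homeomorphic_map_unit_disc_subspace:
  fixes L :: "'a::euclidean_space set"
  assumes L: "subspace L" "dim L = d"
  obtains f where "homeomorphic_map (unit_disc d) (top_of_set (cball 0 1 \<inter> L)) f"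
    "f ` open_disc d = ball 0 1 \<inter> L"
proof -
  obtain B where B: "pairwise orthogonal B" "\<And>x. x \<in> B \<Longrightarrow> norm x = 1" "independent B" "card B = d"
    "span B = L" "0 \<notin> B"
    using orthonormal_basis_subspace[OF L(1)] L(2) by (metis norm_zero zero_neq_one)
  have fin: "finite B" using B(3) independent_imp_finite by blast
  then obtain b where b: "bij_betw b {..<d} B"
    using B(4) by (metis bij_betw_from_nat_into_finite)
  have binj: "b i = b j \<longleftrightarrow> i = j" if "i < d" "j < d" for i j
    using b that by (auto simp: bij_betw_def inj_on_def)
  have bB: "b i \<in> B" if "i < d" for i using b that by (auto simp: bij_betw_def)
  have inner: "b i \<bullet> b j = (if i = j then 1 else 0)" if "i < d" "j < d" for i j
    using B(1,2) bB that binj unfolding pairwise_def orthogonal_def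
    by (auto simp: dot_square_norm)
  have coord: "lin_disc b d x \<bullet> b i = x i" if "i < d" for x i
    using that by (simp add: lin_disc_def inner_sum_left inner if_distrib cong: if_cong)
  have nrm: "(norm (lin_disc b d x))\<^sup>2 = (\<Sum>i<d. (x i)\<^sup>2)" for x
  proof -
    have "(norm (lin_disc b d x))\<^sup>2 = (\<Sum>i<d. lin_disc b d x \<bullet> (x i *\<^sub>R b i))"
      by (simp add: power2_norm_eq_inner) (subst (2) lin_disc_def, simp add: inner_sum_right)
    also have "\<dots> = (\<Sum>i<d. (x i)\<^sup>2)" by (intro sum.cong) (auto simp: coord power2_eq_square)
    finally show ?thesis .
  qed
  have inL: "lin_disc b d x \<in> L" for x
    unfolding lin_disc_def B(5)[symmetric] using bB by (intro span_sum span_scale span_base) auto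
  have surj: "\<exists>x. (\<forall>i\<ge>d. x i = 0) \<and> lin_disc b d x = v" if "v \<in> L" for v
  proof -
    obtain u where u: "v = (\<Sum>w\<in>B. u w *\<^sub>R w)"
      using \<open>v \<in> L\<close> B(5) span_finite[OF fin] by auto
    have "v = (\<Sum>i<d. u (b i) *\<^sub>R b i)"
      unfolding u by (rule sum.reindex_bij_betw[OF b, symmetric])
    then show ?thesis
      by (intro exI[of _ "\<lambda>i. if i < d then u (b i) else 0"]) (simp add: lin_disc_def)
  qed
  have le1: "norm v \<le> 1 \<longleftrightarrow> (norm v)\<^sup>2 \<le> 1" "norm v < 1 \<longleftrightarrow> (norm v)\<^sup>2 < 1" for v :: 'a
    by (simp_all add: abs_square_le_1 abs_square_less_1)
  have img: "lin_disc b d ` topspace (unit_disc d) = cball 0 1 \<inter> L"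
  proof (intro set_eqI iffI)
    fix v assume "v \<in> lin_disc b d ` topspace (unit_disc d)"
    then show "v \<in> cball 0 1 \<inter> L" using inL nrm by (auto simp: topspace_unit_disc le1)
  next
    fix v assume v: "v \<in> cball 0 1 \<inter> L"
    then obtain x where x: "\<forall>i\<ge>d. x i = 0" "lin_disc b d x = v" using surj by blast
    then have "x \<in> topspace (unit_disc d)" using v nrm[of x] by (auto simp: topspace_unit_disc le1)
    then show "v \<in> lin_disc b d ` topspace (unit_disc d)" using x by blast
  qed
  have img2: "lin_disc b d ` open_disc d = ball 0 1 \<inter> L"
  proof (intro set_eqI iffI)
    fix v assume "v \<in> lin_disc b d ` open_disc d"
    then show "v \<in> ball 0 1 \<inter> L" using inL nrm by (auto simp: open_disc_eq le1)
  next
    fix v assume v: "v \<in> ball 0 1 \<inter> L"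
    then obtain x where x: "\<forall>i\<ge>d. x i = 0" "lin_disc b d x = v" using surj by blast
    then have "x \<in> open_disc d" using v nrm[of x] by (auto simp: open_disc_eq le1)
    then show "v \<in> lin_disc b d ` open_disc d" using x by blast
  qed
  have "homeomorphic_map (unit_disc d) (top_of_set (cball 0 1 \<inter> L)) (lin_disc b d)"
  proof (rule continuous_imp_homeomorphic_map)
    show "continuous_map (unit_disc d) (top_of_set (cball 0 1 \<inter> L)) (lin_disc b d)"
    proof -
      have "continuous_on UNIV (lin_disc b d)"
        unfolding lin_disc_def
        by (intro continuous_intros continuous_on_product_coordinates)
      then have "continuous_map (unit_disc d) euclidean (lin_disc b d)"
        unfolding unit_disc_eq using continuous_on_subset by auto
      then show ?thesis using img by (auto simp: continuous_map_in_subtopology)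
    qed
    show "inj_on (lin_disc b d) (topspace (unit_disc d))"
    proof (rule inj_onI)
      fix x y assume xy: "x \<in> topspace (unit_disc d)" "y \<in> topspace (unit_disc d)"
        "lin_disc b d x = lin_disc b d y"
      show "x = y"
      proof
        fix i show "x i = y i"
          using xy coord[of i x] coord[of i y] by (cases "i < d") (auto simp: topspace_unit_disc)
      qed
    qed
    show "Hausdorff_space (top_of_set (cball 0 1 \<inter> L))"
      by (rule Hausdorff_space_subtopology) simp
  qed (use compact_space_unit_disc img in auto)
  then show ?thesis using img2 that by blast
qed

text \<open>
  Invariance of domain inside the affine hulls: the image of the relative interior is open in the
  affine hull of \<open>B\<close> and contained in \<open>B\<close>.
\<close>
lemma image_rel_interior_subset:
  fixes h :: "'a::euclidean_space \<Rightarrow> 'b::euclidean_space"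
  assumes dim: "aff_dim B \<le> aff_dim A" and cont: "continuous_on A h" and im: "h ` A \<subseteq> B"
    and inj: "inj_on h A"
  shows "h ` rel_interior A \<subseteq> rel_interior B"
proof -
  have sub: "h ` rel_interior A \<subseteq> B" using im rel_interior_subset[of A] by (meson image_mono order_trans)
  have "openin (top_of_set (affine hull B)) (h ` rel_interior A)"
  proof (rule invariance_of_domain_affine_sets)
    show "openin (top_of_set (affine hull A)) (rel_interior A)" by (rule openin_rel_interior)
    show "continuous_on (rel_interior A) h"
      using cont rel_interior_subset by (rule continuous_on_subset)
    show "inj_on h (rel_interior A)"
      using inj rel_interior_subset by (rule inj_on_subset)
    show "h \<in> rel_interior A \<rightarrow> affine hull B"
      using sub hull_subset[of B affine] by (simp add: image_subset_iff subset_iff Pi_iff)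
    show "aff_dim (affine hull B) \<le> aff_dim (affine hull A)" using dim by simp
  qed auto
  then show ?thesis using sub by (intro rel_interior_maximal)
qed

lemma homeomorphism_rel_interior:
  fixes f :: "'a::euclidean_space \<Rightarrow> 'b::euclidean_space"
  assumes hom: "homeomorphism S T f g" and dim: "aff_dim S = aff_dim T"
  shows "f ` rel_interior S = rel_interior T"
proof
  have inv: "\<And>x. x \<in> S \<Longrightarrow> g (f x) = x" "\<And>y. y \<in> T \<Longrightarrow> f (g y) = y"
    and img: "f ` S = T" "g ` T = S" and cont: "continuous_on S f" "continuous_on T g"
    using hom by (auto simp: homeomorphism_def)
  have inj: "inj_on f S" "inj_on g T" using inv by (metis inj_onI)+
  show "f ` rel_interior S \<subseteq> rel_interior T"
    using dim cont img inj by (intro image_rel_interior_subset) auto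
  have "g ` rel_interior T \<subseteq> rel_interior S"
    using dim cont img inj by (intro image_rel_interior_subset) auto
  then show "rel_interior T \<subseteq> f ` rel_interior S"
    using inv(2) rel_interior_subset[of T] by (force simp: image_iff subset_iff)
qed

lemma homeomorphism_imp_homeomorphic_map:
  assumes "homeomorphism S T f g"
  shows "homeomorphic_map (top_of_set S) (top_of_set T) f"
  unfolding homeomorphic_map_maps homeomorphic_maps_def
  using assms by (intro exI[of _ g]) (auto simp: homeomorphism_def)

text \<open>
  A compact convex set is homeomorphic to a ball of its dimension, and by
  \<open>homeomorphism_rel_interior\<close> every such homeomorphism takes the open ball to the
  relative interior. This is the source of all attaching maps.
\<close>
lemma homeomorphic_map_unit_disc_closure:
  fixes O' :: "'a::euclidean_space set"
  assumes conv: "convex O'" and bd: "bounded O'" and ne: "O' \<noteq> {}" and ro: "rel_interior O' = O'"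
  obtains f where "homeomorphic_map (unit_disc (nat (aff_dim O'))) (top_of_set (closure O')) f"
    "f ` open_disc (nat (aff_dim O')) = O'"
proof -
  define d where "d = nat (aff_dim O')"
  have d: "int d = aff_dim O'" "d \<le> DIM('a)"
    using ne aff_dim_geq[of O'] aff_dim_empty[of O'] aff_dim_le_DIM[of O'] by (auto simp: d_def)
  obtain L :: "'a set" where L: "subspace L" "dim L = d"
    using choose_subspace_of_subspace[of d "UNIV :: 'a set"] d(2) unfolding dim_UNIV by blast
  let ?D = "cball 0 1 \<inter> L"
  have dL: "aff_dim L = d" by (simp add: L aff_dim_subspace)
  have relD: "rel_interior ?D = ball 0 1 \<inter> L" "aff_dim ?D = d"
  proof -
    have 0: "0 \<in> interior (cball 0 1) \<inter> L" "0 \<in> L \<inter> interior (cball 0 1)"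
      using L subspace_0[of L] by (auto simp: interior_cball)
    have "rel_interior (cball 0 1 \<inter> L) = interior (cball 0 1) \<inter> L"
      by (rule rel_interior_convex_Int_affine[OF convex_cball subspace_imp_affine[OF L(1)]])
        (use 0(1) in blast)
    then show "rel_interior ?D = ball 0 1 \<inter> L" by (simp add: interior_cball)
    have "aff_dim (L \<inter> cball 0 1) = aff_dim L"
      by (rule aff_dim_convex_Int_nonempty_interior[OF subspace_imp_convex[OF L(1)]])
        (use 0(2) in blast)
    then show "aff_dim ?D = d" by (simp add: Int_commute dL)
  qed
  have "?D homeomorphic closure O'"
  proof (rule homeomorphic_convex_compact_sets)
    show "convex ?D" "compact ?D"
      using L by (simp_all add: convex_Int subspace_imp_convex compact_Int_closed closed_subspace)
    show "convex (closure O')" "compact (closure O')" using conv bd by (auto simp: compact_closure)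
    show "aff_dim ?D = aff_dim (closure O')" using relD d by simp
  qed
  then obtain h h' where h: "homeomorphism ?D (closure O') h h'" by (auto simp: homeomorphic_def)
  have "h ` rel_interior ?D = rel_interior (closure O')"
    using h relD d by (intro homeomorphism_rel_interior) auto
  then have hO: "h ` (ball 0 1 \<inter> L) = O'" using relD conv ro by (simp add: convex_rel_interior_closure)
  obtain f where f: "homeomorphic_map (unit_disc d) (top_of_set ?D) f" "f ` open_disc d = ball 0 1 \<inter> L"
    using homeomorphic_map_unit_disc_subspace[OF L] by blast
  have "homeomorphic_map (unit_disc d) (top_of_set (closure O')) (h \<circ> f)"
    by (rule homeomorphic_map_compose[OF f(1) homeomorphism_imp_homeomorphic_map[OF h]])
  moreover have "(h \<circ> f) ` open_disc d = O'" using f(2) hO by (metis image_comp)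
  ultimately show ?thesis using that unfolding d_def by blast
qed


section \<open>Regular CW complexes of convex cells\<close>

definition orthant_sphere :: "(real^'n) set" where
  "orthant_sphere = {C. norm C = 1 \<and> (\<forall>i. 0 \<le> C $ i)}"

definition prob_simplex :: "(real^'n) set" where
  "prob_simplex = {u. (\<Sum>i\<in>UNIV. u $ i) = 1 \<and> (\<forall>i. 0 \<le> u $ i)}"

definition squares :: "real^'n \<Rightarrow> real^'n" where
  "squares C = (\<chi> i. (C $ i)\<^sup>2)"

definition roots :: "real^'n \<Rightarrow> real^'n" where
  "roots u = (\<chi> i. sqrt (u $ i))"

lemma squares_nth [simp]: "squares C $ i = (C $ i)\<^sup>2" by (simp add: squares_def)

lemma norm_power2_vec: "(norm (x :: ('b::real_normed_vector)^'n))\<^sup>2 = (\<Sum>i\<in>UNIV. (norm (x $ i))\<^sup>2)"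
  by (simp add: norm_vec_def L2_set_def sum_nonneg)

lemma norm_eq_1_iff: "norm (C :: real^'n) = 1 \<longleftrightarrow> (\<Sum>i\<in>UNIV. (C $ i)\<^sup>2) = 1"
proof -
  have "norm C = 1 \<longleftrightarrow> (norm C)\<^sup>2 = 1"
    using power2_eq_iff_nonneg[of "norm C" 1] by simp
  then show ?thesis by (simp add: norm_power2_vec)
qed

text \<open>
  Squaring the coordinates turns spherical cells into flat ones and quadratic forms in
  \<open>C\<^sub>i\<^sup>2\<close> into linear forms. Convexity and dimension of cells are therefore
  measured after applying \<open>squares\<close>.
\<close>
lemma homeomorphism_squares: "homeomorphism orthant_sphere prob_simplex squares roots"
proof (rule homeomorphismI)
  show "continuous_on orthant_sphere squares"
    unfolding squares_def by (intro continuous_intros)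
  show "continuous_on prob_simplex roots"
    unfolding roots_def by (intro continuous_intros)
  show "squares ` orthant_sphere \<subseteq> prob_simplex"
    by (auto simp: orthant_sphere_def prob_simplex_def norm_eq_1_iff)
  show "roots ` prob_simplex \<subseteq> orthant_sphere"
    by (auto simp: orthant_sphere_def prob_simplex_def norm_eq_1_iff roots_def)
qed (auto simp: orthant_sphere_def prob_simplex_def squares_def roots_def vec_eq_iff)

lemma closed_orthant_sphere: "closed (orthant_sphere :: (real^'n) set)"
  unfolding orthant_sphere_def by (intro closed_Collect_conj closed_Collect_all closed_Collect_le
      closed_Collect_eq continuous_intros)

lemma compact_orthant_sphere: "compact (orthant_sphere :: (real^'n) set)"
  using closed_orthant_sphere
  by (auto simp: compact_eq_bounded_closed orthant_sphere_def intro!: boundedI[of _ 1])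

text \<open>
  One inclusion is continuity, the other one holds because the image of the compact set
  \<open>closure e\<close> is closed.
\<close>
lemma squares_closure:
  assumes "e \<subseteq> orthant_sphere"
  shows "squares ` closure e = closure (squares ` e)"
proof
  have sub: "closure e \<subseteq> orthant_sphere"
    using assms closed_orthant_sphere by (rule closure_minimal)
  have cont: "continuous_on (closure e) squares" unfolding squares_def by (intro continuous_intros)
  show "squares ` closure e \<subseteq> closure (squares ` e)"
    by (rule image_closure_subset[OF cont closed_closure closure_subset])
  have "compact (squares ` closure e)"
    using cont closed_Int_compact[OF closed_closure compact_orthant_sphere, of e] sub
    by (intro compact_continuous_image) (auto simp: Int_absorb2)
  then show "closure (squares ` e) \<subseteq> squares ` closure e"
    by (intro closure_minimal compact_imp_closed) (auto intro: closure_subset[THEN subsetD])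
qed

text \<open>
  The nonempty cells considered below are relatively open in an affine subspace after squaring, so
  the dimension of the affine hull is their topological dimension.
\<close>
definition cell_dim :: "(real^'n) set \<Rightarrow> nat" where
  "cell_dim e = nat (aff_dim (squares ` e))"

definition attach :: "(real^'n) set \<Rightarrow> (nat \<Rightarrow> real) \<Rightarrow> real^'n" where
  "attach e = (SOME f. homeomorphic_map (unit_disc (cell_dim e)) (top_of_set (closure e)) f \<and>
     f ` open_disc (cell_dim e) = e)"

text \<open>
  After squaring, the cells are convex and relatively open; the closure of a cell is a union of
  cells by the assumption \<open>frontier\<close>.
\<close>
locale convex_cells =
  fixes K :: "(real^'n) set" and E :: "(real^'n) set set"
  assumes fin: "finite E" and part: "partition_on K E" and compact: "compact K"
    and sphere: "K \<subseteq> orthant_sphere"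
    and conv: "\<And>e. e \<in> E \<Longrightarrow> convex (squares ` e)"
    and relopen: "\<And>e. e \<in> E \<Longrightarrow> rel_interior (squares ` e) = squares ` e"
    and frontier: "\<And>e e'. e \<in> E \<Longrightarrow> e' \<in> E \<Longrightarrow> e' \<inter> closure e \<noteq> {} \<Longrightarrow> e' \<subseteq> closure e"
begin

lemma cell_props:
  assumes "e \<in> E"
  shows "e \<subseteq> K" "e \<noteq> {}" "closure e \<subseteq> K" "e \<subseteq> orthant_sphere" "closure e \<subseteq> orthant_sphere"
proof -
  show 1: "e \<subseteq> K" "e \<noteq> {}" using assms part by (auto simp: partition_on_def)
  show "closure e \<subseteq> K" using 1 compact by (intro closure_minimal compact_imp_closed)
  then show "e \<subseteq> orthant_sphere" "closure e \<subseteq> orthant_sphere" using 1 sphere by auto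
qed

lemma cell_unique: "e \<in> E \<Longrightarrow> e' \<in> E \<Longrightarrow> C \<in> e \<Longrightarrow> C \<in> e' \<Longrightarrow> e = e'"
  using part by (auto simp: partition_on_def disjoint_def)

lemma cell_ex: "C \<in> K \<Longrightarrow> \<exists>e\<in>E. C \<in> e"
  using part by (auto simp: partition_on_def)

lemma attach:
  assumes e: "e \<in> E"
  shows "homeomorphic_map (unit_disc (cell_dim e)) (top_of_set (closure e)) (attach e)"
    "attach e ` open_disc (cell_dim e) = e"
proof -
  note p = cell_props[OF e]
  have hom: "homeomorphism (closure e) (squares ` closure e) squares roots"
    by (rule homeomorphism_of_subsets[OF homeomorphism_squares p(5)]) auto
  have "bounded (prob_simplex :: (real^'n) set)"
    using compact_continuous_image[OF homeomorphism_cont1[OF homeomorphism_squares] compact_orthant_sphere]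
      homeomorphism_image1[OF homeomorphism_squares] compact_imp_bounded by metis
  moreover have "squares ` e \<subseteq> prob_simplex"
    using homeomorphism_image1[OF homeomorphism_squares] p(4) by blast
  ultimately have bd: "bounded (squares ` e)" by (rule bounded_subset)
  obtain f where f: "homeomorphic_map (unit_disc (cell_dim e)) (top_of_set (closure (squares ` e))) f"
    "f ` open_disc (cell_dim e) = squares ` e"
    unfolding cell_dim_def
    by (rule homeomorphic_map_unit_disc_closure[OF conv[OF e] bd _ relopen[OF e]]) (use p(2) in simp, blast)
  have "homeomorphic_map (unit_disc (cell_dim e)) (top_of_set (closure e)) (roots \<circ> f)"
    using homeomorphism_imp_homeomorphic_map[OF homeomorphism_symD[OF hom]] f(1)
    unfolding squares_closure[OF p(4)] by (metis homeomorphic_map_compose)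
  moreover have "(roots \<circ> f) ` open_disc (cell_dim e) = e"
  proof -
    have "roots (squares C) = C" if "C \<in> e" for C
      using hom closure_subset that by (auto simp: homeomorphism_def)
    then have "roots ` squares ` e = e" by (simp add: image_image)
    then show ?thesis using f(2) by (metis image_comp)
  qed
  ultimately have "\<exists>f. homeomorphic_map (unit_disc (cell_dim e)) (top_of_set (closure e)) f \<and>
     f ` open_disc (cell_dim e) = e" by blast
  from someI_ex[OF this, folded attach_def]
  show "homeomorphic_map (unit_disc (cell_dim e)) (top_of_set (closure e)) (attach e)"
    "attach e ` open_disc (cell_dim e) = e" by simp_all
qed

text \<open>
  If the dimensions agreed, the two affine hulls would coincide, and the relatively open cell
  \<open>e'\<close> would lie in the relative interior of the closure of \<open>e\<close>, which is
  \<open>e\<close> itself.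
\<close>
lemma face_dim_less:
  assumes e: "e \<in> E" "e' \<in> E" "e' \<subseteq> closure e" "e' \<noteq> e"
  shows "cell_dim e' < cell_dim e"
proof -
  have sub: "squares ` e' \<subseteq> closure (squares ` e)"
    using squares_closure[OF cell_props(4)[OF e(1)]] e(3) by blast
  have ne: "squares ` e \<noteq> {}" "squares ` e' \<noteq> {}" using cell_props(2) e by auto
  have le: "aff_dim (squares ` e') \<le> aff_dim (squares ` e)"
    using aff_dim_subset[OF sub] by simp
  have "aff_dim (squares ` e') \<noteq> aff_dim (squares ` e)"
  proof
    assume eq: "aff_dim (squares ` e') = aff_dim (squares ` e)"
    have "affine hull (squares ` e') \<subseteq> affine hull (closure (squares ` e))"
      using sub by (rule hull_mono)
    then have "affine hull (squares ` e') = affine hull (closure (squares ` e))"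
      using eq ne by (intro affine_dim_equal) auto
    then have "rel_interior (squares ` e') \<subseteq> rel_interior (closure (squares ` e))"
      using sub by (intro subset_rel_interior)
    then have "squares ` e' \<subseteq> squares ` e"
      using relopen conv e by (simp add: convex_rel_interior_closure)
    then have sub': "C \<in> e" if C: "C \<in> e'" for C
    proof -
      obtain D where D: "D \<in> e" "squares C = squares D" using C \<open>squares ` e' \<subseteq> squares ` e\<close> by blast
      have "roots (squares C) = C" "roots (squares D) = D"
        using C D(1) cell_props(4)[OF e(1)] cell_props(4)[OF e(2)]
        by (auto intro!: homeomorphism_apply1[OF homeomorphism_squares])
      then have "C = D" using D(2) by metis
      then show ?thesis using D(1) by metis
    qed
    obtain C where "C \<in> e'" using cell_props(2)[OF e(2)] by blast
    then show False using cell_unique[OF e(1,2) sub'] e(4) by blast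
  qed
  then have "aff_dim (squares ` e') < aff_dim (squares ` e)" using le by simp
  moreover have "0 \<le> aff_dim (squares ` e')"
    using ne(2) aff_dim_geq[of "squares ` e'"] aff_dim_empty[of "squares ` e'"] by linarith
  ultimately show ?thesis by (simp add: cell_dim_def)
qed

lemma closure_of_cell: "e \<in> E \<Longrightarrow> top_of_set K closure_of e = closure e"
  using cell_props(1)[of e] cell_props(3)[of e]
  by (simp add: closure_of_subtopology Int_absorb1)

lemma regular_CW: "regular_CW_complex (top_of_set K) E cell_dim attach"
  unfolding regular_CW_complex_def
proof (intro conjI ballI)
  show "Hausdorff_space (top_of_set K)" by (rule Hausdorff_space_subtopology) simp
  show "finite E" by (rule fin)
  show "partition_on (topspace (top_of_set K)) E" using part by simp
  fix e assume e: "e \<in> E"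
  have sub: "subtopology (top_of_set K) (top_of_set K closure_of e) = top_of_set (closure e)"
    using cell_props[OF e] by (simp add: closure_of_cell[OF e] subtopology_subtopology Int_absorb1)
  show "homeomorphic_map (unit_disc (cell_dim e))
      (subtopology (top_of_set K) (top_of_set K closure_of e)) (attach e)"
    unfolding sub by (rule attach(1)[OF e])
  show "attach e ` open_disc (cell_dim e) = e" by (rule attach(2)[OF e])
  show "attach e ` (topspace (unit_disc (cell_dim e)) - open_disc (cell_dim e))
      \<subseteq> \<Union> {e' \<in> E. cell_dim e' < cell_dim e}"
  proof
    fix C assume "C \<in> attach e ` (topspace (unit_disc (cell_dim e)) - open_disc (cell_dim e))"
    then obtain y where y: "y \<in> topspace (unit_disc (cell_dim e))" "y \<notin> open_disc (cell_dim e)"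
      "C = attach e y" by blast
    have inj: "inj_on (attach e) (topspace (unit_disc (cell_dim e)))"
      and im: "attach e ` topspace (unit_disc (cell_dim e)) = closure e"
      using attach(1)[OF e] by (auto simp: homeomorphic_eq_everything_map)
    have "C \<notin> e"
    proof
      assume "C \<in> e"
      then obtain z where z: "z \<in> open_disc (cell_dim e)" "attach e z = attach e y"
        using attach(2)[OF e] y(3) by (metis imageE)
      moreover have "z \<in> topspace (unit_disc (cell_dim e))"
        using z by (auto simp: open_disc_eq topspace_unit_disc)
      ultimately show False using inj y by (metis inj_onD)
    qed
    moreover have C: "C \<in> closure e" using im y by blast
    moreover obtain e' where e': "e' \<in> E" "C \<in> e'" using C cell_props(3)[OF e] cell_ex by blast
    ultimately have "cell_dim e' < cell_dim e"
      using frontier[OF e e'(1)] by (intro face_dim_less[OF e e'(1)]) auto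
    then show "C \<in> \<Union> {e' \<in> E. cell_dim e' < cell_dim e}" using e' by blast
  qed
qed

end

section \<open>Bundles of tori over sets of directions\<close>

lemma continuous_map_vec_lambda:
  fixes f :: "'n::finite \<Rightarrow> 'x \<Rightarrow> 'b::euclidean_space"
  assumes "\<And>i. continuous_map X euclidean (f i)"
  shows "continuous_map X euclidean (\<lambda>x. \<chi> i. f i x)"
proof -
  have eq: "(\<lambda>x. \<chi> i. f i x) = (\<lambda>x. \<Sum>i\<in>UNIV. axis i (f i x))"
    by (rule ext) (simp add: vec_eq_iff axis_def if_distrib cong: if_cong)
  have "continuous_map euclidean euclidean (axis i :: 'b \<Rightarrow> 'b^'n)" for i
  proof -
    have "continuous_on UNIV (\<lambda>b :: 'b. if j = i then b else 0)" for j
      by (cases "j = i") auto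
    then show ?thesis unfolding axis_def by (simp add: continuous_on_vec_lambda)
  qed
  then have "continuous_map X euclidean (\<lambda>x. axis i (f i x))" for i
    using continuous_map_compose[OF assms[of i], of euclidean "axis i"] by (simp add: o_def)
  then show ?thesis unfolding eq by (intro continuous_map_sum) auto
qed

lemma homeomorphic_map_pullback:
  assumes "inj_on f A" "f ` A = topspace T"
  shows "homeomorphic_map (pullback_topology A f T) T f"
proof -
  have ts: "topspace (pullback_topology A f T) = A"
    using assms(2) by (auto simp: topspace_pullback_topology)
  have "continuous_map (pullback_topology A f T) T (id \<circ> f)"
    by (intro continuous_map_pullback continuous_map_id)
  moreover have "open_map (pullback_topology A f T) T f"
    unfolding open_map_def
  proof (intro allI impI)
    fix U assume "openin (pullback_topology A f T) U"
    then obtain V where V: "openin T V" "U = f -` V \<inter> A"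
      by (auto simp: openin_pullback_topology)
    have "f ` U = V" using V assms(2) openin_subset[OF V(1)] by fast
    then show "openin T (f ` U)" using V by simp
  qed
  ultimately show ?thesis
    using assms by (intro bijective_open_imp_homeomorphic_map) (simp_all add: ts)
qed

text \<open>
  To recognize a subspace of a pulled back topology, it suffices to know its image in the target.
\<close>
lemma subtopology_pullback:
  assumes inj: "inj_on f A" and P: "P \<subseteq> A" and im: "f ` A \<subseteq> topspace T"
    and hom: "homeomorphic_map R (subtopology T (f ` P)) f" and R: "topspace R = P"
  shows "subtopology (pullback_topology A f T) P = R"
  unfolding topology_eq
proof (intro allI iffI)
  fix S assume "openin (subtopology (pullback_topology A f T) P) S"
  then obtain U where U: "openin T U" "S = f -` U \<inter> A \<inter> P"
    by (auto simp: openin_subtopology openin_pullback_topology)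
  then have "f ` S = U \<inter> f ` P" "S \<subseteq> P" using P by auto
  then show "openin R S" using hom U(1) R
    by (auto simp: homeomorphic_map_openness_eq openin_subtopology)
next
  fix S assume "openin R S"
  then obtain U where U: "openin T U" "f ` S = U \<inter> f ` P" and S: "S \<subseteq> P"
    using hom R by (auto simp: homeomorphic_map_openness_eq openin_subtopology)
  have "S = f -` U \<inter> A \<inter> P"
  proof (intro set_eqI iffI)
    fix x assume "x \<in> S" then show "x \<in> f -` U \<inter> A \<inter> P" using U S P by blast
  next
    fix x assume x: "x \<in> f -` U \<inter> A \<inter> P"
    then have "f x \<in> f ` S" using U by blast
    then obtain y where "y \<in> S" "f x = f y" by blast
    then show "x \<in> S" using inj x S P by (metis IntD1 IntD2 inj_onD subsetD)
  qed
  then show "openin (subtopology (pullback_topology A f T) P) S"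
    using U(1) by (auto simp: openin_subtopology openin_pullback_topology)
qed

lemma limitin_homeomorphic_map:
  assumes hom: "homeomorphic_map X Y f" and z: "\<And>m. z m \<in> topspace X" and p: "p \<in> topspace X"
    and lim: "limitin Y (\<lambda>m. f (z m)) (f p) F"
  shows "limitin X z p F"
proof -
  obtain g where g: "homeomorphic_maps X Y f g" using hom by (auto simp: homeomorphic_map_maps)
  have "limitin X (g \<circ> (\<lambda>m. f (z m))) (g (f p)) F"
    using g lim by (intro continuous_map_limit[of Y X g]) (auto simp: homeomorphic_maps_def)
  moreover have "g (f (z m)) = z m" "g (f p) = p" for m
    using g z p by (auto simp: homeomorphic_maps_def)
  ultimately show ?thesis by (simp add: o_def)
qed

text \<open>
  The direction determines the leaf of a nonzero point (\<open>leaf_iff_direction\<close>).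
\<close>
definition direction :: "('b::real_normed_vector)^'n \<Rightarrow> real^'n" where
  "direction p = (\<chi> i. norm (p $ i) / norm p)"

definition support :: "(real^'n) set \<Rightarrow> 'n set" where
  "support e = {i. \<exists>C\<in>e. C $ i \<noteq> 0}"

text \<open>
  The points over \<open>C\<close> form a torus with one circle for each nonzero coordinate of
  \<open>C\<close>: it consists of all points of norm \<open>\<rho> C\<close> on the leaf of
  \<open>C\<close>.
\<close>
definition torus_bundle :: "(real^'n \<Rightarrow> real) \<Rightarrow> (real^'n) set \<Rightarrow> ((real \<times> real)^'n) set" where
  "torus_bundle \<rho> e = {p. p \<noteq> 0 \<and> direction p \<in> e \<and> norm p = \<rho> (direction p)}"

text \<open>
  The phase \<open>s i\<close> has no influence where \<open>C $ i = 0\<close>. In this way circles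
  collapse at the boundary of a cell.
\<close>
definition embed_torus :: "(real^'n \<Rightarrow> real) \<Rightarrow> ('n \<Rightarrow> complex) \<times> (real^'n) \<Rightarrow> (real \<times> real)^'n" where
  "embed_torus \<rho> = (\<lambda>(s, C). \<chi> i. (\<rho> C * C $ i) *\<^sub>R (Re (s i), Im (s i)))"

text \<open>
  The inverse of \<open>embed_torus\<close> over a cell with support \<open>J\<close>: the phases of
  the nonzero coordinates, together with the direction.
\<close>
definition trivialization :: "'n set \<Rightarrow> (real \<times> real)^'n \<Rightarrow> ('n \<Rightarrow> complex) \<times> (real^'n)" where
  "trivialization J p =
     (\<lambda>i\<in>J. Complex (fst (p $ i)) (snd (p $ i)) / of_real (norm (p $ i)), direction p)"

lemma norm_nth_direction: "norm (p $ i) = norm p * direction p $ i"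
  by (cases "p = 0") (simp_all add: direction_def)

lemma direction_in_orthant_sphere:
  assumes "p \<noteq> 0" shows "direction p \<in> orthant_sphere"
proof -
  have "(\<Sum>i\<in>UNIV. (direction p $ i)\<^sup>2) = (\<Sum>i\<in>UNIV. (norm (p $ i))\<^sup>2) / (norm p)\<^sup>2"
    by (simp add: direction_def power_divide sum_divide_distrib)
  also have "\<dots> = 1" using assms by (simp flip: norm_power2_vec)
  finally show ?thesis by (simp add: orthant_sphere_def norm_eq_1_iff) (simp add: direction_def)
qed

lemma direction_eqI:
  assumes C: "C \<in> orthant_sphere" and r: "r > 0" and p: "\<And>i. norm (p $ i) = r * C $ i"
  shows "norm p = r" "direction p = C"
proof -
  have "(norm p)\<^sup>2 = (\<Sum>i\<in>UNIV. (r * C $ i)\<^sup>2)" by (simp add: norm_power2_vec p)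
  also have "\<dots> = r\<^sup>2 * (\<Sum>i\<in>UNIV. (C $ i)\<^sup>2)" by (simp add: power_mult_distrib sum_distrib_left)
  also have "\<dots> = r\<^sup>2" using C norm_eq_1_iff[of C] by (simp add: orthant_sphere_def)
  finally show n: "norm p = r" using r power2_eq_iff_nonneg[of "norm p" r] by simp
  show "direction p = C" using r by (simp add: direction_def vec_eq_iff p n)
qed

lemma leaf_iff_direction:
  assumes C: "C \<in> orthant_sphere"
  shows "p \<in> leaf C \<longleftrightarrow> p \<noteq> 0 \<and> direction p = C"
proof
  assume "p \<in> leaf C"
  then obtain r where r: "r > 0" "\<And>i. norm (p $ i) = r * C $ i" by (auto simp: leaf_def)
  have "norm p = r" "direction p = C" using direction_eqI[OF C r] by auto
  then show "p \<noteq> 0 \<and> direction p = C" using r(1) by auto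
next
  assume p: "p \<noteq> 0 \<and> direction p = C"
  then have "norm p > 0" "\<forall>i. norm (p $ i) = norm p * C $ i"
    using norm_nth_direction[of p] by auto
  then show "p \<in> leaf C" unfolding leaf_def by blast
qed

lemma norm_nth_embed:
  assumes "\<rho> C > 0" "C \<in> orthant_sphere" "C $ i \<noteq> 0 \<Longrightarrow> norm (s i) = 1"
  shows "norm (embed_torus \<rho> (s, C) $ i) = \<rho> C * C $ i"
proof (cases "C $ i = 0")
  case False
  have "norm (Re (s i), Im (s i)) = norm (s i)" by (simp add: norm_prod_def cmod_def)
  moreover have "0 \<le> C $ i" using assms(2) by (simp add: orthant_sphere_def)
  ultimately show ?thesis using assms False
    by (simp add: embed_torus_def abs_mult del: scaleR_Pair)
qed (simp add: embed_torus_def)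

lemma embed_torus_bundle:
  assumes "\<rho> C > 0" "C \<in> orthant_sphere" "\<And>i. C $ i \<noteq> 0 \<Longrightarrow> norm (s i) = 1"
  shows "direction (embed_torus \<rho> (s, C)) = C" "norm (embed_torus \<rho> (s, C)) = \<rho> C"
    "C \<in> e \<Longrightarrow> embed_torus \<rho> (s, C) \<in> torus_bundle \<rho> e"
proof -
  have 1: "norm (embed_torus \<rho> (s, C) $ i) = \<rho> C * C $ i" for i
    using assms by (intro norm_nth_embed)
  show 2: "direction (embed_torus \<rho> (s, C)) = C" "norm (embed_torus \<rho> (s, C)) = \<rho> C"
    using direction_eqI[OF assms(2,1) 1] by auto
  then show "C \<in> e \<Longrightarrow> embed_torus \<rho> (s, C) \<in> torus_bundle \<rho> e"
    using assms(1) by (auto simp: torus_bundle_def)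
qed

lemma embed_trivialization:
  assumes p: "p \<in> torus_bundle \<rho> e" and J: "\<And>i. i \<notin> J \<Longrightarrow> direction p $ i = 0"
  shows "embed_torus \<rho> (trivialization J p) = p"
proof (simp only: vec_eq_iff, intro allI)
  fix i
  have n: "norm (p $ i) = \<rho> (direction p) * direction p $ i"
    using norm_nth_direction[of p i] p by (simp add: torus_bundle_def)
  show "embed_torus \<rho> (trivialization J p) $ i = p $ i"
  proof (cases "p $ i = 0")
    case True
    then have "\<rho> (direction p) * direction p $ i = 0" using n by simp
    then show ?thesis using True by (auto simp: embed_torus_def trivialization_def zero_prod_def)
  next
    case False
    then have "i \<in> J" using n J[of i] by (cases "i \<in> J") auto
    then show ?thesis using False
      by (simp add: embed_torus_def trivialization_def prod_eq_iff flip: n)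
  qed
qed

lemma trivialization_torus:
  assumes p: "p \<in> torus_bundle \<rho> e" and J: "\<And>i. i \<in> J \<Longrightarrow> direction p $ i \<noteq> 0"
  shows "trivialization J p \<in> topspace (torus J) \<times> e"
proof -
  have "norm (Complex (fst (p $ i)) (snd (p $ i)) / of_real (norm (p $ i))) = 1" if "i \<in> J" for i
  proof -
    have "norm (p $ i) \<noteq> 0" using J[OF that] by (auto simp: direction_def)
    moreover have "norm (Complex (fst (p $ i)) (snd (p $ i))) = norm (p $ i)"
      by (simp add: norm_prod_def cmod_def)
    ultimately show ?thesis by (simp add: norm_divide)
  qed
  then show ?thesis using p by (auto simp: trivialization_def torus_def torus_bundle_def)
qed

lemma trivialization_embed:
  assumes "\<rho> C > 0" "C \<in> orthant_sphere" "s \<in> topspace (torus J)" "\<And>i. C $ i \<noteq> 0 \<longleftrightarrow> i \<in> J"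
  shows "trivialization J (embed_torus \<rho> (s, C)) = (s, C)"
proof -
  have s: "\<And>i. C $ i \<noteq> 0 \<Longrightarrow> norm (s i) = 1" "s \<in> extensional J"
    using assms(3,4) by (auto simp: torus_def PiE_iff)
  have "Complex (fst (embed_torus \<rho> (s, C) $ i)) (snd (embed_torus \<rho> (s, C) $ i)) /
     of_real (norm (embed_torus \<rho> (s, C) $ i)) = s i" if "i \<in> J" for i
  proof -
    have "C $ i \<noteq> 0" using assms(4) that by blast
    then have ne: "\<rho> C * C $ i \<noteq> 0" using assms(1) by simp
    have "Complex (fst (embed_torus \<rho> (s, C) $ i)) (snd (embed_torus \<rho> (s, C) $ i))
        = of_real (\<rho> C * C $ i) * s i"
      by (simp add: embed_torus_def complex_eq_iff)
    then show ?thesis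
      using ne norm_nth_embed[of \<rho> C i s] assms(1,2) s(1)[of i] by simp
  qed
  then show ?thesis using embed_torus_bundle(1)[of \<rho> C s, OF assms(1,2) s(1)] s(2)
    by (auto simp: trivialization_def fun_eq_iff extensional_def)
qed

lemma continuous_on_direction: "0 \<notin> S \<Longrightarrow> continuous_on S direction"
  unfolding direction_def by (intro continuous_intros) auto

text \<open>
  If all directions in \<open>e\<close> have the same nonzero coordinates, no circle collapses over
  \<open>e\<close> and the bundle is trivial.
\<close>
lemma homeomorphic_maps_torus_bundle:
  assumes e: "e \<subseteq> orthant_sphere" and cont: "continuous_on e \<rho>" and pos: "\<And>C. C \<in> e \<Longrightarrow> \<rho> C > 0"
    and J: "\<And>C i. C \<in> e \<Longrightarrow> C $ i \<noteq> 0 \<longleftrightarrow> i \<in> J"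
  shows "homeomorphic_maps (prod_topology (torus J) (top_of_set e)) (top_of_set (torus_bundle \<rho> e))
    (embed_torus \<rho>) (trivialization J)"
  unfolding homeomorphic_maps_def
proof (intro conjI ballI)
  let ?P = "prod_topology (torus J) (top_of_set e)"
  have tsP: "topspace ?P = topspace (torus J) \<times> e" by simp
  have unit: "norm (s i) = 1" if "s \<in> topspace (torus J)" "C \<in> e" "C $ i \<noteq> 0" for s C i
    using that J by (auto simp: torus_def PiE_iff)
  show "trivialization J (embed_torus \<rho> x) = x" if "x \<in> topspace ?P" for x
    using that e pos J by (auto intro!: trivialization_embed)
  show emb: "embed_torus \<rho> (trivialization J p) = p" if "p \<in> topspace (top_of_set (torus_bundle \<rho> e))" for p
    using that J by (intro embed_trivialization[of p \<rho> e]) (auto simp: torus_bundle_def)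
  have comp: "continuous_map ?P euclidean (\<lambda>x. (\<rho> (snd x) * snd x $ i) *\<^sub>R (Re (fst x i), Im (fst x i)))" for i
  proof (cases "i \<in> J")
    case True
    have "continuous_map ?P (torus J) fst" by (rule continuous_map_fst)
    moreover have "continuous_map (torus J) euclidean (\<lambda>s. s i)"
      unfolding torus_def using continuous_map_product_projection[OF True, of "\<lambda>_. top_of_set (sphere 0 1)"]
      by (auto simp: continuous_map_in_subtopology)
    ultimately have 1: "continuous_map ?P euclidean (\<lambda>x. fst x i)"
      using continuous_map_compose[of ?P "torus J" fst euclidean "\<lambda>s. s i"] by (simp add: o_def)
    have "continuous_on e (\<lambda>C. \<rho> C * C $ i)" by (intro continuous_intros cont)
    then have 2: "continuous_map ?P euclidean (\<lambda>x. \<rho> (snd x) * snd x $ i)"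
      using continuous_map_compose[of ?P "top_of_set e" snd euclidean "\<lambda>C. \<rho> C * C $ i"]
      by (simp add: o_def continuous_map_snd)
    have "continuous_map ?P (prod_topology euclideanreal euclidean) (\<lambda>x. (\<rho> (snd x) * snd x $ i, fst x i))"
      using 1 2 by (simp add: continuous_map_pairwise o_def del: prod_topology_euclidean)
    moreover have "continuous_map (prod_topology euclideanreal euclidean) euclidean
       (\<lambda>y. fst y *\<^sub>R (Re (snd y), Im (snd y)))"
      by (simp, intro continuous_intros)
    ultimately show ?thesis
      using continuous_map_compose[of ?P "prod_topology euclideanreal euclidean"
         "\<lambda>x. (\<rho> (snd x) * snd x $ i, fst x i)" euclidean "\<lambda>y. fst y *\<^sub>R (Re (snd y), Im (snd y))"]
      by (simp add: o_def)
  next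
    case False
    then have zero: "C $ i = 0" if "C \<in> e" for C using J that by blast
    have "continuous_map ?P euclidean (\<lambda>x. (0 :: real \<times> real))" by simp
    then show ?thesis
      by (rule continuous_map_eq) (use zero in \<open>auto simp: tsP zero_prod_def\<close>)
  qed
  have "continuous_map ?P euclidean (embed_torus \<rho>)"
    using continuous_map_vec_lambda[OF comp] by (simp add: embed_torus_def case_prod_unfold)
  then show "continuous_map ?P (top_of_set (torus_bundle \<rho> e)) (embed_torus \<rho>)"
    unfolding continuous_map_in_subtopology
    using e pos unit by (auto intro!: embed_torus_bundle(3) simp del: topspace_subtopology)
  have z: "0 \<notin> torus_bundle \<rho> e" by (simp add: torus_bundle_def)
  have nz: "p $ i \<noteq> 0" if "p \<in> torus_bundle \<rho> e" "i \<in> J" for p i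
    using that J[of "direction p" i] by (auto simp: torus_bundle_def direction_def)
  have dirJ: "direction p $ i \<noteq> 0" if "p \<in> torus_bundle \<rho> e" "i \<in> J" for p i
    using that J[of "direction p" i] by (auto simp: torus_bundle_def)
  have tr: "trivialization J p \<in> topspace (torus J) \<times> e" if "p \<in> torus_bundle \<rho> e" for p
    using that dirJ by (intro trivialization_torus[OF that]) auto
  let ?phase = "\<lambda>i (p :: (real \<times> real)^'a). Complex (fst (p $ i)) (snd (p $ i)) / of_real (norm (p $ i))"
  have "continuous_on (torus_bundle \<rho> e) (?phase i)" if "i \<in> J" for i
    unfolding Complex_eq
    by (intro continuous_intros) (use nz that in auto)
  moreover have "?phase i p \<in> sphere 0 1" if "p \<in> torus_bundle \<rho> e" "i \<in> J" for p i
    using tr[OF that(1)] that(2) by (auto simp: trivialization_def torus_def PiE_iff)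
  ultimately have 1: "continuous_map (top_of_set (torus_bundle \<rho> e)) (torus J) (\<lambda>p. \<lambda>i\<in>J. ?phase i p)"
    unfolding torus_def by (auto simp: continuous_map_componentwise continuous_map_in_subtopology)
  have 2: "continuous_map (top_of_set (torus_bundle \<rho> e)) (top_of_set e) direction"
    using continuous_on_direction[OF z] by (auto simp: torus_bundle_def)
  show "continuous_map (top_of_set (torus_bundle \<rho> e)) ?P (trivialization J)"
    using 1 2 by (simp add: continuous_map_pairwise trivialization_def o_def)
qed


text \<open>
  A bundle of tori over convex cells. The circles over a cell are labelled by its support, so faces
  use a subset of the labels. The condition on the number of circles distinguishes the toral cells
  of odd and of even dimension.
\<close>
locale toral_cells = convex_cells K E for K :: "(real^'n) set" and E +
  fixes \<rho> :: "real^'n \<Rightarrow> real"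
  assumes \<rho>_cont: "continuous_on K \<rho>" and \<rho>_pos: "\<And>C. C \<in> K \<Longrightarrow> 0 < \<rho> C"
    and same_support: "\<And>e C i. e \<in> E \<Longrightarrow> C \<in> e \<Longrightarrow> i \<in> support e \<Longrightarrow> C $ i \<noteq> 0"
    and card_support: "\<And>e. e \<in> E \<Longrightarrow> card (support e) \<in> {cell_dim e + 1, cell_dim e + 2}"
begin

lemma support_iff: "e \<in> E \<Longrightarrow> C \<in> e \<Longrightarrow> C $ i \<noteq> 0 \<longleftrightarrow> i \<in> support e"
  using same_support by (auto simp: support_def)

lemma support_closure:
  assumes "C \<in> closure e" "i \<notin> support e" shows "C $ i = 0"
proof -
  have "closure e \<subseteq> {C. C $ i = 0}"
    using assms(2) by (intro closure_minimal closed_Collect_eq continuous_intros) (auto simp: support_def)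
  then show ?thesis using assms(1) by blast
qed

lemma support_mono:
  assumes "e \<in> E" "e' \<in> E" "e' \<subseteq> closure e" shows "support e' \<subseteq> support e"
  using support_closure[of _ e] assms(3) by (force simp: support_def[of e'])

lemma bundle_maps:
  assumes "e \<in> E"
  shows "homeomorphic_maps (prod_topology (torus (support e)) (top_of_set e)) (top_of_set (torus_bundle \<rho> e))
    (embed_torus \<rho>) (trivialization (support e))"
  using cell_props[OF assms] \<rho>_pos support_iff[OF assms]
  by (intro homeomorphic_maps_torus_bundle continuous_on_subset[OF \<rho>_cont]) auto

lemma compact_bundle: "compact (torus_bundle \<rho> K)"
proof -
  have "compact (\<rho> ` K)" using compact_continuous_image[OF \<rho>_cont compact] .
  then have bd: "bounded (\<rho> ` K)" and cl: "closed (\<rho> ` K)" by (auto simp: compact_imp_bounded compact_imp_closed)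
  let ?S = "{p :: (real \<times> real)^'n. norm p \<in> \<rho> ` K}"
  have S: "closed ?S" using continuous_closed_vimage[OF cl, of norm] by (simp add: vimage_def)
  have "0 \<notin> ?S" using \<rho>_pos by force
  then have d: "continuous_on ?S direction" by (rule continuous_on_direction)
  let ?S2 = "?S \<inter> direction -` K"
  have S2: "closed ?S2"
    using continuous_closed_preimage[OF d S compact_imp_closed[OF compact]] .
  have c: "continuous_on ?S2 (\<lambda>p. norm p - \<rho> (direction p))"
  proof -
    have "continuous_on ?S2 (\<lambda>p. \<rho> (direction p))"
      using d by (intro continuous_on_compose2[OF \<rho>_cont]) (auto intro: continuous_on_subset)
    then show ?thesis by (intro continuous_intros)
  qed
  have "closed (?S2 \<inter> (\<lambda>p. norm p - \<rho> (direction p)) -` {0})"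
    by (rule continuous_closed_preimage[OF c S2]) simp
  also have "?S2 \<inter> (\<lambda>p. norm p - \<rho> (direction p)) -` {0} = torus_bundle \<rho> K"
    using \<rho>_pos by (force simp: torus_bundle_def)
  finally have "closed (torus_bundle \<rho> K)" .
  moreover have "bounded (torus_bundle \<rho> K)"
  proof -
    obtain B where "\<forall>x\<in>\<rho> ` K. norm x \<le> B" using bd by (auto simp: bounded_iff)
    then have "norm p \<le> B" if "p \<in> torus_bundle \<rho> K" for p
      using that \<rho>_pos by (force simp: torus_bundle_def)
    then show ?thesis by (auto simp: bounded_iff)
  qed
  ultimately show ?thesis by (simp add: compact_eq_bounded_closed)
qed

lemma bundle_Int: "torus_bundle \<rho> (A \<inter> B) = torus_bundle \<rho> A \<inter> torus_bundle \<rho> B"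
  by (auto simp: torus_bundle_def)

lemma closed_bundle:
  assumes "closed A" "A \<subseteq> K" shows "closed (torus_bundle \<rho> A)"
proof -
  have "0 \<notin> torus_bundle \<rho> K" by (simp add: torus_bundle_def)
  then have "closed (torus_bundle \<rho> K \<inter> direction -` A)"
    by (rule continuous_closed_preimage[OF continuous_on_direction compact_imp_closed[OF compact_bundle] assms(1)])
  also have "torus_bundle \<rho> K \<inter> direction -` A = torus_bundle \<rho> A"
    using assms(2) by (auto simp: torus_bundle_def)
  finally show ?thesis .
qed

text \<open>
  A point over the closure of \<open>e\<close> is approached by points over \<open>e\<close> with
  the same phases, where circles that have collapsed get the phase 1.
\<close>
lemma closure_bundle:
  assumes e: "e \<in> E"
  shows "closure (torus_bundle \<rho> e) = torus_bundle \<rho> (closure e)"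
proof
  have "torus_bundle \<rho> e \<subseteq> torus_bundle \<rho> (closure e)"
    using closure_subset by (auto simp: torus_bundle_def)
  then show "closure (torus_bundle \<rho> e) \<subseteq> torus_bundle \<rho> (closure e)"
    using closed_bundle[OF closed_closure cell_props(3)[OF e]] by (rule closure_minimal)
next
  show "torus_bundle \<rho> (closure e) \<subseteq> closure (torus_bundle \<rho> e)"
  proof
    fix p assume p: "p \<in> torus_bundle \<rho> (closure e)"
    then have C: "direction p \<in> closure e" by (auto simp: torus_bundle_def)
    then have CK: "direction p \<in> K" "direction p \<in> orthant_sphere" using cell_props[OF e] by auto
    obtain D where D: "\<And>m. D m \<in> e" "D \<longlonglongrightarrow> direction p" using C by (auto simp: closure_sequential)
    have DK: "D m \<in> K" "D m \<in> orthant_sphere" for m using D(1) cell_props[OF e] by auto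
    define s where "s i = (if p $ i = 0 then 1 else Complex (fst (p $ i)) (snd (p $ i)) / of_real (norm (p $ i)))" for i
    have nC: "norm (Complex (fst (p $ i)) (snd (p $ i))) = norm (p $ i)" for i
      by (simp add: norm_prod_def cmod_def)
    have s: "norm (s i) = 1" for i using nC[of i] by (auto simp: s_def norm_divide)
    have inb: "embed_torus \<rho> (s, D m) \<in> torus_bundle \<rho> e" for m
      using \<rho>_pos[OF DK(1)] DK(2) s D(1) by (intro embed_torus_bundle(3)) auto
    have "(\<lambda>m. \<rho> (D m)) \<longlonglongrightarrow> \<rho> (direction p)"
      using \<rho>_cont DK(1) CK(1) D(2) by (auto simp: continuous_on_sequentially o_def)
    then have "(\<lambda>m. embed_torus \<rho> (s, D m)) \<longlonglongrightarrow> embed_torus \<rho> (s, direction p)"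
      unfolding embed_torus_def prod.case using D(2) by (intro vec_tendstoI) (auto intro!: tendsto_intros simp: o_def)
    also have "embed_torus \<rho> (s, direction p) = p"
    proof -
      have "embed_torus \<rho> (s, direction p) $ i = p $ i" for i
      proof -
        have n: "norm (p $ i) = \<rho> (direction p) * direction p $ i"
          using norm_nth_direction[of p i] p by (simp add: torus_bundle_def)
        show ?thesis
        proof (cases "p $ i = 0")
          case True
          then have "\<rho> (direction p) * direction p $ i = 0" using n by simp
          then show ?thesis using True by (auto simp: embed_torus_def zero_prod_def)
        next
          case False
          then show ?thesis by (simp add: embed_torus_def s_def prod_eq_iff flip: n)
        qed
      qed
      then show ?thesis by (simp add: vec_eq_iff)
    qed
    finally show "p \<in> closure (torus_bundle \<rho> e)" using inb
      unfolding closure_sequential by (intro exI[of _ "\<lambda>m. embed_torus \<rho> (s, D m)"]) auto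
  qed
qed


section \<open>The toral CW complex of a torus bundle\<close>

lemma openin_cell:
  assumes e: "e \<in> E" shows "openin (top_of_set (closure e)) e"
proof -
  have "openin (unit_disc (cell_dim e)) (open_disc (cell_dim e))"
  proof -
    have "continuous_on UNIV (\<lambda>x :: nat \<Rightarrow> real. \<Sum>i<cell_dim e. (x i)\<^sup>2)"
      by (intro continuous_on_sum continuous_on_power continuous_on_product_coordinates)
    then have "open {x :: nat \<Rightarrow> real. (\<Sum>i<cell_dim e. (x i)\<^sup>2) < 1}"
      by (rule open_Collect_less[OF _ continuous_on_const])
    moreover have "open_disc (cell_dim e) = {x. (\<forall>i\<ge>cell_dim e. x i = 0) \<and> (\<Sum>i<cell_dim e. (x i)\<^sup>2) \<le> 1}
       \<inter> {x. (\<Sum>i<cell_dim e. (x i)\<^sup>2) < 1}"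
      by (auto simp: open_disc_eq)
    ultimately show ?thesis by (simp only: unit_disc_eq openin_open_Int)
  qed
  then have "openin (top_of_set (closure e)) (attach e ` open_disc (cell_dim e))"
    using homeomorphic_map_openness[OF attach(1)[OF e]] openin_subset by blast
  then show ?thesis using attach(2)[OF e] by simp
qed

lemma openin_bundle:
  assumes e: "e \<in> E" shows "openin (top_of_set (torus_bundle \<rho> (closure e))) (torus_bundle \<rho> e)"
proof -
  obtain U where U: "open U" "e = closure e \<inter> U" using openin_cell[OF e] by (auto simp: openin_open)
  have "0 \<notin> torus_bundle \<rho> (closure e)" by (simp add: torus_bundle_def)
  from continuous_openin_preimage_gen[OF continuous_on_direction[OF this] U(1)]
  have "openin (top_of_set (torus_bundle \<rho> (closure e))) (torus_bundle \<rho> (closure e) \<inter> direction -` U)" .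
  also have "torus_bundle \<rho> (closure e) \<inter> direction -` U = torus_bundle \<rho> e"
    using U(2) by (auto simp: torus_bundle_def)
  finally show ?thesis .
qed

abbreviation piece where "piece \<equiv> toral_piece cell_dim attach support"

abbreviation tdim where "tdim \<equiv> toral_dim cell_dim support"

abbreviation piece_top where
  "piece_top e e' \<equiv> prod_topology (torus (support e'))
     (subtopology (unit_disc (cell_dim e)) {y. attach e y \<in> e'})"

lemma toral_dim_less:
  assumes "e \<in> E" "e' \<in> E" "e' \<subseteq> closure e" "e' \<noteq> e"
  shows "tdim e' < tdim e"
  using face_dim_less[OF assms] card_mono[OF finite support_mono[OF assms(1-3)]]
  by (simp add: toral_dim_def)

definition closed_ball_points :: "(real^'n) set \<Rightarrow> (('n \<Rightarrow> complex) \<times> (nat \<Rightarrow> real)) set" where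
  "closed_ball_points e = (\<Union>e'\<in>{e' \<in> E. e' \<subseteq> closure e}. piece e e')"

definition attach_bundle :: "(real^'n) set \<Rightarrow> ('n \<Rightarrow> complex) \<times> (nat \<Rightarrow> real) \<Rightarrow> (real \<times> real)^'n" where
  "attach_bundle e = (\<lambda>(s, y). embed_torus \<rho> (s, attach e y))"

text \<open>
  The topology on the closed toral ball is pulled back from phase space. Thus the attaching map is a
  homeomorphism by construction, and the conditions on convergent sequences become statements about
  limits in phase space.
\<close>
definition closed_ball_top :: "(real^'n) set \<Rightarrow> (('n \<Rightarrow> complex) \<times> (nat \<Rightarrow> real)) topology" where
  "closed_ball_top e = pullback_topology (closed_ball_points e) (attach_bundle e)
     (top_of_set (torus_bundle \<rho> (closure e)))"

lemma faces_cover: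
  assumes e: "e \<in> E" and C: "C \<in> closure e"
  obtains e' where "e' \<in> E" "e' \<subseteq> closure e" "C \<in> e'"
proof -
  obtain e' where "e' \<in> E" "C \<in> e'" using cell_ex cell_props(3)[OF e] C by blast
  then show ?thesis using frontier[OF e] C that by blast
qed

lemma attach_map:
  assumes e: "e \<in> E"
  shows "inj_on (attach e) (topspace (unit_disc (cell_dim e)))"
    "attach e ` topspace (unit_disc (cell_dim e)) = closure e"
    "continuous_map (unit_disc (cell_dim e)) (top_of_set (closure e)) (attach e)"
  using attach(1)[OF e] by (auto simp: homeomorphic_eq_everything_map)

text \<open>
  Over a single face the attaching map is the product of the attaching map of the base with the
  identity of the torus, followed by the trivialization of the bundle over that face.
\<close>
lemma attach_bundle_piece:
  assumes e: "e \<in> E" "e' \<in> E" "e' \<subseteq> closure e"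
  shows "homeomorphic_map
      (piece_top e e')
      (top_of_set (torus_bundle \<rho> e')) (attach_bundle e)"
proof -
  have "homeomorphic_map (subtopology (unit_disc (cell_dim e)) {y. attach e y \<in> e'})
      (subtopology (top_of_set (closure e)) e') (attach e)"
    by (rule homeomorphic_map_subtopologies_alt[OF attach(1)[OF e(1)]]) auto
  then have "homeomorphic_map (subtopology (unit_disc (cell_dim e)) {y. attach e y \<in> e'})
      (top_of_set e') (attach e)"
    using e(3) by (simp add: subtopology_subtopology Int_absorb1)
  then obtain h where h: "homeomorphic_maps (subtopology (unit_disc (cell_dim e)) {y. attach e y \<in> e'})
      (top_of_set e') (attach e) h" by (auto simp: homeomorphic_map_maps)
  have "homeomorphic_maps
      (piece_top e e')
      (prod_topology (torus (support e')) (top_of_set e'))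
      (\<lambda>(s, y). (id s, attach e y)) (\<lambda>(s, y). (id s, h y))"
    using h homeomorphic_maps_id[of "torus (support e')" "torus (support e')"]
    by (simp only: homeomorphic_maps_prod) auto
  then have 1: "homeomorphic_map
      (piece_top e e')
      (prod_topology (torus (support e')) (top_of_set e')) (\<lambda>(s, y). (id s, attach e y))"
    by (rule homeomorphic_maps_imp_map)
  have "attach_bundle e = embed_torus \<rho> \<circ> (\<lambda>(s, y). (id s, attach e y))"
    by (auto simp: attach_bundle_def)
  then show ?thesis
    using homeomorphic_map_compose[OF 1 homeomorphic_maps_imp_map[OF bundle_maps[OF e(2)]]] by simp
qed

lemma piece_eq:
  "piece e e' =
   topspace (piece_top e e')"
  by (auto simp: toral_piece_def)

lemma attach_bundle_image:
  assumes e: "e \<in> E" "e' \<in> E" "e' \<subseteq> closure e"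
  shows "attach_bundle e ` piece e e' = torus_bundle \<rho> e'"
    "inj_on (attach_bundle e) (piece e e')"
  using attach_bundle_piece[OF assms] unfolding piece_eq
  by (auto simp: homeomorphic_eq_everything_map simp del: topspace_prod_topology)

lemma bundle_disjoint:
  assumes "e' \<in> E" "e'' \<in> E" "p \<in> torus_bundle \<rho> e'" "p \<in> torus_bundle \<rho> e''" shows "e' = e''"
  using assms cell_unique by (auto simp: torus_bundle_def)

lemma attach_bundle_closed_ball:
  assumes e: "e \<in> E"
  shows "attach_bundle e ` closed_ball_points e = torus_bundle \<rho> (closure e)"
    "inj_on (attach_bundle e) (closed_ball_points e)"
proof -
  have "attach_bundle e ` closed_ball_points e = (\<Union>e'\<in>{e' \<in> E. e' \<subseteq> closure e}. torus_bundle \<rho> e')"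
    unfolding closed_ball_points_def image_UN using attach_bundle_image(1)[OF e] by auto
  also have "\<dots> = torus_bundle \<rho> (closure e)"
    using faces_cover[OF e] by (auto simp: torus_bundle_def) metis
  finally show "attach_bundle e ` closed_ball_points e = torus_bundle \<rho> (closure e)" .
  show "inj_on (attach_bundle e) (closed_ball_points e)"
  proof (rule inj_onI)
    fix x y assume xy: "x \<in> closed_ball_points e" "y \<in> closed_ball_points e"
      and eq: "attach_bundle e x = attach_bundle e y"
    obtain e1 where e1: "e1 \<in> E" "e1 \<subseteq> closure e" "x \<in> piece e e1"
      using xy(1) by (auto simp: closed_ball_points_def)
    obtain e2 where e2: "e2 \<in> E" "e2 \<subseteq> closure e" "y \<in> piece e e2"
      using xy(2) by (auto simp: closed_ball_points_def)
    have "attach_bundle e x \<in> torus_bundle \<rho> e1" "attach_bundle e y \<in> torus_bundle \<rho> e2"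
      using attach_bundle_image(1)[OF e e1(1,2)] attach_bundle_image(1)[OF e e2(1,2)] e1(3) e2(3) by blast+
    then have "e1 = e2" using bundle_disjoint[OF e1(1) e2(1)] eq by simp
    then show "x = y" using attach_bundle_image(2)[OF e e1(1,2)] e1(3) e2(3) eq by (auto dest: inj_onD)
  qed
qed

lemma closed_ball_homeomorphic:
  assumes e: "e \<in> E"
  shows "homeomorphic_map (closed_ball_top e) (top_of_set (torus_bundle \<rho> (closure e))) (attach_bundle e)"
    "topspace (closed_ball_top e) = closed_ball_points e"
  unfolding closed_ball_top_def
  using homeomorphic_map_pullback[OF attach_bundle_closed_ball(2)[OF e]] attach_bundle_closed_ball(1)[OF e]
  by (auto simp: topspace_pullback_topology)

lemma open_piece:
  assumes e: "e \<in> E"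
  shows "topspace (torus (support e)) \<times> open_disc (cell_dim e) = piece e e"
proof -
  have "y \<in> open_disc (cell_dim e) \<longleftrightarrow> y \<in> topspace (unit_disc (cell_dim e)) \<and> attach e y \<in> e" for y
  proof
    assume y: "y \<in> open_disc (cell_dim e)"
    then have "attach e y \<in> e" using attach(2)[OF e] by blast
    then show "y \<in> topspace (unit_disc (cell_dim e)) \<and> attach e y \<in> e"
      using y by (auto simp: open_disc_eq topspace_unit_disc)
  next
    assume y: "y \<in> topspace (unit_disc (cell_dim e)) \<and> attach e y \<in> e"
    then obtain z where z: "z \<in> open_disc (cell_dim e)" "attach e z = attach e y"
      using attach(2)[OF e] by (metis imageE)
    then have "z \<in> topspace (unit_disc (cell_dim e))" by (auto simp: open_disc_eq topspace_unit_disc)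
    then show "y \<in> open_disc (cell_dim e)" using attach_map(1)[OF e] y z by (metis inj_onD)
  qed
  then show ?thesis by (auto simp: toral_piece_def)
qed

lemma attach_bundle_direction:
  assumes e: "e \<in> E" and x: "(s, y) \<in> closed_ball_points e"
  shows "direction (attach_bundle e (s, y)) = attach e y" "attach e y \<in> closure e"
proof -
  obtain e1 where e1: "e1 \<in> E" "e1 \<subseteq> closure e" "(s, y) \<in> piece e e1"
    using x by (auto simp: closed_ball_points_def)
  then have C: "attach e y \<in> e1" "s \<in> topspace (torus (support e1))" by (auto simp: toral_piece_def)
  then show "attach e y \<in> closure e" using e1 by blast
  have "norm (s i) = 1" if "attach e y $ i \<noteq> 0" for i
    using C support_iff[OF e1(1) C(1), of i] that by (auto simp: torus_def PiE_iff)
  then show "direction (attach_bundle e (s, y)) = attach e y"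
    unfolding attach_bundle_def prod.case using cell_props[OF e1(1)] C \<rho>_pos
    by (intro embed_torus_bundle(1)) auto
qed

text \<open>
  Coordinates in the support of the face converge since their phases and moduli do; in the remaining
  coordinates the modulus tends to 0, whatever the phases are.
\<close>
lemma attach_bundle_tendsto:
  assumes e: "e \<in> E" "e'' \<in> E" "e'' \<subseteq> closure e"
    and z: "\<And>m. (s m, x m) \<in> closed_ball_points e" and p: "(t, y) \<in> piece e e''"
    and lim: "limitin (unit_disc (cell_dim e)) x y sequentially"
    and phases: "\<And>i. i \<in> support e'' \<Longrightarrow> (\<lambda>m. s m i) \<longlonglongrightarrow> t i"
  shows "(\<lambda>m. attach_bundle e (s m, x m)) \<longlonglongrightarrow> attach_bundle e (t, y)"
proof -
  have "limitin (top_of_set (closure e)) (attach e \<circ> x) (attach e y) sequentially"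
    using continuous_map_limit[OF attach_map(3)[OF e(1)] lim] .
  then have a: "(\<lambda>m. attach e (x m)) \<longlonglongrightarrow> attach e y" "attach e y \<in> closure e"
    by (auto simp: limitin_subtopology o_def)
  have D: "attach e (x m) \<in> K" "attach e y \<in> K" for m
    using attach_bundle_direction(2)[OF e(1) z] a(2) cell_props(3)[OF e(1)] by auto
  have r: "(\<lambda>m. \<rho> (attach e (x m))) \<longlonglongrightarrow> \<rho> (attach e y)"
    using \<rho>_cont D a(1) by (auto simp: continuous_on_sequentially o_def)
  have co: "(\<lambda>m. attach e (x m) $ i) \<longlonglongrightarrow> attach e y $ i" for i
    using a(1) by (rule tendsto_vec_nth)
  have nrm: "norm (attach_bundle e (s m, x m) $ i) = \<rho> (attach e (x m)) * attach e (x m) $ i" for m i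
  proof -
    have "attach_bundle e (s m, x m) \<in> torus_bundle \<rho> (closure e)"
      using attach_bundle_closed_ball(1)[OF e(1)] z[of m] by blast
    then show ?thesis
      using norm_nth_direction[of "attach_bundle e (s m, x m)" i] attach_bundle_direction(1)[OF e(1) z]
      by (simp add: torus_bundle_def)
  qed
  show ?thesis
  proof (rule vec_tendstoI)
    fix i
    show "(\<lambda>m. attach_bundle e (s m, x m) $ i) \<longlonglongrightarrow> attach_bundle e (t, y) $ i"
    proof (cases "i \<in> support e''")
      case True
      then show ?thesis using r co[of i] phases[of i]
        by (auto simp: attach_bundle_def embed_torus_def intro!: tendsto_intros)
    next
      case False
      have "attach e y \<in> e''" using p by (auto simp: toral_piece_def)
      then have 0: "attach e y $ i = 0" using support_iff[OF e(2)] False by blast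
      have "(\<lambda>m. norm (attach_bundle e (s m, x m) $ i)) \<longlonglongrightarrow> \<rho> (attach e y) * attach e y $ i"
        unfolding nrm by (intro tendsto_intros r co)
      then have "(\<lambda>m. attach_bundle e (s m, x m) $ i) \<longlonglongrightarrow> 0"
        using 0 by (simp add: tendsto_norm_zero_iff)
      then show ?thesis using 0 by (simp add: attach_bundle_def embed_torus_def zero_prod_def)
    qed
  qed
qed

lemma piece_subset: "e' \<in> E \<Longrightarrow> e' \<subseteq> closure e \<Longrightarrow>
    piece e e' \<subseteq> closed_ball_points e"
  by (auto simp: closed_ball_points_def)

text \<open>
  A limit of points over \<open>e'\<close> lies over the closure of \<open>e'\<close>. Hence
  sequences can only leave a piece towards a face, which has lower dimension.
\<close>
lemma closed_ball_frontier:
  assumes e: "e \<in> E" "e' \<in> E" "e'' \<in> E" "e' \<subseteq> closure e" "e'' \<subseteq> closure e"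
    and z: "range z \<subseteq> piece e e'"
    and p: "p \<in> piece e e''"
    and lim: "limitin (closed_ball_top e) z p sequentially"
  shows "e'' \<subseteq> closure e'"
proof -
  have "limitin (top_of_set (torus_bundle \<rho> (closure e))) (attach_bundle e \<circ> z) (attach_bundle e p) sequentially"
    using closed_ball_homeomorphic(1)[OF e(1)] lim
    by (intro continuous_map_limit) (auto simp: homeomorphic_eq_everything_map)
  then have "(\<lambda>m. attach_bundle e (z m)) \<longlonglongrightarrow> attach_bundle e p"
    by (simp add: limitin_subtopology o_def)
  moreover have "attach_bundle e (z m) \<in> torus_bundle \<rho> e'" for m
    using attach_bundle_image(1)[OF e(1,2,4)] z by blast
  ultimately have "attach_bundle e p \<in> closure (torus_bundle \<rho> e')"
    unfolding closure_sequential by (intro exI[of _ "\<lambda>m. attach_bundle e (z m)"]) auto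
  then have "direction (attach_bundle e p) \<in> closure e'"
    unfolding closure_bundle[OF e(2)] by (simp add: torus_bundle_def)
  moreover have "attach_bundle e p \<in> torus_bundle \<rho> e''"
    using attach_bundle_image(1)[OF e(1,3,5)] p by blast
  then have "direction (attach_bundle e p) \<in> e''" by (simp add: torus_bundle_def)
  ultimately show ?thesis using frontier[OF e(2,3)] by blast
qed

lemma dense_piece:
  assumes e: "e \<in> E"
  shows "closed_ball_top e closure_of (piece e e) = topspace (closed_ball_top e)"
proof -
  note hom = closed_ball_homeomorphic[OF e]
  have sub: "piece e e \<subseteq> topspace (closed_ball_top e)"
    unfolding hom(2) by (rule piece_subset[OF e closure_subset])
  have "attach_bundle e ` (closed_ball_top e closure_of piece e e)
     = top_of_set (torus_bundle \<rho> (closure e)) closure_of torus_bundle \<rho> e"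
    using homeomorphic_map_closure_of[OF hom(1) sub] attach_bundle_image(1)[OF e e closure_subset] by simp
  also have "\<dots> = torus_bundle \<rho> (closure e)"
    using closure_bundle[OF e] closure_subset[of "torus_bundle \<rho> e"]
    by (simp add: closure_of_subtopology Int_absorb1)
  also have "\<dots> = attach_bundle e ` topspace (closed_ball_top e)"
    unfolding hom(2) by (rule attach_bundle_closed_ball(1)[OF e, symmetric])
  finally show ?thesis
    using attach_bundle_closed_ball(2)[OF e] closure_of_subset_topspace[of "closed_ball_top e"] hom(2)
    by (metis inj_on_image_eq_iff order_refl)
qed

lemma open_piece_openin:
  assumes e: "e \<in> E"
  shows "openin (closed_ball_top e) (piece e e)"
  using homeomorphic_map_openness_eq[OF closed_ball_homeomorphic(1)[OF e]]
    piece_subset[OF e closure_subset] closed_ball_homeomorphic(2)[OF e]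
    attach_bundle_image(1)[OF e e closure_subset] openin_bundle[OF e] by auto

lemma closed_toral_ball_top:
  assumes e: "e \<in> E"
  shows "closed_toral_ball (top_of_set K) E cell_dim attach support e (closed_ball_top e)"
  unfolding closed_toral_ball_def Let_def closure_of_cell[OF e] open_piece[OF e] dense_piece[OF e]
proof (intro conjI ballI impI allI)
  let ?Z = "closed_ball_top e"
  note hom = closed_ball_homeomorphic[OF e]
  show "topspace ?Z = (\<Union>e'\<in>{e' \<in> E. e' \<subseteq> closure e}. piece e e')"
    unfolding hom(2) closed_ball_points_def ..
  have "metrizable_space (top_of_set (torus_bundle \<rho> (closure e)))"
    by (intro metrizable_space_subtopology metrizable_space_euclidean)
  then show "metrizable_space ?Z"
    using homeomorphic_metrizable_space[OF homeomorphic_map_imp_homeomorphic_space[OF hom(1)]] by blast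
  have "compact (torus_bundle \<rho> (closure e))"
    using closed_Int_compact[OF closed_bundle[OF closed_closure cell_props(3)[OF e]] compact_bundle]
    unfolding bundle_Int[symmetric] using cell_props(3)[OF e] by (simp add: Int_absorb2)
  then have "compact_space (top_of_set (torus_bundle \<rho> (closure e)))"
    by (simp add: compact_space_subtopology)
  then show "compactin ?Z (topspace ?Z)"
    using homeomorphic_compact_space[OF homeomorphic_map_imp_homeomorphic_space[OF hom(1)]]
    by (simp add: compact_space_def)
  show "openin ?Z (piece e e)" by (rule open_piece_openin[OF e])
  fix e' assume "e' \<in> {e' \<in> E. e' \<subseteq> closure e}"
  then have e': "e' \<in> E" "e' \<subseteq> closure e" by auto
  show "subtopology ?Z (piece e e') =
      piece_top e e'"
    unfolding closed_ball_top_def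
  proof (rule subtopology_pullback[OF attach_bundle_closed_ball(2)[OF e] piece_subset[OF e']])
    show "attach_bundle e ` closed_ball_points e \<subseteq> topspace (top_of_set (torus_bundle \<rho> (closure e)))"
      using attach_bundle_closed_ball(1)[OF e] by simp
    have "torus_bundle \<rho> e' \<subseteq> torus_bundle \<rho> (closure e)" using e' by (auto simp: torus_bundle_def)
    then show "homeomorphic_map
        (piece_top e e')
        (subtopology (top_of_set (torus_bundle \<rho> (closure e)))
          (attach_bundle e ` piece e e')) (attach_bundle e)"
      unfolding attach_bundle_image(1)[OF e e'] using attach_bundle_piece[OF e e']
      by (simp add: subtopology_subtopology Int_absorb1)
  qed (rule piece_eq[symmetric])
  fix e'' assume "e'' \<in> {e' \<in> E. e' \<subseteq> closure e}"
  then have e'': "e'' \<in> E" "e'' \<subseteq> closure e" by auto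
  {
    fix z :: "nat \<Rightarrow> _" and p
    assume less: "e' \<noteq> e'' \<and> tdim e' \<le> tdim e''"
      and z: "range z \<subseteq> piece e e' \<and> p \<in> piece e e''"
    show "\<not> limitin ?Z z p sequentially"
    proof
      assume "limitin ?Z z p sequentially"
      then have "e'' \<subseteq> closure e'"
        using closed_ball_frontier[OF e e'(1) e''(1) e'(2) e''(2)] z by blast
      then show False using toral_dim_less[OF e'(1) e''(1)] less by force
    qed
  next
    fix s :: "nat \<Rightarrow> _" and x t y
    assume A: "(\<forall>m. (s m, x m) \<in> piece e e') \<and>
       (t, y) \<in> piece e e'' \<and>
       limitin (unit_disc (cell_dim e)) x y sequentially \<and> (\<forall>i\<in>support e''. (\<lambda>m. s m i) \<longlonglongrightarrow> t i)"
    then have z: "\<And>m. (s m, x m) \<in> closed_ball_points e" and p: "(t, y) \<in> closed_ball_points e"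
      using piece_subset[OF e'] piece_subset[OF e''] by blast+
    have "(\<lambda>m. attach_bundle e (s m, x m)) \<longlonglongrightarrow> attach_bundle e (t, y)"
      using A by (intro attach_bundle_tendsto[OF e e'' z]) auto
    moreover have "attach_bundle e (s m, x m) \<in> torus_bundle \<rho> (closure e)"
      "attach_bundle e (t, y) \<in> torus_bundle \<rho> (closure e)" for m
      using attach_bundle_closed_ball(1)[OF e] z p by blast+
    ultimately have "limitin (top_of_set (torus_bundle \<rho> (closure e)))
        (\<lambda>m. attach_bundle e (s m, x m)) (attach_bundle e (t, y)) sequentially"
      by (simp add: limitin_subtopology)
    then show "limitin ?Z (\<lambda>m. (s m, x m)) (t, y) sequentially"
      using z p hom(2) by (intro limitin_homeomorphic_map[OF hom(1)]) auto
  }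
qed simp

theorem toral_CW_bundle:
  "toral_CW_complex (top_of_set (torus_bundle \<rho> K)) (torus_bundle \<rho>) support
     (\<lambda>e. trivialization (support e)) (top_of_set K) E cell_dim attach"
  unfolding toral_CW_complex_def
proof (intro conjI ballI impI)
  show "Hausdorff_space (top_of_set (torus_bundle \<rho> K))" by (rule Hausdorff_space_subtopology) simp
  show "regular_CW_complex (top_of_set K) E cell_dim attach" by (rule regular_CW)
  have ne: "torus_bundle \<rho> e \<noteq> {}" if e: "e \<in> E" for e
  proof -
    obtain C where C: "C \<in> e" using cell_props(2)[OF e] by blast
    have "embed_torus \<rho> (\<lambda>_. 1, C) \<in> torus_bundle \<rho> e"
      using C cell_props[OF e] \<rho>_pos by (intro embed_torus_bundle(3)) auto
    then show ?thesis by blast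
  qed
  show inj: "inj_on (torus_bundle \<rho>) E"
    using ne bundle_disjoint by (metis all_not_in_conv inj_onI)
  have "\<Union> (torus_bundle \<rho> ` E) = torus_bundle \<rho> K"
    using part by (auto simp: torus_bundle_def partition_on_def)
  moreover have "disjoint (torus_bundle \<rho> ` E)"
    using bundle_disjoint by (fastforce simp: disjoint_def)
  moreover have "{} \<notin> torus_bundle \<rho> ` E" using ne by auto
  ultimately show "partition_on (topspace (top_of_set (torus_bundle \<rho> K))) (torus_bundle \<rho> ` E)"
    by (simp add: partition_on_def)
  fix e assume e: "e \<in> E"
  show "finite (support e)" "card (support e) \<in> {cell_dim e + 1, cell_dim e + 2}"
    using card_support[OF e] by auto
  have subK: "torus_bundle \<rho> e \<subseteq> torus_bundle \<rho> K" "torus_bundle \<rho> (closure e) \<subseteq> torus_bundle \<rho> K"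
    using cell_props[OF e] by (auto simp: torus_bundle_def)
  have "homeomorphic_map (top_of_set (torus_bundle \<rho> e)) (prod_topology (torus (support e)) (top_of_set e))
      (trivialization (support e))"
    using bundle_maps[OF e] homeomorphic_maps_map by blast
  then show "homeomorphic_map (subtopology (top_of_set (torus_bundle \<rho> K)) (torus_bundle \<rho> e))
      (prod_topology (torus (support e)) (subtopology (top_of_set K) e)) (trivialization (support e))"
    using subK cell_props[OF e] by (simp add: subtopology_subtopology Int_absorb1)
  have clo: "top_of_set (torus_bundle \<rho> K) closure_of torus_bundle \<rho> e = torus_bundle \<rho> (closure e)"
    using subK by (simp add: closure_of_subtopology Int_absorb1 closure_bundle[OF e])
  let ?TB = "topspace (torus (support e)) \<times> open_disc (cell_dim e)"
  show "\<exists>Z \<Phi>. closed_toral_ball (top_of_set K) E cell_dim attach support e Z \<and>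
      homeomorphic_map Z (subtopology (top_of_set (torus_bundle \<rho> K))
        (top_of_set (torus_bundle \<rho> K) closure_of torus_bundle \<rho> e)) \<Phi> \<and>
      \<Phi> ` (Z frontier_of ?TB)
        \<subseteq> \<Union> (torus_bundle \<rho> ` {e' \<in> E. tdim e' < tdim e}) \<and>
      (\<forall>s\<in>topspace (torus (support e)). \<forall>y\<in>open_disc (cell_dim e).
         \<Phi> (s, y) \<in> torus_bundle \<rho> e \<and> trivialization (support e) (\<Phi> (s, y)) = (s, attach e y))"
  proof (intro exI[of _ "closed_ball_top e"] exI[of _ "attach_bundle e"] conjI ballI)
    show "closed_toral_ball (top_of_set K) E cell_dim attach support e (closed_ball_top e)"
      by (rule closed_toral_ball_top[OF e])
    show "homeomorphic_map (closed_ball_top e) (subtopology (top_of_set (torus_bundle \<rho> K))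
        (top_of_set (torus_bundle \<rho> K) closure_of torus_bundle \<rho> e)) (attach_bundle e)"
      unfolding clo using closed_ball_homeomorphic(1)[OF e] subK
      by (simp add: subtopology_subtopology Int_absorb1)
    have fr: "closed_ball_top e frontier_of ?TB
        = closed_ball_points e - piece e e"
      unfolding open_piece[OF e] frontier_of_def dense_piece[OF e]
      using open_piece_openin[OF e] by (simp add: interior_of_openin closed_ball_homeomorphic(2)[OF e])
    show "attach_bundle e ` (closed_ball_top e frontier_of ?TB)
        \<subseteq> \<Union> (torus_bundle \<rho> ` {e' \<in> E. tdim e' < tdim e})"
    proof
      fix p assume "p \<in> attach_bundle e ` (closed_ball_top e frontier_of ?TB)"
      then obtain x where x: "x \<in> closed_ball_points e" "x \<notin> piece e e"
        "p = attach_bundle e x" unfolding fr by blast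
      obtain e' where e': "e' \<in> E" "e' \<subseteq> closure e" "x \<in> piece e e'"
        using x(1) by (auto simp: closed_ball_points_def)
      have "e' \<noteq> e" using x e' by auto
      then have "tdim e' < tdim e"
        by (rule toral_dim_less[OF e e'(1,2)])
      moreover have "p \<in> torus_bundle \<rho> e'"
        using attach_bundle_image(1)[OF e e'(1,2)] e'(3) x(3) by blast
      ultimately show "p \<in> \<Union> (torus_bundle \<rho> ` {e' \<in> E. tdim e' < tdim e})"
        using e'(1) by blast
    qed
    fix s y assume sy: "s \<in> topspace (torus (support e))" "y \<in> open_disc (cell_dim e)"
    then have "(s, y) \<in> piece e e" using open_piece[OF e] by blast
    then show "attach_bundle e (s, y) \<in> torus_bundle \<rho> e"
      using attach_bundle_image(1)[OF e e closure_subset] by blast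
    have "attach e y \<in> e" using sy attach(2)[OF e] by blast
    then show "trivialization (support e) (attach_bundle e (s, y)) = (s, attach e y)"
      using bundle_maps[OF e] sy by (simp add: homeomorphic_maps_def attach_bundle_def)
  qed
next
  fix e e' assume "e \<in> E" "e' \<in> E" "e' \<subseteq> top_of_set K closure_of e"
  then show "support e' \<subseteq> support e" using support_mono by (simp add: closure_of_cell)
qed

end

section \<open>Scalar equations and radial dynamics\<close>

text \<open>
  The solution is the inverse of the time function \<open>T x = \<integral> 1 / F\<close>. Since
  \<open>F\<close> vanishes at \<open>b\<close> and is Lipschitz there, \<open>T\<close> grows at
  least like a positive multiple of \<open>- ln (b - x)\<close>; so the solution exists for all
  positive times and needs infinite time to reach \<open>b\<close>.
\<close>
lemma scalar_flow_up:
  fixes F F' :: "real \<Rightarrow> real"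
  assumes der: "\<And>x. (F has_real_derivative F' x) (at x)" and contF': "continuous_on UNIV F'"
    and ab: "a < b" and zero: "F b = 0" and pos: "\<And>x. a \<le> x \<Longrightarrow> x < b \<Longrightarrow> 0 < F x"
  obtains u where "u 0 = a" "\<And>t. t \<ge> 0 \<Longrightarrow> (u has_real_derivative F (u t)) (at t)"
    "\<And>t. t \<ge> 0 \<Longrightarrow> a \<le> u t \<and> u t < b" "(u \<longlongrightarrow> b) at_top"
proof -
  have contF: "isCont F x" for x using DERIV_isCont[OF der] .
  have contFon: "continuous_on S F" for S
    using contF by (simp add: continuous_at_imp_continuous_on)
  obtain L where L: "L > 0" "\<And>x. x \<in> {a..b} \<Longrightarrow> \<bar>F' x\<bar> \<le> L"
  proof -
    have "bounded (F' ` {a..b})"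
      using contF' by (intro compact_imp_bounded compact_continuous_image continuous_on_subset[OF contF']) auto
    then obtain B where "B > 0" "\<forall>y\<in>F' ` {a..b}. norm y \<le> B" by (auto simp: bounded_pos)
    then show ?thesis using that[of B] by auto
  qed
  have lip: "F x \<le> L * (b - x)" if x: "a \<le> x" "x < b" for x
  proof -
    obtain z where z: "x < z" "z < b" "F b - F x = (b - x) * F' z"
      using MVT2[OF x(2), of F F'] der by blast
    have "- F' z \<le> L" using L(2)[of z] z x by auto
    then have "(b - x) * (- F' z) \<le> (b - x) * L" using x by (intro mult_left_mono) auto
    then show ?thesis using z(3) zero by (simp add: mult.commute)
  qed
  \<comment> \<open>The time function starts to the left of \<open>a\<close>, so that its inverse is
    differentiable on both sides of time 0.\<close>
  obtain c where c: "c < a" "\<And>x. c \<le> x \<Longrightarrow> x < b \<Longrightarrow> 0 < F x"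
  proof -
    have "eventually (\<lambda>x. F x > 0) (nhds a)"
      using contF[of a] pos[of a] ab by (intro order_tendstoD(1)[of F "F a"]) (auto simp: isCont_def tendsto_at_iff_tendsto_nhds)
    then obtain d where d: "d > 0" "\<And>x. dist x a < d \<Longrightarrow> F x > 0"
      unfolding eventually_nhds_metric by blast
    show ?thesis
    proof (rule that[of "a - d/2"])
      show "a - d/2 < a" using d by simp
      fix x assume x: "a - d/2 \<le> x" "x < b"
      show "0 < F x"
      proof (cases "a \<le> x")
        case False then show ?thesis using x d by (intro d(2)) (auto simp: dist_real_def)
      qed (use x pos in auto)
    qed
  qed
  define T where "T x = integral {c..x} (\<lambda>y. 1 / F y) - integral {c..a} (\<lambda>y. 1 / F y)" for x
  have Tder: "(T has_real_derivative 1 / F x) (at x)" if x: "c < x" "x < b" for x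
  proof -
    define d where "d = (x + b) / 2"
    have d: "x < d" "d < b" using x by (auto simp: d_def)
    have "continuous_on {c..d} (\<lambda>y. 1 / F y)"
      using c(2) d by (intro continuous_intros contFon) (fastforce)
    then have "((\<lambda>x. integral {c..x} (\<lambda>y. 1 / F y)) has_real_derivative 1 / F x) (at x within {c..d})"
      using x d by (intro integral_has_real_derivative) auto
    moreover have "at x within {c..d} = at x" using x d by (intro at_within_Icc_at) auto
    ultimately show ?thesis unfolding T_def by (auto intro!: derivative_eq_intros)
  qed
  have Tcont: "isCont T x" if "c < x" "x < b" for x using DERIV_isCont[OF Tder[OF that]] .
  have Tmono: "T x < T y" if "c < x" "x < y" "y < b" for x y
    using that(2)
  proof (rule DERIV_pos_imp_increasing)
    fix z assume "x \<le> z" "z \<le> y"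
    then show "\<exists>w. (T has_real_derivative w) (at z) \<and> 0 < w"
      using Tder[of z] c(2)[of z] that by (intro exI[of _ "1 / F z"]) auto
  qed
  have Ta: "T a = 0" by (simp add: T_def)
  have Tlow: "(ln (b - a) - ln (b - x)) / L \<le> T x" if x: "a \<le> x" "x < b" for x
  proof -
    let ?D = "\<lambda>x. T x + ln (b - x) / L"
    have "?D a \<le> ?D x"
    proof (rule DERIV_nonneg_imp_nondecreasing[OF x(1)])
      fix z assume z: "a \<le> z" "z \<le> x"
      have "(?D has_real_derivative (1 / F z - 1 / (b - z) / L)) (at z)"
        using z x c(1) by (auto intro!: derivative_eq_intros Tder simp: divide_inverse)
      moreover have "1 / (L * (b - z)) \<le> 1 / F z"
        using lip[of z] pos[of z] z x by (intro divide_left_mono) auto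
      ultimately show "\<exists>w. (?D has_real_derivative w) (at z) \<and> 0 \<le> w"
        by (intro exI[of _ "1 / F z - 1 / (b - z) / L"]) (auto simp: mult.commute)
    qed
    then show ?thesis using Ta by (simp add: diff_divide_distrib)
  qed
  have ex: "\<exists>x. c' \<le> x \<and> x < b \<and> T x = t" if c': "c < c'" "c' \<le> a" and t: "T c' \<le> t" for c' t
  proof -
    \<comment> \<open>The lower bound \<open>Tlow\<close> equals \<open>max 0 t\<close> at the point
      \<open>d\<close>.\<close>
    define d where "d = b - (b - a) * exp (- (L * max 0 t))"
    have e: "exp (- (L * max 0 t)) \<le> 1" using L by simp
    have "(b - a) * exp (- (L * max 0 t)) \<le> b - a"
      by (rule mult_left_le[OF e]) (use ab in simp)
    moreover have "0 < (b - a) * exp (- (L * max 0 t))" using ab by simp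
    ultimately have d: "a \<le> d" "d < b" unfolding d_def by linarith+
    have "ln (b - d) = ln (b - a) - L * max 0 t" using ab by (simp add: d_def ln_mult)
    moreover have "ln (b - a) \<le> L * T d + ln (b - d)" using Tlow[OF d] L by (simp add: field_simps)
    ultimately have "L * max 0 t \<le> L * T d" by linarith
    then have "max 0 t \<le> T d" by (rule mult_left_le_imp_le[OF _ L(1)])
    then have "\<exists>x\<ge>c'. x \<le> d \<and> T x = t"
      using d c' t Tcont by (intro IVT) auto
    then show ?thesis using d by force
  qed
  define c1 where "c1 = (c + a) / 2"
  have c1: "c < c1" "c1 < a" using c(1) by (auto simp: c1_def)
  define u where "u t = (SOME x. c1 \<le> x \<and> x < b \<and> T x = t)" for t
  have u: "c1 \<le> u t \<and> u t < b \<and> T (u t) = t" if "T c1 \<le> t" for t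
    unfolding u_def by (rule someI_ex[OF ex]) (use c1 that in auto)
  have Tc1: "T c1 < 0" using Tmono[of c1 a] c1 ab Ta by simp
  have inj: "x = y" if "c < x" "x < b" "c < y" "y < b" "T x = T y" for x y
    using Tmono[of x y] Tmono[of y x] that by (cases x y rule: linorder_cases) auto
  have uT: "u (T x) = x" if "c1 \<le> x" "x < b" for x
  proof -
    have "T c1 \<le> T x" using Tmono[of c1 x] that c1 by (cases "c1 = x") auto
    from u[OF this] show ?thesis using inj[of "u (T x)" x] c1 that by auto
  qed
  have u_gt: "x < u t" if "c1 \<le> x" "x < b" "T x < t" for x t
  proof -
    have "T c1 \<le> T x" using Tmono[of c1 x] that c1 by (cases "c1 = x") auto
    then have ut: "c1 \<le> u t \<and> u t < b \<and> T (u t) = t" using that by (intro u) auto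
    show ?thesis
    proof (rule ccontr)
      assume "\<not> x < u t"
      then have "T (u t) \<le> T x" using Tmono[of "u t" x] ut that c1 by (cases "u t = x") auto
      then show False using ut that by auto
    qed
  qed
  have u0: "u 0 = a" using uT[of a] c1 ab Ta by simp
  have bounds: "a \<le> u t \<and> u t < b" if "t \<ge> 0" for t
  proof (cases "t = 0")
    case True then show ?thesis using u0 ab by simp
  next
    case False then show ?thesis using u_gt[of a t] u[of t] c1 ab Ta Tc1 that by auto
  qed
  show ?thesis
  proof (rule that[of u])
    fix t :: real assume t: "t \<ge> 0"
    have b: "a \<le> u t" "u t < b" using bounds[OF t] by auto
    have Tu: "T (u t) = t" using u[of t] Tc1 t by auto
    have "isCont u (T (u t))"
    proof (rule isCont_inverse_function2[where f = T and a = c1 and b = "(u t + b) / 2"])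
      show "c1 < u t" "u t < (u t + b) / 2" using b c1 by auto
      fix z assume "c1 \<le> z" "z \<le> (u t + b) / 2"
      then show "u (T z) = z" "isCont T z" using b c1 by (auto intro!: uT Tcont)
    qed
    then have "isCont u t" using Tu by simp
    moreover have "(T has_real_derivative 1 / F (u t)) (at (u t))" using b c1 by (intro Tder) auto
    moreover have "1 / F (u t) \<noteq> 0" using pos[of "u t"] b by auto
    moreover have "T c1 < t" "t < t + 1" using Tc1 t by auto
    ultimately have "(u has_real_derivative inverse (1 / F (u t))) (at t)"
      using u by (intro DERIV_inverse_function[where f = T and a = "T c1" and b = "t + 1"]) auto
    then show "(u has_real_derivative F (u t)) (at t)" by simp
  next
    show "(u \<longlongrightarrow> b) at_top"
    proof (rule order_tendstoI)
      fix y assume "y < b"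
      then have "c1 \<le> max y a" "max y a < b" using c1 ab by auto
      then show "\<forall>\<^sub>F t in at_top. y < u t"
        using u_gt[of "max y a"] by (intro eventually_mono[OF eventually_gt_at_top[of "T (max y a)"]]) fastforce
    next
      fix y assume "b < y"
      then show "\<forall>\<^sub>F t in at_top. u t < y"
        using bounds by (intro eventually_mono[OF eventually_ge_at_top[of 0]]) fastforce
    qed
  qed (use u0 bounds in auto)
qed

lemma scalar_flow_down:
  fixes F F' :: "real \<Rightarrow> real"
  assumes der: "\<And>x. (F has_real_derivative F' x) (at x)" and contF': "continuous_on UNIV F'"
    and ab: "b < a" and zero: "F b = 0" and neg: "\<And>x. b < x \<Longrightarrow> x \<le> a \<Longrightarrow> F x < 0"
  obtains u where "u 0 = a" "\<And>t. t \<ge> 0 \<Longrightarrow> (u has_real_derivative F (u t)) (at t)"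
    "\<And>t. t \<ge> 0 \<Longrightarrow> b < u t \<and> u t \<le> a" "(u \<longlongrightarrow> b) at_top"
proof -
  have der': "((\<lambda>x. - F (- x)) has_real_derivative F' (- x)) (at x)" for x
    using DERIV_minus[OF DERIV_chain2[OF der[of "- x"] DERIV_minus[OF DERIV_ident]]] by simp
  have cont: "continuous_on UNIV (\<lambda>x. F' (- x))"
    by (rule continuous_on_compose2[OF contF']) (auto intro!: continuous_intros)
  obtain v where v: "v 0 = - a" "\<And>t. t \<ge> 0 \<Longrightarrow> (v has_real_derivative - F (- v t)) (at t)"
    "\<And>t. t \<ge> 0 \<Longrightarrow> - a \<le> v t \<and> v t < - b" "(v \<longlongrightarrow> - b) at_top"
    by (rule scalar_flow_up[OF der' cont, of "- a" "- b"]) (use ab zero neg in auto)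
  show ?thesis
  proof (rule that[of "\<lambda>t. - v t"])
    fix t :: real assume "t \<ge> 0"
    then show "((\<lambda>t. - v t) has_real_derivative F (- v t)) (at t)"
      using DERIV_minus[OF v(2)] by simp
    show "b < - v t \<and> - v t \<le> a" using v(3)[OF \<open>t \<ge> 0\<close>] by auto
  qed (use v(1) tendsto_minus[OF v(4)] in auto)
qed


section \<open>The normal form in polar coordinates\<close>

definition quad :: "(nat^'n \<Rightarrow> real) \<Rightarrow> ('b::real_normed_vector)^'n \<Rightarrow> real" where
  "quad a p = (\<Sum>j\<in>UNIV. a (unit_mi j) * (norm (p $ j))\<^sup>2)"

definition quart :: "(nat^'n::{finite,linorder} \<Rightarrow> real) \<Rightarrow> ('b::real_normed_vector)^'n::{finite,linorder} \<Rightarrow> real" where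
  "quart a p = (\<Sum>(j, l)\<in>{(j, l). j \<le> l}. a (unit_mi j + unit_mi l) * (norm (p $ j))\<^sup>2 * (norm (p $ l))\<^sup>2)"

text \<open>
  On a single leaf the growth rate depends on the distance to the origin only. It is defined for
  arbitrary normed coordinates in order to evaluate it both at points of phase space and at
  directions.
\<close>
definition growth :: "(nat^'n::{finite,linorder} \<Rightarrow> real) \<Rightarrow> real \<Rightarrow> ('b::real_normed_vector)^'n::{finite,linorder} \<Rightarrow> real" where
  "growth a \<nu> p = \<nu> + quad a p + quart a p"

lemma quad_scaleR: "quad a (x *\<^sub>R p) = x\<^sup>2 * quad a p"
  by (simp add: quad_def sum_distrib_left power_mult_distrib mult_ac)

lemma quart_scaleR: "quart a (x *\<^sub>R p) = x^4 * quart a p"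
  unfolding quart_def sum_distrib_left
  by (rule sum.cong) (auto simp: power_mult_distrib power4_eq_xxxx power2_eq_square mult_ac)

lemma growth_scaleR: "growth a \<nu> (x *\<^sub>R p) = \<nu> + x\<^sup>2 * quad a p + x^4 * quart a p"
  by (simp add: growth_def quad_scaleR quart_scaleR)

lemma growth_cong:
  assumes "\<And>i. norm (p $ i) = norm (q $ i)"
  shows "quad a p = quad a q" "quart a p = quart a q" "growth a \<nu> p = growth a \<nu> q"
  using assms by (simp_all add: growth_def quad_def quart_def)

lemma continuous_on_growth [continuous_intros]:
  "continuous_on S f \<Longrightarrow> continuous_on S (\<lambda>x. growth a \<nu> (f x))"
  unfolding growth_def quad_def quart_def case_prod_unfold by (intro continuous_intros)

lemma growth_0 [simp]: "growth a \<nu> 0 = \<nu>" by (simp add: growth_def quad_def quart_def)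

definition quarter_turn :: "real \<times> real \<Rightarrow> real \<times> real" where
  "quarter_turn z = (- snd z, fst z)"

definition rot :: "real \<Rightarrow> real \<times> real \<Rightarrow> real \<times> real" where
  "rot \<phi> z = (cos \<phi> * fst z - sin \<phi> * snd z, sin \<phi> * fst z + cos \<phi> * snd z)"

definition twist :: "('n \<Rightarrow> real) \<Rightarrow> (real \<times> real)^'n \<Rightarrow> (real \<times> real)^'n" where
  "twist \<theta> p = (\<chi> i. rot (\<theta> i) (p $ i))"

lemma twist_nth [simp]: "twist \<theta> p $ i = rot (\<theta> i) (p $ i)" by (simp add: twist_def)

lemma norm_rot [simp]: "norm (rot \<phi> z) = norm z"
proof -
  have "(cos \<phi> * fst z - sin \<phi> * snd z)\<^sup>2 + (sin \<phi> * fst z + cos \<phi> * snd z)\<^sup>2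
      = ((cos \<phi>)\<^sup>2 + (sin \<phi>)\<^sup>2) * ((fst z)\<^sup>2 + (snd z)\<^sup>2)"
    by algebra
  then show ?thesis by (simp add: rot_def norm_prod_def add.commute)
qed

lemma norm_twist [simp]: "norm (twist \<theta> p) = norm p"
  by (simp add: norm_vec_def L2_set_def)

lemma rot_0 [simp]: "rot 0 z = z" by (simp add: rot_def)

lemma rot_rot: "rot \<phi> (rot \<psi> z) = rot (\<phi> + \<psi>) z"
  by (simp add: rot_def cos_add sin_add algebra_simps)

lemma rot_add: "rot \<phi> (z + w) = rot \<phi> z + rot \<phi> w"
  by (simp add: rot_def algebra_simps)

lemma rot_scaleR: "rot \<phi> (x *\<^sub>R z) = x *\<^sub>R rot \<phi> z"
  by (simp add: rot_def algebra_simps)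

lemma rot_quarter_turn: "rot \<phi> (quarter_turn z) = quarter_turn (rot \<phi> z)"
  by (simp add: rot_def quarter_turn_def)

lemma quarter_turn_scaleR: "quarter_turn (x *\<^sub>R z) = x *\<^sub>R quarter_turn z"
  by (simp add: quarter_turn_def)

lemma growth_twist [simp]: "growth a \<nu> (twist \<theta> p) = growth a \<nu> p"
  by (rule growth_cong) simp

lemma normal_form_nth:
  "normal_form \<omega> a \<nu> p $ i = \<omega> i *\<^sub>R quarter_turn (p $ i) + growth a \<nu> p *\<^sub>R (p $ i)"
  by (simp add: normal_form_def growth_def quad_def quart_def norm_prod_def quarter_turn_def
      case_prod_unfold prod_eq_iff)

lemma has_vector_derivative_rot:
  assumes \<phi>: "(\<phi> has_real_derivative \<phi>') (at t within S)"
    and z: "(z has_vector_derivative z') (at t within S)"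
  shows "((\<lambda>t. rot (\<phi> t) (z t)) has_vector_derivative rot (\<phi> t) (z' + \<phi>' *\<^sub>R quarter_turn (z t))) (at t within S)"
proof -
  have f: "((\<lambda>t. fst (z t)) has_real_derivative fst z') (at t within S)"
    "((\<lambda>t. snd (z t)) has_real_derivative snd z') (at t within S)"
    using bounded_linear.has_vector_derivative[OF bounded_linear_fst z]
      bounded_linear.has_vector_derivative[OF bounded_linear_snd z]
    by (simp_all add: has_real_derivative_iff_has_vector_derivative)
  show ?thesis unfolding rot_def
    by (rule has_vector_derivative_Pair; unfold has_real_derivative_iff_has_vector_derivative[symmetric])
      (auto intro!: derivative_eq_intros \<phi> f simp: quarter_turn_def algebra_simps)
qed

lemma has_vector_derivative_vec_lambda:
  fixes f :: "'n::finite \<Rightarrow> real \<Rightarrow> 'b::euclidean_space"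
  assumes "\<And>i. (f i has_vector_derivative f' i) (at t within S)"
  shows "((\<lambda>t. \<chi> i. f i t) has_vector_derivative (\<chi> i. f' i)) (at t within S)"
proof -
  have lin: "bounded_linear (axis i :: 'b \<Rightarrow> 'b^'n)" for i
    by (rule linear_conv_bounded_linear[THEN iffD1], rule linearI) (simp_all add: axis_def vec_eq_iff)
  have eq: "(\<chi> i. g i) = (\<Sum>i\<in>UNIV. axis i (g i))" for g :: "'n \<Rightarrow> 'b"
    by (simp add: vec_eq_iff axis_def if_distrib cong: if_cong)
  show ?thesis unfolding eq
    by (intro has_vector_derivative_sum bounded_linear.has_vector_derivative[OF lin] assms)
qed

lemma has_vector_derivative_nth:
  "(u has_vector_derivative u') F \<Longrightarrow> ((\<lambda>t. u t $ i) has_vector_derivative u' $ i) F"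
  by (rule bounded_linear.has_vector_derivative[OF bounded_linear_vec_nth])

text \<open>
  The rotation turns the \<open>i\<close>-th plane with constant speed \<open>\<omega> i\<close>,
  and the growth rate does not see rotations. So a solution of the scalar equation for the radius,
  rotated, solves the system.
\<close>
lemma solution_of_radial:
  assumes I: "is_interval I"
    and x: "\<And>t. t \<in> I \<Longrightarrow> (x has_real_derivative x t * growth a \<nu> (x t *\<^sub>R p)) (at t within I)"
  shows "solution_on (normal_form \<omega> a \<nu>) I (\<lambda>t. twist (\<lambda>i. \<omega> i * t) (x t *\<^sub>R p))"
  unfolding solution_on_def
proof (intro conjI ballI I)
  fix t assume t: "t \<in> I"
  have xp: "((\<lambda>t. x t *\<^sub>R p $ i) has_vector_derivative (x t * growth a \<nu> (x t *\<^sub>R p)) *\<^sub>R p $ i) (at t within I)" for i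
    using has_vector_derivative_scaleR[OF x[OF t] has_vector_derivative_const] by simp
  have "((\<lambda>t. \<omega> i * t) has_real_derivative \<omega> i) (at t within I)" for i
    by (auto intro!: derivative_eq_intros)
  from has_vector_derivative_rot[OF this xp]
  have "((\<lambda>t. twist (\<lambda>i. \<omega> i * t) (x t *\<^sub>R p)) has_vector_derivative
      (\<chi> i. rot (\<omega> i * t) ((x t * growth a \<nu> (x t *\<^sub>R p)) *\<^sub>R p $ i + \<omega> i *\<^sub>R quarter_turn (x t *\<^sub>R p $ i)))) (at t within I)"
    unfolding twist_def vector_scaleR_component by (rule has_vector_derivative_vec_lambda)
  also have "(\<chi> i. rot (\<omega> i * t) ((x t * growth a \<nu> (x t *\<^sub>R p)) *\<^sub>R p $ i + \<omega> i *\<^sub>R quarter_turn (x t *\<^sub>R p $ i)))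
     = normal_form \<omega> a \<nu> (twist (\<lambda>i. \<omega> i * t) (x t *\<^sub>R p))"
    unfolding vec_eq_iff normal_form_nth growth_twist
    by (simp add: rot_add rot_scaleR rot_quarter_turn quarter_turn_scaleR mult_ac add.commute)
  finally show "((\<lambda>t. twist (\<lambda>i. \<omega> i * t) (x t *\<^sub>R p)) has_vector_derivative
      normal_form \<omega> a \<nu> (twist (\<lambda>i. \<omega> i * t) (x t *\<^sub>R p))) (at t within I)" .
qed

text \<open>
  The quotient of \<open>y\<close> and the exponential of the integral has derivative zero.
\<close>
lemma linear_ode_unique:
  fixes y c :: "real \<Rightarrow> real"
  assumes c: "continuous_on {0..T} c"
    and y: "\<And>t. t \<in> {0..T} \<Longrightarrow> (y has_real_derivative c t * y t) (at t within {0..T})"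
    and t: "t \<in> {0..T}"
  shows "y t = exp (integral {0..t} c) * y 0"
proof -
  define A where "A t = integral {0..t} c" for t
  have A: "(A has_real_derivative c t) (at t within {0..T})" if "t \<in> {0..T}" for t
    unfolding A_def by (rule integral_has_real_derivative[OF c that])
  have D: "((\<lambda>t. y t * exp (- A t)) has_real_derivative 0) (at r within {0..T})" if "r \<in> {0..T}" for r
    by (auto intro!: derivative_eq_intros y A that)
  have "y t * exp (- A t) = y 0 * exp (- A 0)"
  proof (rule has_derivative_zero_unique[where f = "\<lambda>t. y t * exp (- A t)"])
    fix r assume "r \<in> {0..T}"
    then show "((\<lambda>t. y t * exp (- A t)) has_derivative (\<lambda>h. 0)) (at r within {0..T})"
      using D[of r] by (simp add: has_field_derivative_def lambda_zero)
  qed (use t in auto)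
  moreover have "A 0 = 0" by (simp add: A_def)
  ultimately have "y t * exp (- A t) * exp (A t) = y 0 * exp (A t)" by simp
  then show ?thesis by (simp add: A_def exp_minus field_simps)
qed

text \<open>
  The rotational part of the field is orthogonal to each coordinate pair. Therefore the squared
  norms of all pairs solve the same linear equation, with coefficient twice the growth rate, and
  remain proportional to their initial values.
\<close>
lemma solution_norms:
  assumes sol: "solution_on (normal_form \<omega> a \<nu>) {0..T} u"
  obtains x where "x 0 = 1" "\<And>t. t \<in> {0..T} \<Longrightarrow> 0 < x t"
    "\<And>t. t \<in> {0..T} \<Longrightarrow> (x has_real_derivative x t * growth a \<nu> (u t)) (at t within {0..T})"
    "\<And>t i. t \<in> {0..T} \<Longrightarrow> norm (u t $ i) = x t * norm (u 0 $ i)"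
proof -
  have der: "(u has_vector_derivative normal_form \<omega> a \<nu> (u t)) (at t within {0..T})" if "t \<in> {0..T}" for t
    using sol that by (auto simp: solution_on_def)
  have contu: "continuous_on {0..T} u"
    unfolding continuous_on_eq_continuous_within using der has_vector_derivative_continuous by blast
  then have contg: "continuous_on {0..T} (\<lambda>t. growth a \<nu> (u t))" by (intro continuous_intros)
  define A where "A t = integral {0..t} (\<lambda>t. growth a \<nu> (u t))" for t
  have A: "(A has_real_derivative growth a \<nu> (u t)) (at t within {0..T})" if "t \<in> {0..T}" for t
    unfolding A_def using integral_has_real_derivative[OF contg that] .
  have m: "((\<lambda>t. u t $ i \<bullet> u t $ i) has_real_derivative 2 * growth a \<nu> (u t) * (u t $ i \<bullet> u t $ i)) (at t within {0..T})"
    if "t \<in> {0..T}" for t i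
  proof -
    have q: "z \<bullet> quarter_turn z = 0" for z by (cases z) (simp add: quarter_turn_def)
    have d: "((\<lambda>t. u t $ i) has_vector_derivative normal_form \<omega> a \<nu> (u t) $ i) (at t within {0..T})"
      by (rule has_vector_derivative_nth[OF der[OF that]])
    from bounded_bilinear.has_vector_derivative[OF bounded_bilinear_inner d d]
    have "((\<lambda>t. u t $ i \<bullet> u t $ i) has_vector_derivative
      (u t $ i \<bullet> normal_form \<omega> a \<nu> (u t) $ i + normal_form \<omega> a \<nu> (u t) $ i \<bullet> u t $ i)) (at t within {0..T})" .
    also have "u t $ i \<bullet> normal_form \<omega> a \<nu> (u t) $ i + normal_form \<omega> a \<nu> (u t) $ i \<bullet> u t $ i
        = 2 * growth a \<nu> (u t) * (u t $ i \<bullet> u t $ i)"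
      by (simp only: inner_commute[of "normal_form \<omega> a \<nu> (u t) $ i"])
        (simp add: normal_form_nth inner_add_right q)
    finally show ?thesis by (simp add: has_real_derivative_iff_has_vector_derivative)
  qed
  have const: "(norm (u t $ i))\<^sup>2 = (exp (A t))\<^sup>2 * (norm (u 0 $ i))\<^sup>2" if t: "t \<in> {0..T}" for t i
  proof -
    have "continuous_on {0..T} (\<lambda>t. 2 * growth a \<nu> (u t))" by (intro continuous_intros contg)
    from linear_ode_unique[OF this m t] have "u t $ i \<bullet> u t $ i = exp (2 * A t) * (u 0 $ i \<bullet> u 0 $ i)"
      by (simp add: A_def)
    then show ?thesis by (simp add: power2_norm_eq_inner flip: exp_double)
  qed
  show ?thesis
  proof (rule that[of "\<lambda>t. exp (A t)"])
    fix t i assume t: "t \<in> {0..T}"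
    have "(norm (u t $ i))\<^sup>2 = (exp (A t) * norm (u 0 $ i))\<^sup>2"
      using const[OF t, of i] by (simp add: power_mult_distrib)
    then show "norm (u t $ i) = exp (A t) * norm (u 0 $ i)"
      using power2_eq_iff_nonneg by (metis exp_ge_zero mult_nonneg_nonneg norm_ge_zero)
  next
    fix t assume t: "t \<in> {0..T}"
    show "((\<lambda>t. exp (A t)) has_real_derivative exp (A t) * growth a \<nu> (u t)) (at t within {0..T})"
      by (auto intro!: derivative_eq_intros A t)
  qed (simp_all add: A_def)
qed


lemma solution_on_subset:
  assumes "solution_on F I u" "J \<subseteq> I" "is_interval J" shows "solution_on F J u"
  using assms unfolding solution_on_def by (meson has_vector_derivative_within_subset subsetD)

lemma solution_on_shift:
  assumes sol: "solution_on F I u" and J: "is_interval J" "\<And>t. t \<in> J \<Longrightarrow> t + c \<in> I"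
  shows "solution_on F J (\<lambda>t. u (t + c))"
  unfolding solution_on_def
proof (intro conjI ballI J(1))
  fix t assume t: "t \<in> J"
  have "(u has_vector_derivative F (u (t + c))) (at (t + c) within I)"
    using sol J(2)[OF t] by (auto simp: solution_on_def)
  then have "(u has_vector_derivative F (u (t + c))) (at (t + c) within (\<lambda>t. t + c) ` J)"
    by (rule has_vector_derivative_within_subset) (use J(2) in auto)
  moreover have "((\<lambda>t. t + c) has_vector_derivative 1) (at t within J)"
    by (auto intro!: derivative_eq_intros)
  ultimately have "((u \<circ> (\<lambda>t. t + c)) has_vector_derivative 1 *\<^sub>R F (u (t + c))) (at t within J)"
    by (intro vector_diff_chain_within) auto
  then show "((\<lambda>t. u (t + c)) has_vector_derivative F (u (t + c))) (at t within J)"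
    by (simp add: o_def)
qed

definition radial_rate :: "(nat^'n::{finite,linorder} \<Rightarrow> real) \<Rightarrow> real \<Rightarrow>
    ('b::real_normed_vector)^'n::{finite,linorder} \<Rightarrow> real \<Rightarrow> real" where
  "radial_rate a \<nu> p x = x * growth a \<nu> (x *\<^sub>R p)"

lemma radial_rate_deriv:
  "(radial_rate a \<nu> p has_real_derivative \<nu> + 3 * quad a p * x\<^sup>2 + 5 * quart a p * x^4) (at x)"
  unfolding radial_rate_def growth_scaleR
  by (auto intro!: derivative_eq_intros simp: field_simps power2_eq_square power4_eq_xxxx eval_nat_numeral)

lemma radial_rate_deriv_cont: "continuous_on UNIV (\<lambda>x. \<nu> + 3 * quad a p * x\<^sup>2 + 5 * quart a p * x^4)"
  by (intro continuous_intros)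

text \<open>
  Here \<open>b\<close> is the multiple of \<open>p\<close> at which the radial equation is at rest,
  and there is no other rest point between \<open>p\<close> and \<open>b *\<^sub>R p\<close>.
\<close>
lemma radial_solution_towards:
  fixes p :: "(real \<times> real)^'n::{finite,linorder}"
  assumes b: "b = 0 \<or> growth a \<nu> (b *\<^sub>R p) = 0" "b \<ge> 0"
    and up: "1 < b \<Longrightarrow> \<forall>x. 1 \<le> x \<and> x < b \<longrightarrow> growth a \<nu> (x *\<^sub>R p) > 0"
    and down: "b < 1 \<Longrightarrow> \<forall>x. b < x \<and> x \<le> 1 \<longrightarrow> growth a \<nu> (x *\<^sub>R p) < 0"
  obtains x where "x 0 = (1::real)" "\<And>t. t \<ge> 0 \<Longrightarrow> 0 < x t \<and> \<bar>x t - b\<bar> \<le> \<bar>1 - b\<bar>"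
    "(x \<longlongrightarrow> b) at_top"
    "\<And>\<omega>. solution_on (normal_form \<omega> a \<nu>) {0..} (\<lambda>t. twist (\<lambda>i. \<omega> i * t) (x t *\<^sub>R p))"
proof -
  have zero: "radial_rate a \<nu> p b = 0" using b by (auto simp: radial_rate_def)
  obtain x where x: "x 0 = (1::real)" "\<And>t. t \<ge> 0 \<Longrightarrow> (x has_real_derivative radial_rate a \<nu> p (x t)) (at t)"
    "\<And>t. t \<ge> 0 \<Longrightarrow> 0 < x t \<and> \<bar>x t - b\<bar> \<le> \<bar>1 - b\<bar>" "(x \<longlongrightarrow> b) at_top"
  proof (cases "b = 1" "1 < b" rule: bool.exhaust[case_product bool.exhaust])
    case True_True then show ?thesis by simp
  next
    case True_False
    then show ?thesis using zero by (intro that[of "\<lambda>_. 1"]) auto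
  next
    case False_True
    obtain u where u: "u 0 = (1::real)" "\<And>t. t \<ge> 0 \<Longrightarrow> (u has_real_derivative radial_rate a \<nu> p (u t)) (at t)"
      "\<And>t. t \<ge> 0 \<Longrightarrow> 1 \<le> u t \<and> u t < b" "(u \<longlongrightarrow> b) at_top"
      by (rule scalar_flow_up[OF radial_rate_deriv radial_rate_deriv_cont _ zero, of 1])
        (use False_True up in \<open>auto simp: radial_rate_def\<close>)
    show ?thesis
    proof (rule that[OF u(1,2) _ u(4)])
      fix t :: real assume "t \<ge> 0" then show "0 < u t \<and> \<bar>u t - b\<bar> \<le> \<bar>1 - b\<bar>" using u(3)[of t] by auto
    qed
  next
    case False_False
    then have b1: "b < 1" by auto
    obtain u where u: "u 0 = (1::real)" "\<And>t. t \<ge> 0 \<Longrightarrow> (u has_real_derivative radial_rate a \<nu> p (u t)) (at t)"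
      "\<And>t. t \<ge> 0 \<Longrightarrow> b < u t \<and> u t \<le> 1" "(u \<longlongrightarrow> b) at_top"
    proof (rule scalar_flow_down[OF radial_rate_deriv radial_rate_deriv_cont b1 zero])
      fix x assume "b < x" "x \<le> 1"
      then show "radial_rate a \<nu> p x < 0"
        using down b1 b(2) by (auto simp: radial_rate_def intro!: mult_pos_neg)
    qed auto
    show ?thesis
    proof (rule that[OF u(1,2) _ u(4)])
      fix t :: real assume "t \<ge> 0" then show "0 < u t \<and> \<bar>u t - b\<bar> \<le> \<bar>1 - b\<bar>" using u(3)[of t] b(2) by auto
    qed
  qed
  have "solution_on (normal_form \<omega> a \<nu>) {0..} (\<lambda>t. twist (\<lambda>i. \<omega> i * t) (x t *\<^sub>R p))" for \<omega>
    using x(2) by (intro solution_of_radial)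
      (auto simp: radial_rate_def is_interval_ci intro: has_field_derivative_at_within)
  then show ?thesis using that x by blast
qed

text \<open>
  The same in backward time, with rest point 0.
\<close>
lemma radial_solution_from_0:
  fixes p :: "(real \<times> real)^'n::{finite,linorder}"
  assumes pos: "\<And>x. 0 < x \<Longrightarrow> x \<le> 1 \<Longrightarrow> growth a \<nu> (x *\<^sub>R p) > 0"
  obtains x where "x 0 = (1::real)" "\<And>t. t \<le> 0 \<Longrightarrow> 0 < x t \<and> x t \<le> 1" "(x \<longlongrightarrow> 0) at_bot"
    "\<And>\<omega>. solution_on (normal_form \<omega> a \<nu>) {..0} (\<lambda>t. twist (\<lambda>i. \<omega> i * t) (x t *\<^sub>R p))"
proof -
  have der: "((\<lambda>x. - radial_rate a \<nu> p x) has_real_derivative - (\<nu> + 3 * quad a p * x\<^sup>2 + 5 * quart a p * x^4)) (at x)" for x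
    by (rule DERIV_minus[OF radial_rate_deriv])
  have cont: "continuous_on UNIV (\<lambda>x. - (\<nu> + 3 * quad a p * x\<^sup>2 + 5 * quart a p * x^4))"
    by (intro continuous_intros)
  obtain y where y: "y 0 = (1::real)" "\<And>t. t \<ge> 0 \<Longrightarrow> (y has_real_derivative - radial_rate a \<nu> p (y t)) (at t)"
    "\<And>t. t \<ge> 0 \<Longrightarrow> 0 < y t \<and> y t \<le> 1" "(y \<longlongrightarrow> 0) at_top"
    by (rule scalar_flow_down[OF der cont, of 0 1]) (use pos in \<open>auto simp: radial_rate_def\<close>)
  have "((\<lambda>t. y (- t)) has_real_derivative radial_rate a \<nu> p (y (- t))) (at t)" if "t \<le> 0" for t
    using DERIV_chain2[OF y(2) DERIV_minus[OF DERIV_ident], of t] that by simp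
  then have "solution_on (normal_form \<omega> a \<nu>) {..0} (\<lambda>t. twist (\<lambda>i. \<omega> i * t) (y (- t) *\<^sub>R p))" for \<omega>
    by (intro solution_of_radial)
      (auto simp: radial_rate_def is_interval_ic intro: has_field_derivative_at_within)
  moreover have "((\<lambda>t. y (- t)) \<longlongrightarrow> 0) at_bot"
    using filterlim_compose[OF y(4) filterlim_uminus_at_top_at_bot] .
  ultimately show ?thesis using that[of "\<lambda>t. y (- t)"] y by simp
qed

text \<open>
  If the growth rate has one sign on the whole leaf, then each point of the leaf tends to the
  origin, in backward or in forward time. This is impossible for a point of least norm of an
  invariant set.
\<close>
lemma no_compact_invariant_set:
  fixes H :: "((real \<times> real)^'n::{finite,linorder}) set"
  assumes C: "\<And>r. r > 0 \<Longrightarrow> \<kappa> * growth a \<nu> (r *\<^sub>R C) > 0" and \<kappa>: "\<kappa> \<noteq> (0 :: real)"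
    and C0: "C \<noteq> 0" and H: "compact H" "H \<noteq> {}" "H \<subseteq> leaf C"
    and inv: "flow_invariant (normal_form \<omega> a \<nu>) H"
  shows False
proof -
  obtain p where p: "p \<in> H" "\<And>q. q \<in> H \<Longrightarrow> norm p \<le> norm q"
    using continuous_attains_inf[OF H(1,2), of norm] by (auto intro: continuous_intros)
  obtain r where r: "r > 0" "\<And>i. norm (p $ i) = r * C $ i" using p(1) H(3) by (auto simp: leaf_def)
  have Cpos: "0 \<le> C $ i" for i using r by (metis norm_ge_zero zero_le_mult_iff less_le_not_le)
  have g: "\<kappa> * growth a \<nu> (x *\<^sub>R p) > 0" if "x > 0" for x
  proof -
    have "growth a \<nu> (x *\<^sub>R p) = growth a \<nu> ((x * r) *\<^sub>R C)"
      using r Cpos that by (intro growth_cong) (simp add: abs_mult)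
    then show ?thesis using C[of "x * r"] r that by simp
  qed
  have pn: "norm p > 0"
  proof -
    have "C = 0" if "p = 0" using r that by (simp add: vec_eq_iff)
    then have "p \<noteq> 0" using C0 by blast
    then show ?thesis by simp
  qed
  show False
  proof (cases "\<kappa> > 0")
    case True
    then have "growth a \<nu> (x *\<^sub>R p) > 0" if "0 < x" "x \<le> 1" for x
      using g[of x] that by (simp add: zero_less_mult_iff)
    then obtain x where x: "x 0 = (1::real)" "\<And>t. t \<le> 0 \<Longrightarrow> 0 < x t \<and> x t \<le> 1" "(x \<longlongrightarrow> 0) at_bot"
      "\<And>\<omega>. solution_on (normal_form \<omega> a \<nu>) {..0} (\<lambda>t. twist (\<lambda>i. \<omega> i * t) (x t *\<^sub>R p))"
      using radial_solution_from_0[of a \<nu> p] by blast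
    have "twist (\<lambda>i. \<omega> i * 0) (x 0 *\<^sub>R p) = p" using x(1) by (simp add: vec_eq_iff)
    then have sub: "(\<lambda>t. twist (\<lambda>i. \<omega> i * t) (x t *\<^sub>R p)) ` {..0} \<subseteq> H"
      using inv x(4) p(1) unfolding flow_invariant_def by fastforce
    have "\<forall>\<^sub>F t in at_bot. x t < 1 \<and> t \<le> 0"
      using order_tendstoD(2)[OF x(3), of 1] by (intro eventually_conj eventually_le_at_bot) auto
    then obtain t where t: "x t < 1" "t \<le> 0" using eventually_happens'[OF trivial_limit_at_bot_linorder] by blast
    have "norm p \<le> norm (twist (\<lambda>i. \<omega> i * t) (x t *\<^sub>R p))" using sub t p(2) by blast
    then show False using t x(2)[OF t(2)] pn by simp
  next
    case False
    then have neg: "growth a \<nu> (x *\<^sub>R p) < 0" if "0 < x" for x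
      using g[OF that] \<kappa> by (simp add: zero_less_mult_iff)
    obtain x where x: "x 0 = (1::real)" "\<And>t. t \<ge> 0 \<Longrightarrow> 0 < x t \<and> \<bar>x t - 0\<bar> \<le> \<bar>1 - 0\<bar>" "(x \<longlongrightarrow> 0) at_top"
      "\<And>\<omega>. solution_on (normal_form \<omega> a \<nu>) {0..} (\<lambda>t. twist (\<lambda>i. \<omega> i * t) (x t *\<^sub>R p))"
      by (rule radial_solution_towards[of 0 a \<nu> p]) (use neg in auto)
    have "twist (\<lambda>i. \<omega> i * 0) (x 0 *\<^sub>R p) = p" using x(1) by (simp add: vec_eq_iff)
    then have sub: "(\<lambda>t. twist (\<lambda>i. \<omega> i * t) (x t *\<^sub>R p)) ` {0..} \<subseteq> H"
      using inv x(4) p(1) unfolding flow_invariant_def by fastforce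
    have "\<forall>\<^sub>F t in at_top. x t < 1 \<and> 0 \<le> t"
      using order_tendstoD(2)[OF x(3), of 1] by (intro eventually_conj eventually_ge_at_top) auto
    then obtain t where t: "x t < 1" "0 \<le> t" using eventually_happens'[OF trivial_limit_at_top_linorder] by blast
    have "norm p \<le> norm (twist (\<lambda>i. \<omega> i * t) (x t *\<^sub>R p))" using sub t p(2) by fastforce
    then show False using t x(2)[OF t(2)] pn by simp
  qed
qed

lemma norm_vec_scale:
  fixes p q :: "('b::real_normed_vector)^'n"
  assumes "\<And>i. norm (q $ i) = x * norm (p $ i)" "0 \<le> x"
  shows "norm q = x * norm p"
proof -
  have "norm q = norm (x *\<^sub>R p)" by (simp add: norm_vec_def assms)
  then show ?thesis using assms(2) by simp
qed

text \<open>
  While the solution stays in the ball, its norm cannot increase; so it never reaches a norm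
  strictly between the initial one and the radius of the ball.
\<close>
lemma solution_norm_nonincreasing:
  fixes v :: "real \<Rightarrow> (real \<times> real)^'n::{finite,linorder}"
  assumes sol: "solution_on (normal_form \<omega> a \<nu>) {0..T} v" and T: "0 \<le> T"
    and neg: "\<And>p :: (real \<times> real, 'n) vec. norm p < r \<Longrightarrow> growth a \<nu> p \<le> 0" and r: "norm (v 0) < r"
  shows "norm (v T) \<le> norm (v 0)"
proof (rule ccontr)
  assume "\<not> norm (v T) \<le> norm (v 0)"
  then have gt: "norm (v 0) < norm (v T)" by simp
  define c where "c = (norm (v 0) + min r (norm (v T))) / 2"
  have c: "norm (v 0) < c" "c < r" "c < norm (v T)" using gt r by (auto simp: c_def min_def)
  have der: "(v has_vector_derivative normal_form \<omega> a \<nu> (v t)) (at t within {0..T})" if "t \<in> {0..T}" for t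
    using sol that by (auto simp: solution_on_def)
  have contv: "continuous_on {0..T} v"
    unfolding continuous_on_eq_continuous_within using der has_vector_derivative_continuous by blast
  let ?S = "{0..T} \<inter> (\<lambda>t. norm (v t)) -` {c..}"
  have "closed ?S" using contv by (intro continuous_closed_preimage continuous_intros) auto
  then have "compact ({0..T} \<inter> ?S)" by (intro compact_Int_closed) auto
  then have S: "compact ?S" by (simp add: Int_left_absorb)
  have "T \<in> ?S" using T c by auto
  then obtain t2 where t2: "t2 \<in> ?S" "\<And>t. t \<in> ?S \<Longrightarrow> t2 \<le> t"
    using compact_attains_inf[OF S] by blast
  have below: "norm (v t) < c" if "0 \<le> t" "t < t2" for t
    using t2(2)[of t] that t2(1) by force
  have sol2: "solution_on (normal_form \<omega> a \<nu>) {0..t2} v"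
    using t2(1) by (intro solution_on_subset[OF sol]) (auto simp: is_interval_cc)
  obtain x where x: "x 0 = 1" "\<And>t. t \<in> {0..t2} \<Longrightarrow> 0 < x t"
    "\<And>t. t \<in> {0..t2} \<Longrightarrow> (x has_real_derivative x t * growth a \<nu> (v t)) (at t within {0..t2})"
    "\<And>t i. t \<in> {0..t2} \<Longrightarrow> norm (v t $ i) = x t * norm (v 0 $ i)"
    using solution_norms[OF sol2] by metis
  have "x t2 \<le> x 0"
  proof (rule DERIV_nonpos_imp_decreasing_open[where f = x])
    show "0 \<le> t2" using t2(1) by auto
    show "continuous_on {0..t2} x" by (rule DERIV_continuous_on[OF x(3)])
    fix t assume t: "0 < t" "t < t2"
    have "(x has_real_derivative x t * growth a \<nu> (v t)) (at t)"
      using x(3)[of t] t by (simp add: at_within_Icc_at)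
    moreover have "x t * growth a \<nu> (v t) \<le> 0"
      using x(2)[of t] neg[of "v t"] below[of t] t c by (auto intro!: mult_nonneg_nonpos)
    ultimately show "\<exists>y. (x has_real_derivative y) (at t) \<and> y \<le> 0" by blast
  qed
  then have "x t2 \<le> 1" "0 < x t2" using x(1) x(2)[of t2] t2(1) by auto
  moreover have "norm (v t2) = x t2 * norm (v 0)"
    using x(2,4)[of t2] t2(1) by (intro norm_vec_scale) auto
  ultimately have "norm (v t2) \<le> norm (v 0)" by (simp add: mult_left_le_one_le)
  then show False using t2(1) c(1) by auto
qed

section \<open>Local equivalence at nonzero parameters and the bifurcation at zero\<close>

text \<open>
  With \<open>\<kappa> = 1 / growth a \<nu> - 1 / growth a \<mu>\<close> this is the difference of
  the times that the flows for \<open>\<nu>\<close> and \<open>\<mu>\<close> need from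
  \<open>p\<close> to the sphere of radius \<open>r\<close>: in the variable \<open>z = ln
  norm\<close> these times are integrals of the inverse growth rate from \<open>ln (norm p)\<close>
  to \<open>ln r\<close>. The interval is rescaled to the unit interval, so that continuity in
  \<open>p\<close> is continuity of an integral in its parameter.
\<close>
definition phase_shift :: "((real \<times> real)^'n \<Rightarrow> real) \<Rightarrow> real \<Rightarrow> (real \<times> real)^'n \<Rightarrow> real" where
  "phase_shift \<kappa> r p =
     integral {0..1} (\<lambda>y. ln (r / norm p) * \<kappa> (exp (y * ln (r / norm p)) *\<^sub>R p))"

lemma phase_shift_cong:
  assumes "\<And>p q. (\<And>i. norm (p $ i) = norm (q $ i)) \<Longrightarrow> \<kappa> p = \<kappa> q"
    and "\<And>i. norm (p $ i) = norm (q $ i)"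
  shows "phase_shift \<kappa> r p = phase_shift \<kappa> r q"
proof -
  have "norm p = norm q" using assms(2) by (simp add: norm_vec_def)
  moreover have "\<kappa> (x *\<^sub>R p) = \<kappa> (x *\<^sub>R q)" for x
    by (rule assms(1)) (simp add: assms(2))
  ultimately show ?thesis by (simp add: phase_shift_def)
qed

lemma continuous_on_phase_shift:
  fixes \<kappa> :: "(real \<times> real)^'n \<Rightarrow> real"
  assumes \<kappa>: "continuous_on (cball 0 r) \<kappa>"
  shows "continuous_on (ball 0 r - {0}) (phase_shift \<kappa> r)"
proof -
  let ?U = "ball 0 r - {0 :: (real \<times> real)^'n}"
  have r: "r > 0" if "p \<in> ?U" for p using le_less_trans[OF norm_ge_zero, of p r] that by simp
  have arg: "continuous_on (?U \<times> cbox 0 1) (\<lambda>z. exp (snd z * ln (r / norm (fst z))) *\<^sub>R fst z)"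
    by (intro continuous_intros) (use r in auto)
  have in_ball: "exp (y * ln (r / norm p)) *\<^sub>R p \<in> cball 0 r" if "p \<in> ?U" "y \<in> cbox 0 1" for p and y :: real
  proof -
    have n: "0 < norm p" "norm p < r" using that by auto
    then have "y * ln (r / norm p) \<le> ln (r / norm p)"
      using that(2) by (intro mult_left_le_one_le ln_ge_zero) auto
    then have "exp (y * ln (r / norm p)) \<le> r / norm p"
      using n by (metis exp_le_cancel_iff exp_ln divide_pos_pos order_less_trans)
    then show ?thesis using n by (simp add: field_simps)
  qed
  have "continuous_on (?U \<times> cbox 0 1)
     (\<lambda>(p, y). ln (r / norm p) * \<kappa> (exp (y * ln (r / norm p)) *\<^sub>R p))"
    unfolding case_prod_unfold
  proof (intro continuous_on_mult)
    show "continuous_on (?U \<times> cbox 0 1) (\<lambda>z. ln (r / norm (fst z)))"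
      by (intro continuous_intros) (use r in auto)
    show "continuous_on (?U \<times> cbox 0 1) (\<lambda>z. \<kappa> (exp (snd z * ln (r / norm (fst z))) *\<^sub>R fst z))"
      by (rule continuous_on_compose2[OF \<kappa> arg]) (use in_ball in force)
  qed
  from integral_continuous_on_param[OF this] show ?thesis
    by (simp add: phase_shift_def[abs_def])
qed

text \<open>
  Along a solution, \<open>phase_shift\<close> is a difference of values of one antiderivative
  \<open>G\<close> of \<open>\<kappa>\<close> along the ray through \<open>u 0\<close>, with upper
  limit independent of time.
\<close>
lemma phase_shift_deriv:
  fixes \<kappa> :: "(real \<times> real)^'n \<Rightarrow> real"
  assumes \<kappa>: "continuous_on (cball 0 r) \<kappa>"
    and cong: "\<And>p q. (\<And>i. norm (p $ i) = norm (q $ i)) \<Longrightarrow> \<kappa> p = \<kappa> q"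
    and nz: "u 0 \<noteq> 0" and x_pos: "\<And>t. t \<in> {0..T} \<Longrightarrow> 0 < x t"
    and x: "\<And>t. t \<in> {0..T} \<Longrightarrow> (x has_real_derivative x t * f t) (at t within {0..T})"
    and u: "\<And>t i. t \<in> {0..T} \<Longrightarrow> norm (u t $ i) = x t * norm (u 0 $ i)"
    and ball: "\<And>t. t \<in> {0..T} \<Longrightarrow> norm (u t) < r" and t: "t \<in> {0..T}"
  shows "((\<lambda>t. phase_shift \<kappa> r (u t)) has_real_derivative - f t * \<kappa> (u t)) (at t within {0..T})"
proof -
  have n0: "norm (u 0) > 0" using nz by simp
  have nu: "norm (u t) = x t * norm (u 0)" if "t \<in> {0..T}" for t
    using u[OF that] x_pos[OF that] by (intro norm_vec_scale) auto
  have r: "r > 0" using ball[OF t] norm_ge_zero[of "u t"] by linarith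
  define z1 where "z1 = ln (r / norm (u 0))"
  have lnx: "continuous_on {0..T} (\<lambda>t. ln (x t))"
    using x_pos DERIV_continuous_on[OF x] by (intro continuous_intros) fastforce+
  obtain t0 where t0: "t0 \<in> {0..T}" "\<And>t. t \<in> {0..T} \<Longrightarrow> ln (x t0) \<le> ln (x t)"
    using continuous_attains_inf[OF _ _ lnx] t by auto
  \<comment> \<open>Any bound strictly below all values of \<open>ln (x t)\<close> can serve as
    lower limit of the antiderivative.\<close>
  define z0 where "z0 = ln (x t0) - 1"
  have z: "z0 < ln (x t) \<and> ln (x t) < z1" if "t \<in> {0..T}" for t
  proof -
    have "x t < r / norm (u 0)" using ball[OF that] nu[OF that] n0 by (simp add: field_simps)
    then have "ln (x t) < z1" using x_pos[OF that] unfolding z1_def by simp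
    then show ?thesis using t0(2)[OF that] by (simp add: z0_def)
  qed
  define k where "k z = \<kappa> (exp z *\<^sub>R u 0)" for z
  have kcont: "continuous_on {z0..z1} k"
    unfolding k_def
  proof (rule continuous_on_compose2[OF \<kappa>])
    have "norm (exp z *\<^sub>R u 0) \<le> r" if "z \<le> z1" for z
    proof -
      have "exp z \<le> r / norm (u 0)" using that r n0 unfolding z1_def
        by (metis exp_le_cancel_iff exp_ln divide_pos_pos)
      then show ?thesis using n0 by (simp add: field_simps)
    qed
    then show "(\<lambda>z. exp z *\<^sub>R u 0) ` {z0..z1} \<subseteq> cball 0 r" by auto
  qed (intro continuous_intros)
  define G where "G z = integral {z0..z} k" for z
  have G: "(G has_real_derivative k z) (at z within {z0..z1})" if "z \<in> {z0..z1}" for z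
    unfolding G_def by (rule integral_has_real_derivative[OF kcont that])
  have shift: "phase_shift \<kappa> r (u t) = G z1 - G (ln (x t))" if t: "t \<in> {0..T}" for t
  proof -
    let ?L = "z1 - ln (x t)"
    have L: "ln (r / norm (u t)) = ?L"
      using r n0 x_pos[OF t] by (simp add: nu[OF t] z1_def ln_div ln_mult)
    have seg: "ln (x t) + y * ?L \<in> {z0..z1}" if "y \<in> {0..1}" for y
    proof -
      have "0 \<le> y * ?L" "y * ?L \<le> ?L" using z[OF t] that by (auto intro: mult_left_le_one_le)
      then show ?thesis unfolding atLeastAtMost_iff using z[OF t] by linarith
    qed
    have \<kappa>k: "\<kappa> (exp (y * ?L) *\<^sub>R u t) = k (ln (x t) + y * ?L)" for y
      unfolding k_def by (rule cong) (simp add: exp_add abs_mult abs_of_pos[OF x_pos[OF t]] x_pos[OF t] u[OF t] mult_ac)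
    have "((\<lambda>y. ?L * k (ln (x t) + y * ?L)) has_integral
        (G (ln (x t) + 1 * ?L) - G (ln (x t) + 0 * ?L))) {0..1}"
    proof (rule fundamental_theorem_of_calculus)
      fix y :: real assume y: "y \<in> {0..1}"
      have "((\<lambda>y. ln (x t) + y * ?L) has_real_derivative ?L) (at y within {0..1})"
        by (auto intro!: derivative_eq_intros)
      moreover have "(G has_real_derivative k (ln (x t) + y * ?L)) (at (ln (x t) + y * ?L) within (\<lambda>y. ln (x t) + y * ?L) ` {0..1})"
        using seg by (intro has_field_derivative_subset[OF G[OF seg[OF y]]]) auto
      ultimately have "((G \<circ> (\<lambda>y. ln (x t) + y * ?L)) has_real_derivative k (ln (x t) + y * ?L) * ?L) (at y within {0..1})"
        by (intro DERIV_image_chain)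
      then show "((\<lambda>y. G (ln (x t) + y * ?L)) has_vector_derivative ?L * k (ln (x t) + y * ?L)) (at y within {0..1})"
        by (simp add: has_real_derivative_iff_has_vector_derivative o_def mult.commute)
    qed simp
    then show ?thesis
      unfolding phase_shift_def L \<kappa>k by (intro integral_unique) simp
  qed
  have "((\<lambda>t. ln (x t)) has_real_derivative f t) (at t within {0..T})"
    using x_pos[OF t] by (auto intro!: derivative_eq_intros x[OF t])
  moreover have "(G has_real_derivative k (ln (x t))) (at (ln (x t)) within (\<lambda>t. ln (x t)) ` {0..T})"
    using z t by (intro has_field_derivative_subset[OF G]) (auto simp: less_imp_le)
  ultimately have "((G \<circ> (\<lambda>t. ln (x t))) has_real_derivative k (ln (x t)) * f t) (at t within {0..T})"
    by (intro DERIV_image_chain)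
  then have "((\<lambda>t. G z1 - G (ln (x t))) has_real_derivative 0 - k (ln (x t)) * f t) (at t within {0..T})"
    by (intro DERIV_diff) (auto simp: o_def)
  moreover have "k (ln (x t)) = \<kappa> (u t)"
    unfolding k_def by (rule cong) (simp add: x_pos[OF t] abs_of_pos[OF x_pos[OF t]] u[OF t])
  ultimately have "((\<lambda>t. G z1 - G (ln (x t))) has_real_derivative - f t * \<kappa> (u t)) (at t within {0..T})"
    by (simp add: mult.commute)
  then show ?thesis
    by (rule has_field_derivative_transform_within[where d = 1]) (use shift t in auto)
qed

text \<open>
  Following the rotations of the normal form for the time \<open>\<alpha> p\<close>, without moving
  along the leaf.
\<close>
definition reparam :: "('n \<Rightarrow> real) \<Rightarrow> ((real \<times> real)^'n \<Rightarrow> real) \<Rightarrow> (real \<times> real)^'n \<Rightarrow> (real \<times> real)^'n" where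
  "reparam \<omega> \<alpha> p = twist (\<lambda>i. \<omega> i * \<alpha> p) p"

lemma reparam_nth: "reparam \<omega> \<alpha> p $ i = rot (\<omega> i * \<alpha> p) (p $ i)"
  by (simp add: reparam_def)

lemma norm_reparam [simp]: "norm (reparam \<omega> \<alpha> p) = norm p" by (simp add: reparam_def)

text \<open>
  At the origin, where \<open>\<alpha>\<close> may be unbounded, continuity holds since norms are
  preserved.
\<close>
lemma continuous_on_reparam:
  assumes \<alpha>: "continuous_on (S - {0}) \<alpha>"
  shows "continuous_on S (reparam \<omega> \<alpha>)"
  unfolding continuous_on_eq_continuous_within
proof
  fix p assume p: "p \<in> S"
  show "continuous (at p within S) (reparam \<omega> \<alpha>)"
  proof (cases "p = 0")
    case True
    have "((\<lambda>p. norm (reparam \<omega> \<alpha> p)) \<longlongrightarrow> 0) (at 0 within S)"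
      by (simp add: tendsto_norm_zero)
    then have "(reparam \<omega> \<alpha> \<longlongrightarrow> 0) (at 0 within S)" by (rule tendsto_norm_zero_cancel)
    moreover have "reparam \<omega> \<alpha> 0 = 0" using norm_reparam[of \<omega> \<alpha> 0] by (simp only: norm_zero norm_eq_zero)
    ultimately show ?thesis using True by (simp add: continuous_within)
  next
    case False
    have "continuous_on (S - {0}) (reparam \<omega> \<alpha>)"
      unfolding reparam_def twist_def rot_def by (intro continuous_intros \<alpha>)
    then have "continuous (at p within S - {0}) (reparam \<omega> \<alpha>)"
      using p False by (simp add: continuous_on_eq_continuous_within)
    moreover have "at p within S - {0} = at p within S"
      using False by (intro at_within_nhd[of p "- {0}"]) auto
    ultimately show ?thesis by simp
  qed
qed

lemma reparam_inverse:
  assumes "\<And>p q. (\<And>i. norm (p $ i) = norm (q $ i)) \<Longrightarrow> \<alpha> p = \<alpha> q"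
  shows "reparam \<omega> (\<lambda>p. - \<alpha> p) (reparam \<omega> \<alpha> p) = p"
proof -
  have "\<alpha> (reparam \<omega> \<alpha> p) = \<alpha> p" by (rule assms) (simp add: reparam_nth)
  then show ?thesis by (simp add: vec_eq_iff reparam_nth rot_rot)
qed

text \<open>
  Along a solution \<open>u\<close> for \<open>\<nu>\<close> the phase shift changes at the rate
  \<open>growth a \<nu> / growth a \<mu> - 1\<close>. In the time \<open>\<tau> = t +\<close> phase
  shift, which runs at the rate \<open>growth a \<nu> / growth a \<mu> > 0\<close>, the norm of the
  image grows according to \<open>\<mu>\<close> and the angles of the image turn with the speeds
  \<open>\<omega> i\<close>.
\<close>
lemma maps_orbits_reparam:
  fixes M :: "((real \<times> real)^'n::{finite,linorder}) set" and \<omega> :: "'n \<Rightarrow> real"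
  defines "\<kappa> a \<nu> \<mu> p \<equiv> 1 / growth a \<nu> p - 1 / growth a \<mu> p"
  assumes M: "\<And>p \<theta>. p \<in> M \<Longrightarrow> twist \<theta> p \<in> M"
    and pos: "\<And>p :: (real \<times> real, 'n) vec. norm p \<le> r \<Longrightarrow> 0 < growth a \<nu> p * growth a \<mu> p"
  shows "maps_orbits (M \<inter> ball 0 r) (normal_form \<omega> a \<nu>) (M \<inter> ball 0 r) (normal_form \<omega> a \<mu>)
    (reparam \<omega> (phase_shift (\<kappa> a \<nu> \<mu>) r))"
  unfolding maps_orbits_def
proof (intro allI impI)
  fix T :: real and u
  assume "T > 0 \<and> solution_on (normal_form \<omega> a \<nu>) {0..T} u \<and> u ` {0..T} \<subseteq> M \<inter> ball 0 r"
  then have T: "T > 0" and sol: "solution_on (normal_form \<omega> a \<nu>) {0..T} u"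
    and im: "\<And>t. t \<in> {0..T} \<Longrightarrow> u t \<in> M" "\<And>t. t \<in> {0..T} \<Longrightarrow> norm (u t) < r"
    by (auto simp: image_subset_iff)
  let ?h = "reparam \<omega> (phase_shift (\<kappa> a \<nu> \<mu>) r)"
  obtain x where x: "x 0 = 1" "\<And>t. t \<in> {0..T} \<Longrightarrow> 0 < x t"
    "\<And>t. t \<in> {0..T} \<Longrightarrow> (x has_real_derivative x t * growth a \<nu> (u t)) (at t within {0..T})"
    "\<And>t i. t \<in> {0..T} \<Longrightarrow> norm (u t $ i) = x t * norm (u 0 $ i)"
    using solution_norms[OF sol] by metis
  have hM: "?h (u t) \<in> M \<inter> ball 0 r" if "t \<in> {0..T}" for t
    using im[OF that] M by (simp add: reparam_def)
  show "\<exists>T' v \<tau>. T' > 0 \<and> solution_on (normal_form \<omega> a \<mu>) {0..T'} v \<and> v ` {0..T'} \<subseteq> M \<inter> ball 0 r \<and>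
      continuous_on {0..T} \<tau> \<and> strict_mono_on {0..T} \<tau> \<and> \<tau> 0 = 0 \<and> \<tau> T = T' \<and>
      (\<forall>t\<in>{0..T}. ?h (u t) = v (\<tau> t))"
  proof (cases "u 0 = 0")
    case True
    have u0: "u t = 0" if "t \<in> {0..T}" for t using x(4)[OF that] True by (simp add: vec_eq_iff)
    have h0: "?h 0 = 0" using norm_reparam[of \<omega> _ 0] by (simp only: norm_zero norm_eq_zero)
    have "normal_form \<omega> a \<mu> 0 = 0" by (simp add: vec_eq_iff normal_form_nth quarter_turn_def zero_prod_def)
    then have "solution_on (normal_form \<omega> a \<mu>) {0..T} (\<lambda>_. 0)"
      by (simp add: solution_on_def is_interval_cc)
    moreover have "0 \<in> M \<inter> ball 0 r" using hM[of 0] T u0[of 0] h0 by simp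
    ultimately show ?thesis using T u0 h0
      by (intro exI[of _ T] exI[of _ "\<lambda>_. 0"] exI[of _ "\<lambda>t. t"]) (auto simp: strict_mono_on_def)
  next
    case False
    have g: "growth a \<nu> p \<noteq> 0" "growth a \<mu> p \<noteq> 0" if "norm p \<le> r" for p :: "(real \<times> real, 'n) vec"
      using pos[OF that] by auto
    have \<kappa>c: "continuous_on (cball 0 r) (\<kappa> a \<nu> \<mu>)"
      unfolding \<kappa>_def using g by (intro continuous_intros) auto
    have \<kappa>cong: "\<kappa> a \<nu> \<mu> p = \<kappa> a \<nu> \<mu> q" if "\<And>i. norm (p $ i) = norm (q $ i)" for p q
      unfolding \<kappa>_def using growth_cong(3)[of p q a] that by simp
    let ?\<alpha> = "\<lambda>t. phase_shift (\<kappa> a \<nu> \<mu>) r (u t)"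
    let ?f = "\<lambda>t. growth a \<nu> (u t)" and ?g = "\<lambda>t. growth a \<mu> (u t)"
    have \<alpha>: "(?\<alpha> has_real_derivative ?f t / ?g t - 1) (at t within {0..T})" if "t \<in> {0..T}" for t
    proof -
      have "(?\<alpha> has_real_derivative - ?f t * \<kappa> a \<nu> \<mu> (u t)) (at t within {0..T})"
        by (rule phase_shift_deriv[OF \<kappa>c \<kappa>cong False x(2,3,4) im(2) that])
      moreover have "- ?f t * \<kappa> a \<nu> \<mu> (u t) = ?f t / ?g t - 1"
        using g[of "u t"] im(2)[OF that] by (simp add: \<kappa>_def field_simps)
      ultimately show ?thesis by simp
    qed
    define \<tau> where "\<tau> t = t + (?\<alpha> t - ?\<alpha> 0)" for t
    have \<tau>: "(\<tau> has_real_derivative ?f t / ?g t) (at t within {0..T})" if "t \<in> {0..T}" for t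
      unfolding \<tau>_def using DERIV_add[OF DERIV_ident DERIV_diff[OF \<alpha>[OF that] DERIV_const]] by simp
    have rate: "?f t / ?g t > 0" if "t \<in> {0..T}" for t
      using pos[of "u t"] im(2)[OF that] by (auto simp: zero_less_mult_iff zero_less_divide_iff)
    have \<tau>c: "continuous_on {0..T} \<tau>" by (rule DERIV_continuous_on[OF \<tau>])
    have \<tau>mono: "\<tau> s < \<tau> t" if "0 \<le> s" "s < t" "t \<le> T" for s t
    proof (rule DERIV_pos_imp_increasing_open[OF that(2)])
      fix y assume "s < y" "y < t"
      then have "(\<tau> has_real_derivative ?f y / ?g y) (at y)" "y \<in> {0..T}"
        using \<tau>[of y] that by (auto simp: at_within_Icc_at)
      then show "\<exists>z. (\<tau> has_real_derivative z) (at y) \<and> 0 < z" using rate by blast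
    qed (use that in \<open>auto intro: continuous_on_subset[OF \<tau>c]\<close>)
    have \<tau>0: "\<tau> 0 = 0" by (simp add: \<tau>_def)
    have \<tau>le: "\<tau> s \<le> \<tau> t" if "0 \<le> s" "s \<le> t" "t \<le> T" for s t
      using \<tau>mono[of s t] that by (cases "s = t") auto
    have \<tau>im: "\<tau> ` {0..T} = {0..\<tau> T}"
    proof
      show "\<tau> ` {0..T} \<subseteq> {0..\<tau> T}" using \<tau>le[of 0] \<tau>le[of _ T] \<tau>0 by fastforce
      show "{0..\<tau> T} \<subseteq> \<tau> ` {0..T}"
      proof
        fix s assume "s \<in> {0..\<tau> T}"
        then have "\<exists>t\<ge>0. t \<le> T \<and> \<tau> t = s" using \<tau>0 T \<tau>c by (intro IVT') auto
        then show "s \<in> \<tau> ` {0..T}" by auto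
      qed
    qed
    have inj: "inj_on \<tau> {0..T}"
      by (rule linorder_inj_onI) (use \<tau>mono in fastforce)+
    define \<eta> where "\<eta> = inv_into {0..T} \<tau>"
    have \<eta>: "\<eta> (\<tau> t) = t" if "t \<in> {0..T}" for t unfolding \<eta>_def using inv_into_f_f[OF inj that] .
    have \<eta>c: "continuous_on {0..\<tau> T} \<eta>"
      using continuous_on_inv[OF \<tau>c, of \<eta>] \<eta> by (simp add: \<tau>im)
    have \<eta>d: "(\<eta> has_real_derivative ?g t / ?f t) (at (\<tau> t) within {0..\<tau> T})" if t: "t \<in> {0..T}" for t
    proof -
      have "(\<eta> has_derivative ((*) (?g t / ?f t))) (at (\<tau> t) within \<tau> ` {0..T})"
      proof (rule has_derivative_inverse_within)
        show "(\<tau> has_derivative ((*) (?f t / ?g t))) (at t within {0..T})"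
          using \<tau>[OF t] by (simp add: has_field_derivative_def)
        show "continuous (at (\<tau> t) within \<tau> ` {0..T}) \<eta>"
          using \<eta>c t unfolding \<tau>im[symmetric] continuous_on_eq_continuous_within by blast
        show "linear ((*) (?g t / ?f t))" by (rule linearI) (simp_all add: algebra_simps add_divide_distrib)
        show "((*) (?g t / ?f t)) \<circ> ((*) (?f t / ?g t)) = id"
          using rate[OF t] by (auto simp: fun_eq_iff)
      qed (use t \<eta> in auto)
      then show ?thesis by (simp add: has_field_derivative_def \<tau>im)
    qed
    define v where "v s = ?h (u (\<eta> s))" for s
    have hder: "((\<lambda>t. ?h (u t)) has_vector_derivative (?f t / ?g t) *\<^sub>R normal_form \<omega> a \<mu> (?h (u t))) (at t within {0..T})"
      if t: "t \<in> {0..T}" for t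
    proof -
      have ui: "((\<lambda>t. u t $ i) has_vector_derivative normal_form \<omega> a \<nu> (u t) $ i) (at t within {0..T})" for i
        using sol t by (auto simp: solution_on_def intro: has_vector_derivative_nth)
      have "((\<lambda>t. \<omega> i * ?\<alpha> t) has_real_derivative \<omega> i * (?f t / ?g t - 1)) (at t within {0..T})" for i
        by (rule DERIV_cmult[OF \<alpha>[OF t]])
      from has_vector_derivative_rot[OF this ui]
      have "((\<lambda>t. ?h (u t)) has_vector_derivative (\<chi> i. rot (\<omega> i * ?\<alpha> t)
          (normal_form \<omega> a \<nu> (u t) $ i + (\<omega> i * (?f t / ?g t - 1)) *\<^sub>R quarter_turn (u t $ i)))) (at t within {0..T})"
        unfolding reparam_def twist_def by (rule has_vector_derivative_vec_lambda)
      also have "(\<chi> i. rot (\<omega> i * ?\<alpha> t)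
          (normal_form \<omega> a \<nu> (u t) $ i + (\<omega> i * (?f t / ?g t - 1)) *\<^sub>R quarter_turn (u t $ i)))
        = (?f t / ?g t) *\<^sub>R normal_form \<omega> a \<mu> (?h (u t))"
      proof -
        have gh: "growth a \<mu> (?h (u t)) = ?g t" by (simp add: reparam_def)
        have ne: "?g t \<noteq> 0" using g(2)[of "u t"] im(2)[OF t] by simp
        have "normal_form \<omega> a \<nu> (u t) $ i + (\<omega> i * (?f t / ?g t - 1)) *\<^sub>R quarter_turn (u t $ i)
          = (?f t / ?g t) *\<^sub>R (\<omega> i *\<^sub>R quarter_turn (u t $ i) + ?g t *\<^sub>R (u t $ i))" for i
          unfolding normal_form_nth using ne by (simp add: algebra_simps)
        then show ?thesis
          unfolding vec_eq_iff normal_form_nth vector_scaleR_component gh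
          by (simp add: reparam_nth rot_add rot_scaleR rot_quarter_turn)
      qed
      finally show ?thesis .
    qed
    have "solution_on (normal_form \<omega> a \<mu>) {0..\<tau> T} v"
      unfolding solution_on_def
    proof (intro conjI ballI is_interval_cc)
      fix s assume "s \<in> {0..\<tau> T}"
      then obtain t where t: "t \<in> {0..T}" "s = \<tau> t" unfolding \<tau>im[symmetric] by blast
      have fg: "?f t \<noteq> 0" "?g t \<noteq> 0" using rate[OF t(1)] by auto
      have \<eta>im: "\<eta> ` {0..\<tau> T} = {0..T}"
        unfolding \<tau>im[symmetric] image_image using \<eta> by simp
      have "(\<eta> has_vector_derivative ?g t / ?f t) (at s within {0..\<tau> T})"
        using \<eta>d[OF t(1)] t(2) by (simp add: has_real_derivative_iff_has_vector_derivative)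
      moreover have "((\<lambda>t. ?h (u t)) has_vector_derivative (?f t / ?g t) *\<^sub>R normal_form \<omega> a \<mu> (?h (u t)))
          (at (\<eta> s) within \<eta> ` {0..\<tau> T})"
        using hder[OF t(1)] \<eta>[OF t(1)] t(2) by (simp add: \<eta>im)
      ultimately have "(((\<lambda>t. ?h (u t)) \<circ> \<eta>) has_vector_derivative
          (?g t / ?f t) *\<^sub>R ((?f t / ?g t) *\<^sub>R normal_form \<omega> a \<mu> (?h (u t)))) (at s within {0..\<tau> T})"
        by (rule vector_diff_chain_within)
      then show "(v has_vector_derivative normal_form \<omega> a \<mu> (v s)) (at s within {0..\<tau> T})"
        using fg \<eta>[OF t(1)] t(2) by (simp add: v_def[abs_def] o_def)
    qed
    moreover have "v ` {0..\<tau> T} \<subseteq> M \<inter> ball 0 r"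
      unfolding \<tau>im[symmetric] using hM by (auto simp: v_def \<eta>)
    moreover have "\<tau> T > 0" using \<tau>mono[of 0 T] T \<tau>0 by simp
    moreover have "strict_mono_on {0..T} \<tau>" using \<tau>mono by (auto simp: strict_mono_on_def)
    ultimately show ?thesis using \<tau>c \<tau>0 \<eta>
      by (intro exI[of _ "\<tau> T"] exI[of _ v] exI[of _ \<tau>]) (auto simp: v_def)
  qed
qed

lemma growth_near_0:
  assumes "\<epsilon> > 0"
  obtains r where "r > 0" "\<And>p \<nu>. norm (p :: ('b::real_normed_vector)^'n::{finite,linorder}) \<le> r \<Longrightarrow> \<bar>growth a \<nu> p - \<nu>\<bar> < \<epsilon>"
proof -
  have "continuous_on UNIV (growth a 0 :: ('b, 'n) vec \<Rightarrow> real)" by (rule continuous_on_growth) (rule continuous_on_id)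
  then have "isCont (growth a 0 :: ('b, 'n) vec \<Rightarrow> real) 0" by (simp add: continuous_on_eq_continuous_at)
  then obtain d where d: "d > 0" "\<And>p :: ('b, 'n) vec. dist p 0 < d \<Longrightarrow> dist (growth a 0 p) (growth a 0 (0 :: ('b, 'n) vec)) < \<epsilon>"
    using assms unfolding continuous_at_eps_delta by blast
  show ?thesis
  proof (rule that[of "d / 2"])
    fix p :: "('b, 'n) vec" and \<nu> assume "norm p \<le> d / 2"
    then have "dist p 0 < d" using d(1) by simp
    from d(2)[OF this] have "\<bar>growth a 0 p\<bar> < \<epsilon>" by (simp only: growth_0 dist_real_def)
    then show "\<bar>growth a \<nu> p - \<nu>\<bar> < \<epsilon>" by (simp add: growth_def)
  qed (use d in simp)
qed

text \<open>
  Exchanging \<open>\<nu>\<close> and \<open>\<mu>\<close> changes the sign of the phase shift, so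
  the inverse homeomorphism is of the same kind.
\<close>
lemma locally_equivalent_nonzero:
  fixes M :: "((real \<times> real)^'n::{finite,linorder}) set"
  assumes M: "0 \<in> M" "\<And>p \<theta>. p \<in> M \<Longrightarrow> twist \<theta> p \<in> M" and \<nu>: "\<nu> \<noteq> 0" and \<mu>: "\<bar>\<mu> - \<nu>\<bar> < \<bar>\<nu>\<bar> / 4"
  shows "locally_equivalent_at 0 M (normal_form \<omega> a \<nu>) (normal_form \<omega> a \<mu>)"
proof -
  obtain r where r: "r > 0" "\<And>p \<nu>'. norm (p :: (real \<times> real, 'n) vec) \<le> r \<Longrightarrow> \<bar>growth a \<nu>' p - \<nu>'\<bar> < \<bar>\<nu>\<bar> / 4"
    using growth_near_0[of "\<bar>\<nu>\<bar> / 4"] \<nu> by (metis divide_pos_pos zero_less_abs_iff zero_less_numeral)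
  have pos: "0 < growth a \<nu> p * growth a \<mu> p" if "norm p \<le> r" for p :: "(real \<times> real, 'n) vec"
    using r(2)[OF that, of \<nu>] r(2)[OF that, of \<mu>] \<mu> \<nu> by (auto simp: zero_less_mult_iff abs_if split: if_splits)
  define \<kappa> where "\<kappa> \<nu> \<mu> p = 1 / growth a \<nu> p - 1 / growth a \<mu> p" for \<nu> \<mu> and p :: "(real \<times> real, 'n) vec"
  let ?\<alpha> = "phase_shift (\<kappa> \<nu> \<mu>) r" and ?\<beta> = "phase_shift (\<kappa> \<mu> \<nu>) r"
  have neg: "?\<beta> = (\<lambda>p. - ?\<alpha> p)" "?\<alpha> = (\<lambda>p. - ?\<beta> p)"
  proof -
    have "\<kappa> \<mu> \<nu> p = - \<kappa> \<nu> \<mu> p" for p by (simp add: \<kappa>_def)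
    then show "?\<beta> = (\<lambda>p. - ?\<alpha> p)" by (simp add: phase_shift_def fun_eq_iff)
    then show "?\<alpha> = (\<lambda>p. - ?\<beta> p)" by simp
  qed
  have cong: "\<kappa> \<nu>1 \<nu>2 p = \<kappa> \<nu>1 \<nu>2 q" if "\<And>i. norm (p $ i) = norm (q $ i)" for p q \<nu>1 \<nu>2
    unfolding \<kappa>_def using growth_cong(3)[of p q a] that by simp
  have cong\<alpha>: "phase_shift (\<kappa> \<nu>1 \<nu>2) r p = phase_shift (\<kappa> \<nu>1 \<nu>2) r q"
    if "\<And>i. norm (p $ i) = norm (q $ i)" for p q \<nu>1 \<nu>2
    using cong that by (rule phase_shift_cong)
  have g: "growth a \<nu> p \<noteq> 0" "growth a \<mu> p \<noteq> 0" if "norm p \<le> r" for p :: "(real \<times> real, 'n) vec"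
    using pos[OF that] by auto
  let ?U = "M \<inter> ball 0 r"
  have "continuous_on (cball 0 r) (\<kappa> \<nu> \<mu>)" "continuous_on (cball 0 r) (\<kappa> \<mu> \<nu>)"
    unfolding \<kappa>_def using g by (auto intro!: continuous_intros)
  then have cont: "continuous_on ?U (reparam \<omega> ?\<alpha>)" "continuous_on ?U (reparam \<omega> ?\<beta>)"
    by (auto intro!: continuous_on_reparam intro: continuous_on_subset[OF continuous_on_phase_shift])
  have inv: "reparam \<omega> ?\<beta> (reparam \<omega> ?\<alpha> p) = p" "reparam \<omega> ?\<alpha> (reparam \<omega> ?\<beta> p) = p" for p
    using reparam_inverse[of ?\<alpha> \<omega> p] reparam_inverse[of ?\<beta> \<omega> p] cong\<alpha> neg by (metis (no_types, lifting))+
  have im: "reparam \<omega> \<alpha> ` ?U \<subseteq> ?U" for \<alpha> using M(2) by (auto simp: reparam_def)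
  have hom: "homeomorphism ?U ?U (reparam \<omega> ?\<alpha>) (reparam \<omega> ?\<beta>)"
    using cont im inv by (intro homeomorphismI) auto
  have h0: "reparam \<omega> ?\<alpha> 0 = 0" using norm_reparam[of \<omega> _ 0] by (simp only: norm_zero norm_eq_zero)
  have 1: "maps_orbits ?U (normal_form \<omega> a \<nu>) ?U (normal_form \<omega> a \<mu>) (reparam \<omega> ?\<alpha>)"
    unfolding \<kappa>_def[abs_def] by (rule maps_orbits_reparam) (use M pos in auto)
  have 2: "maps_orbits ?U (normal_form \<omega> a \<mu>) ?U (normal_form \<omega> a \<nu>) (reparam \<omega> ?\<beta>)"
    unfolding \<kappa>_def[abs_def] by (rule maps_orbits_reparam) (use M pos in \<open>auto simp: mult.commute\<close>)
  have "openin (top_of_set M) ?U" by (rule openin_open_Int) simp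
  then show ?thesis unfolding locally_equivalent_at_def
    using hom h0 1 2 r(1) M(1) by (intro exI[of _ ?U] exI[of _ "reparam \<omega> ?\<alpha>"] exI[of _ "reparam \<omega> ?\<beta>"]) auto
qed


text \<open>
  Since \<open>a (unit_mi i) > 0\<close>, for the parameter 0 a solution in the \<open>i\<close>-th
  coordinate plane runs from an arbitrarily small neighbourhood of the origin to the point
  \<open>ray c\<close>. Its image would be a solution for \<open>\<mu>\<close> that starts
  arbitrarily close to the origin and ends at a fixed nonzero point, although the norm cannot
  increase for \<open>\<mu> < 0\<close>.
\<close>
lemma not_locally_equivalent_at_0:
  fixes M :: "((real \<times> real)^'n::{finite,linorder}) set" and i :: 'n
  defines "ray \<equiv> \<lambda>c. (\<chi> j. if j = i then (c, 0) else 0) :: (real \<times> real, 'n) vec"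
  assumes M: "\<And>c \<theta>. twist \<theta> (ray c) \<in> M" and a: "a (unit_mi i) > 0" and \<mu>: "\<mu> < 0"
  shows "\<not> locally_equivalent_at 0 M (normal_form \<omega> a 0) (normal_form \<omega> a \<mu>)"
proof
  assume "locally_equivalent_at 0 M (normal_form \<omega> a 0) (normal_form \<omega> a \<mu>)"
  then obtain U V h h' where U: "openin (top_of_set M) U" "0 \<in> U" and hom: "homeomorphism U V h h'"
    and h0: "h 0 = 0" and orb: "maps_orbits U (normal_form \<omega> a 0) V (normal_form \<omega> a \<mu>) h"
    unfolding locally_equivalent_at_def by blast
  obtain e where e: "e > 0" "\<And>p. p \<in> M \<Longrightarrow> norm p < e \<Longrightarrow> p \<in> U"
  proof -
    obtain W where W: "open W" "U = M \<inter> W" using U(1) by (auto simp: openin_open)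
    then obtain e where "e > 0" "ball 0 e \<subseteq> W" using U(2) open_contains_ball_eq[OF W(1)] by blast
    then show ?thesis using that[of e] W(2) by (auto simp: subset_iff)
  qed
  have nray: "norm (ray c) = \<bar>c\<bar>" for c
  proof -
    have "norm (ray c) = L2_set (\<lambda>j. if j = i then \<bar>c\<bar> else 0) UNIV"
      unfolding norm_vec_def ray_def by (rule arg_cong[of _ _ "\<lambda>f. L2_set f UNIV"]) auto
    then show ?thesis by (simp add: L2_set_def if_distrib[of "\<lambda>x. x\<^sup>2"] cong: if_cong)
  qed
  have ray_scale: "x *\<^sub>R ray c = ray (x * c)" for x c by (simp add: ray_def vec_eq_iff)
  have q: "quad a (ray c) = a (unit_mi i) * c\<^sup>2" for c
    by (simp add: quad_def ray_def if_distrib if_distribR cong: if_cong)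
  have w: "quart a (ray c) = a (unit_mi i + unit_mi i) * c^4" for c
  proof -
    have "quart a (ray c) = (\<Sum>(j, l)\<in>{(i, i)}. a (unit_mi j + unit_mi l) * (norm (ray c $ j))\<^sup>2 * (norm (ray c $ l))\<^sup>2)"
      unfolding quart_def by (rule sum.mono_neutral_right) (auto simp: ray_def split: if_splits)
    then show ?thesis by (simp add: ray_def power4_eq_xxxx power2_eq_square)
  qed
  define b where "b = a (unit_mi i + unit_mi i)"
  \<comment> \<open>The bounds keep the ray up to \<open>ray c\<close> inside \<open>U\<close> and
    let the quadratic term dominate the quartic one on it.\<close>
  define c where "c = min (e / 2) (min 1 (a (unit_mi i) / (2 * (\<bar>b\<bar> + 1))))"
  have c: "0 < c" "c < e" "c \<le> 1" "c * (\<bar>b\<bar> + 1) \<le> a (unit_mi i) / 2"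
  proof -
    have "c \<le> a (unit_mi i) / (2 * (\<bar>b\<bar> + 1))" by (simp add: c_def)
    then show "c * (\<bar>b\<bar> + 1) \<le> a (unit_mi i) / 2" by (simp add: field_simps)
  qed (use e a in \<open>auto simp: c_def\<close>)
  have grow: "growth a 0 (y *\<^sub>R ray c) > 0" if y: "0 < y" "y \<le> 1" for y
  proof -
    have "\<bar>b\<bar> * (y * c)\<^sup>2 \<le> \<bar>b\<bar> * c"
    proof (rule mult_left_mono)
      have "(y * c) * (y * c) \<le> 1 * c"
        using y c by (intro mult_mono) (auto intro: mult_le_one mult_left_le_one_le)
      then show "(y * c)\<^sup>2 \<le> c" by (simp add: power2_eq_square)
    qed simp
    also have "\<bar>b\<bar> * c \<le> c * (\<bar>b\<bar> + 1)" using c by (simp add: algebra_simps)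
    finally have "\<bar>b\<bar> * (y * c)\<^sup>2 < a (unit_mi i)" using c(4) a by linarith
    moreover have "- \<bar>b\<bar> * (y * c)\<^sup>2 \<le> b * (y * c)\<^sup>2" by (intro mult_right_mono) auto
    ultimately have "0 < a (unit_mi i) + b * (y * c)\<^sup>2" by linarith
    then have "0 < (y * c)\<^sup>2 * (a (unit_mi i) + b * (y * c)\<^sup>2)" using y c by (intro mult_pos_pos) auto
    also have "\<dots> = growth a 0 (y *\<^sub>R ray c)"
      by (simp only: growth_def ray_scale q w flip: b_def)
        (simp add: algebra_simps power4_eq_xxxx power2_eq_square)
    finally show ?thesis .
  qed
  obtain x where x: "x 0 = (1::real)" "\<And>t. t \<le> 0 \<Longrightarrow> 0 < x t \<and> x t \<le> 1" "(x \<longlongrightarrow> 0) at_bot"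
    "\<And>\<omega>. solution_on (normal_form \<omega> a 0) {..0} (\<lambda>t. twist (\<lambda>i. \<omega> i * t) (x t *\<^sub>R ray c))"
    using radial_solution_from_0[OF grow] by blast
  define u where "u t = twist (\<lambda>i. \<omega> i * t) (x t *\<^sub>R ray c)" for t
  have u: "u t \<in> U" "norm (u t) = x t * c" if "t \<le> 0" for t
  proof -
    show n: "norm (u t) = x t * c" using x(2)[OF that] c(1) by (simp add: u_def nray)
    have "x t * c \<le> 1 * c" using x(2)[OF that] c by (intro mult_right_mono) auto
    then show "u t \<in> U" using n c(2) M[of "\<lambda>i. \<omega> i * t" "x t * c"]
      by (intro e(2)) (auto simp: u_def ray_scale)
  qed
  have u0: "u 0 = ray c" using x(1) by (simp add: u_def vec_eq_iff)
  have inj: "h p \<noteq> 0" if p: "p \<in> U" "p \<noteq> 0" for p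
  proof
    assume "h p = 0"
    then have "h' (h p) = h' (h 0)" by (simp only: h0)
    then show False using p homeomorphism_apply1[OF hom p(1)] homeomorphism_apply1[OF hom U(2)] by simp
  qed
  have "ray c \<noteq> 0" using nray[of c] c(1) by auto
  then have y: "h (u 0) \<noteq> 0" using inj[of "u 0"] u(1)[of 0] u0 by simp
  obtain r where r: "r > 0" "\<And>p \<nu>'. norm (p :: (real \<times> real, 'n) vec) \<le> r \<Longrightarrow> \<bar>growth a \<nu>' p - \<nu>'\<bar> < - \<mu>"
    using growth_near_0[of "- \<mu>"] \<mu> by auto
  have "continuous_on U h" using hom by (simp add: homeomorphism_def)
  moreover have "0 < min r (norm (h (u 0)))" using r(1) y by simp
  ultimately have "\<exists>d>0. \<forall>p\<in>U. dist p 0 < d \<longrightarrow> dist (h p) (h 0) < min r (norm (h (u 0)))"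
    using U(2) unfolding continuous_on_iff by blast
  then obtain d where d: "d > 0" "\<And>p. p \<in> U \<Longrightarrow> norm p < d \<Longrightarrow> norm (h p) < min r (norm (h (u 0)))"
    using h0 by auto
  have "\<forall>\<^sub>F t in at_bot. x t < d \<and> t \<le> - 1"
    by (rule eventually_conj[OF order_tendstoD(2)[OF x(3) d(1)] eventually_le_at_bot])
  then obtain t0 where t0: "x t0 < d" "t0 < 0"
    using eventually_happens'[OF trivial_limit_at_bot_linorder] by fastforce
  have small: "norm (u t0) < d"
  proof -
    have "x t0 * c \<le> x t0 * 1" using x(2)[of t0] t0 c by (intro mult_left_mono) auto
    then show ?thesis using u(2)[of t0] t0 by simp
  qed
  let ?T = "- t0"
  have sol: "solution_on (normal_form \<omega> a 0) {0..?T} (\<lambda>t. u (t + t0))"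
    using x(4)[of \<omega>] unfolding u_def[symmetric] by (rule solution_on_shift) (auto simp: is_interval_cc)
  have im: "(\<lambda>t. u (t + t0)) ` {0..?T} \<subseteq> U" using u(1) by auto
  have "0 < ?T" using t0(2) by simp
  from orb[unfolded maps_orbits_def, rule_format, OF conjI[OF this conjI[OF sol im]]]
  obtain T' v \<tau> where v: "T' > 0" "solution_on (normal_form \<omega> a \<mu>) {0..T'} v"
    "\<tau> 0 = 0" "\<tau> ?T = T'" "\<And>t. t \<in> {0..?T} \<Longrightarrow> h (u (t + t0)) = v (\<tau> t)"
    by blast
  have v0: "v 0 = h (u t0)" "v T' = h (u 0)" using v(5)[of 0] v(5)[of ?T] v(3,4) t0(2) by auto
  have hs: "norm (h (u t0)) < min r (norm (h (u 0)))" using d(2)[OF u(1) small] t0(2) by simp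
  have "norm (v T') \<le> norm (v 0)"
  proof (rule solution_norm_nonincreasing[OF v(2)])
    show "0 \<le> T'" using v(1) by simp
    show "growth a \<mu> p \<le> 0" if "norm p < r" for p :: "(real \<times> real, 'n) vec"
      using r(2)[of p \<mu>] that by auto
    show "norm (v 0) < r" using hs v0 by simp
  qed
  then show False using hs v0 by simp
qed

text \<open>
  The inner product of the field with the pairs rotated by a quarter turn is \<open>\<omega>
  i\<close> times the squared norm of the pair.
\<close>
lemma normal_form_eq_0_iff:
  assumes "\<And>i. \<omega> i \<noteq> 0"
  shows "normal_form \<omega> a \<nu> p = 0 \<longleftrightarrow> p = 0"
proof
  assume 0: "normal_form \<omega> a \<nu> p = 0"
  have "p $ i = 0" for i
  proof -
    have "normal_form \<omega> a \<nu> p $ i \<bullet> quarter_turn (p $ i) = 0" using 0 by simp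
    moreover have "z \<bullet> quarter_turn z = 0" "quarter_turn z \<bullet> quarter_turn z = z \<bullet> z" for z
      by (cases z; simp add: quarter_turn_def)+
    ultimately show ?thesis using assms by (simp add: normal_form_nth inner_add_left)
  qed
  then show "p = 0" by (simp add: vec_eq_iff)
qed (simp add: vec_eq_iff normal_form_nth quarter_turn_def zero_prod_def)

text \<open>
  A global equivalence takes equilibria to equilibria, since the time change is onto, and the origin
  is the only equilibrium. So it fixes the origin.
\<close>
lemma equivalent_imp_locally_equivalent:
  assumes \<omega>: "\<And>i. \<omega> i \<noteq> 0" and M: "0 \<in> M"
    and eq: "topologically_equivalent M (normal_form \<omega> a \<nu>) (normal_form \<omega> a \<mu>)"
  shows "locally_equivalent_at 0 M (normal_form \<omega> a \<nu>) (normal_form \<omega> a \<mu>)"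
proof -
  obtain h h' where h: "homeomorphism M M h h'" "maps_orbits M (normal_form \<omega> a \<nu>) M (normal_form \<omega> a \<mu>) h"
    "maps_orbits M (normal_form \<omega> a \<mu>) M (normal_form \<omega> a \<nu>) h'"
    using eq by (auto simp: topologically_equivalent_def)
  have "solution_on (normal_form \<omega> a \<nu>) {0..1} (\<lambda>_. 0)"
    using normal_form_eq_0_iff[OF \<omega>, where a = a and \<nu> = \<nu> and p = 0] by (simp add: solution_on_def is_interval_cc)
  note sol = this
  have im: "(\<lambda>_. 0) ` {0..1::real} \<subseteq> M" using M by auto
  from h(2)[unfolded maps_orbits_def, rule_format, OF conjI[OF zero_less_one conjI[OF sol im]]]
  obtain T' v and \<tau> :: "real \<Rightarrow> real" where v: "T' > 0" "solution_on (normal_form \<omega> a \<mu>) {0..T'} v"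
    "continuous_on {0..1} \<tau>" "\<tau> 0 = 0" "\<tau> 1 = T'" "\<And>t. t \<in> {0..1} \<Longrightarrow> h 0 = v (\<tau> t)"
    by blast
  have const: "v s = h 0" if "s \<in> {0..T'}" for s
  proof -
    have "\<exists>t\<ge>0. t \<le> 1 \<and> \<tau> t = s" using that v by (intro IVT') auto
    then show ?thesis using v(6) by auto
  qed
  have d1: "(v has_vector_derivative normal_form \<omega> a \<mu> (h 0)) (at 0 within {0..T'})"
  proof -
    have 0: "0 \<in> {0..T'}" using v(1) by simp
    then have "(v has_vector_derivative normal_form \<omega> a \<mu> (v 0)) (at 0 within {0..T'})"
      using v(2) unfolding solution_on_def by blast
    then show ?thesis unfolding const[OF 0] .
  qed
  have "((\<lambda>_. h 0) has_vector_derivative 0) (at 0 within {0..T'})" by simp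
  then have d2: "(v has_vector_derivative 0) (at 0 within {0..T'})"
    by (rule has_vector_derivative_transform[OF _ const, rotated -1]) (use v(1) in auto)
  have "normal_form \<omega> a \<mu> (h 0) = 0"
    using vector_derivative_unique_within_closed_interval[of 0 T' 0 v] d1 d2 v(1) by simp
  then have h0: "h 0 = 0" by (simp only: normal_form_eq_0_iff[OF \<omega>])
  moreover have "openin (top_of_set M) M" by (rule openin_subtopology_self)
  ultimately show ?thesis unfolding locally_equivalent_at_def
    using h M h0 by (intro exI[of _ M] exI[of _ h] exI[of _ h'] conjI)
qed

theorem primary_bifurcation_variety_eq:
  fixes M :: "((real \<times> real)^'n::{finite,linorder}) set" and i :: 'n
  assumes \<omega>: "\<And>i. \<omega> i \<noteq> 0" and M: "0 \<in> M" "\<And>p \<theta>. p \<in> M \<Longrightarrow> twist \<theta> p \<in> M"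
    and ray: "\<And>c. (\<chi> j. if j = i then (c, 0) else 0) \<in> M" and a: "a (unit_mi i) > 0"
  shows "primary_bifurcation_variety M (normal_form \<omega> a) = {\<nu>. \<nu> = 0}"
proof (intro set_eqI iffI)
  fix \<nu> assume \<nu>: "\<nu> \<in> primary_bifurcation_variety M (normal_form \<omega> a)"
  have "\<nu> = 0"
  proof (rule ccontr)
    assume "\<nu> \<noteq> 0"
    then have "\<bar>\<nu>\<bar> / 4 > 0" by simp
    then obtain \<mu> where "\<bar>\<mu> - \<nu>\<bar> < \<bar>\<nu>\<bar> / 4" "\<not> locally_equivalent_at 0 M (normal_form \<omega> a \<nu>) (normal_form \<omega> a \<mu>)"
      using \<nu> unfolding primary_bifurcation_variety_def by blast
    then show False using locally_equivalent_nonzero[of M \<nu> \<mu> \<omega> a] M \<open>\<nu> \<noteq> 0\<close> by blast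
  qed
  then show "\<nu> \<in> {\<nu>. \<nu> = 0}" by simp
next
  fix \<nu> :: real assume "\<nu> \<in> {\<nu>. \<nu> = 0}"
  then have \<nu>: "\<nu> = 0" by simp
  have ne: "\<not> locally_equivalent_at 0 M (normal_form \<omega> a 0) (normal_form \<omega> a \<mu>)" if "\<mu> < 0" for \<mu>
    using not_locally_equivalent_at_0[where M = M and i = i] M(2)[OF ray] a that by blast
  have A: "\<exists>\<mu>. \<bar>\<mu> - 0\<bar> < \<delta> \<and> \<not> locally_equivalent_at 0 M (normal_form \<omega> a 0) (normal_form \<omega> a \<mu>)"
    if "\<delta> > 0" for \<delta> :: real
    using ne[of "- (\<delta> / 2)"] that by (intro exI[of _ "- (\<delta> / 2)"]) simp
  have B: "\<exists>\<mu>. \<bar>\<mu> - 0\<bar> < \<delta> \<and> \<not> topologically_equivalent M (normal_form \<omega> a 0) (normal_form \<omega> a \<mu>)"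
    if "\<delta> > 0" for \<delta> :: real
  proof -
    have "\<not> topologically_equivalent M (normal_form \<omega> a 0) (normal_form \<omega> a (- (\<delta> / 2)))"
      using ne[of "- (\<delta> / 2)"] that equivalent_imp_locally_equivalent[OF \<omega> M(1)] by fastforce
    then show ?thesis using that by (intro exI[of _ "- (\<delta> / 2)"]) simp
  qed
  show "\<nu> \<in> primary_bifurcation_variety M (normal_form \<omega> a)"
    unfolding primary_bifurcation_variety_def bifurcation_variety_def \<nu> using A B by simp
qed

section \<open>A simplex cut by a hyperplane through its interior\<close>

lemma rel_open_affine_Int_open:
  fixes H :: "'a::euclidean_space set"
  assumes "affine H" "open W" "H \<inter> W \<noteq> {}"
  shows "rel_interior (H \<inter> W) = H \<inter> W" "aff_dim (H \<inter> W) = aff_dim H"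
proof -
  have op: "openin (top_of_set (affine hull H)) (H \<inter> W)"
    using assms by (simp add: openin_open_Int hull_same)
  then have hull: "affine hull (H \<inter> W) = affine hull H"
    using assms(3) by (rule affine_hull_openin)
  show "rel_interior (H \<inter> W) = H \<inter> W" using op hull by (simp add: rel_interior_eq)
  show "aff_dim (H \<inter> W) = aff_dim H" using hull by (metis aff_dim_affine_hull)
qed

definition face_plane :: "'n set \<Rightarrow> (real^'n) set" where
  "face_plane G = {u. (\<Sum>i\<in>UNIV. u $ i) = 1 \<and> (\<forall>i. i \<notin> G \<longrightarrow> u $ i = 0)}"

lemma face_plane_eq:
  "face_plane G = {u. \<forall>i. i \<notin> G \<longrightarrow> u $ i = 0} \<inter> {u. (\<chi> i. 1) \<bullet> u = 1}"
  by (auto simp: face_plane_def inner_vec_def)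

lemma affine_face_plane: "affine (face_plane G :: (real^'n) set)"
proof -
  have "subspace {u :: real^'n. \<forall>i. i \<notin> G \<longrightarrow> u $ i = 0}" by (auto simp: subspace_def)
  then show ?thesis unfolding face_plane_eq
    by (intro affine_Int subspace_imp_affine affine_hyperplane)
qed

lemma axis_in_face_plane: "i \<in> G \<Longrightarrow> axis i 1 \<in> face_plane G"
  by (auto simp: face_plane_def axis_def)

text \<open>
  The plane is a hyperplane section of a coordinate subspace.
\<close>
lemma aff_dim_face_plane:
  fixes G :: "'n::finite set"
  assumes "G \<noteq> {}" shows "aff_dim (face_plane G) = int (card G) - 1"
proof -
  let ?V = "{u :: real^'n. \<forall>i. i \<notin> G \<longrightarrow> u $ i = 0}"
  have V: "subspace ?V" by (auto simp: subspace_def)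
  have B: "(\<lambda>i. axis i 1 :: real^'n) ` G \<subseteq> Basis" by (auto simp: axis_in_Basis_iff)
  have "?V = {u. \<forall>v\<in>Basis. v \<notin> (\<lambda>i. axis i 1) ` G \<longrightarrow> u \<bullet> v = 0}"
    by (auto simp: Basis_vec_def inner_axis axis_eq_axis)
  then have "dim ?V = card ((\<lambda>i. axis i 1 :: real^'n) ` G)" using dim_substandard[OF B] by simp
  also have "\<dots> = card G" by (intro card_image) (auto simp: inj_on_def axis_eq_axis)
  finally have dV: "aff_dim ?V = card G" by (simp add: aff_dim_subspace[OF V])
  obtain i where i: "i \<in> G" using assms by blast
  have ne: "?V \<inter> {u. (\<chi> i. 1) \<bullet> u = 1} \<noteq> {}"
    using axis_in_face_plane[OF i] unfolding face_plane_eq by blast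
  moreover have "\<not> ?V \<subseteq> {u. (\<chi> i. 1) \<bullet> u = 1}"
  proof
    assume sub: "?V \<subseteq> {u. (\<chi> i. 1) \<bullet> u = 1}"
    have "(\<chi> i. 1) \<bullet> (0 :: real^'n) = 1" using subsetD[OF sub, of 0] by simp
    then show False by simp
  qed
  ultimately show ?thesis
    unfolding face_plane_eq using aff_dim_affine_Int_hyperplane[OF subspace_imp_affine[OF V], of "\<chi> i. 1" 1] dV
    by simp
qed

definition open_face :: "'n set \<Rightarrow> (real^'n) set" where
  "open_face G = {C \<in> orthant_sphere. \<forall>i. 0 < C $ i \<longleftrightarrow> i \<in> G}"

lemma open_face_zero: "C \<in> open_face G \<Longrightarrow> i \<notin> G \<Longrightarrow> C $ i = 0"
  by (force simp: open_face_def orthant_sphere_def less_le)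

lemma open_face_nonzero:
  assumes "C \<in> open_face G" "i \<in> G" shows "C $ i \<noteq> 0"
proof -
  have "0 < C $ i" using assms by (simp add: open_face_def)
  then show ?thesis by simp
qed

lemma mem_squares_image:
  assumes "e \<subseteq> orthant_sphere"
  shows "u \<in> squares ` e \<longleftrightarrow> u \<in> prob_simplex \<and> roots u \<in> e"
proof
  assume "u \<in> squares ` e"
  then obtain C where C: "C \<in> e" "u = squares C" by blast
  have "C \<in> orthant_sphere" using C assms by blast
  then have "roots u = C" "u \<in> prob_simplex"
    using homeomorphism_apply1[OF homeomorphism_squares] homeomorphism_image1[OF homeomorphism_squares] C(2) by auto
  then show "u \<in> prob_simplex \<and> roots u \<in> e" using C(1) by simp
next
  assume u: "u \<in> prob_simplex \<and> roots u \<in> e"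
  then have "squares (roots u) = u" using homeomorphism_apply2[OF homeomorphism_squares] by blast
  then show "u \<in> squares ` e" using u by (metis image_eqI)
qed

text \<open>
  The segment from \<open>C\<close> to \<open>D\<close> in squared coordinates.
\<close>
definition blend :: "real \<Rightarrow> real^'n \<Rightarrow> real^'n \<Rightarrow> real^'n" where
  "blend t C D = roots ((1 - t) *\<^sub>R squares C + t *\<^sub>R squares D)"

lemma blend_nth_sq: "0 \<le> t \<Longrightarrow> t \<le> 1 \<Longrightarrow> (blend t C D $ i)\<^sup>2 = (1 - t) * (C $ i)\<^sup>2 + t * (D $ i)\<^sup>2"
  by (simp add: blend_def roots_def)

text \<open>
  A direction is in the closure of a cell as soon as some segment ending there runs in the cell.
\<close>
lemma blend_tendsto:
  assumes C: "C \<in> orthant_sphere" and mem: "\<And>t. 0 < t \<Longrightarrow> t \<le> 1 \<Longrightarrow> blend t C D \<in> e"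
  shows "C \<in> closure e"
proof -
  have "(\<lambda>n. blend (1 / real (Suc n)) C D) \<longlonglongrightarrow> blend 0 C D"
    unfolding blend_def roots_def
  proof (rule vec_tendstoI)
    fix i
    have "(\<lambda>n. 1 / real (Suc n)) \<longlonglongrightarrow> 0" using LIMSEQ_inverse_real_of_nat by (simp add: inverse_eq_divide)
    then have "(\<lambda>n. sqrt (((1 - 1 / real (Suc n)) *\<^sub>R squares C + (1 / real (Suc n)) *\<^sub>R squares D) $ i))
        \<longlonglongrightarrow> sqrt (((1 - 0) *\<^sub>R squares C + 0 *\<^sub>R squares D) $ i)"
      by (intro tendsto_intros)
    then show "(\<lambda>n. (\<chi> i. sqrt (((1 - 1 / real (Suc n)) *\<^sub>R squares C + (1 / real (Suc n)) *\<^sub>R squares D) $ i)) $ i)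
        \<longlonglongrightarrow> (\<chi> i. sqrt (((1 - 0) *\<^sub>R squares C + 0 *\<^sub>R squares D) $ i)) $ i"
      by (simp only: vec_lambda_beta)
  qed
  moreover have "blend 0 C D = C"
    using homeomorphism_apply1[OF homeomorphism_squares C] by (simp add: blend_def)
  moreover have "blend (1 / real (Suc n)) C D \<in> e" for n by (intro mem) auto
  ultimately show ?thesis unfolding closure_sequential
    by (intro exI[of _ "\<lambda>n. blend (1 / real (Suc n)) C D"]) auto
qed

lemma blend_open_face:
  assumes C: "C \<in> orthant_sphere" "\<And>i. i \<notin> G \<Longrightarrow> C $ i = 0" and D: "D \<in> open_face G" and t: "0 < t" "t \<le> 1"
  shows "blend t C D \<in> open_face G"
proof -
  have DS: "D \<in> orthant_sphere" using D by (simp add: open_face_def)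
  have sumeq: "(\<Sum>i\<in>UNIV. (blend t C D $ i)\<^sup>2) = (1 - t) * (\<Sum>i\<in>UNIV. (C $ i)\<^sup>2) + t * (\<Sum>i\<in>UNIV. (D $ i)\<^sup>2)"
    using t by (simp add: blend_nth_sq sum.distrib sum_distrib_left)
  have nn: "0 \<le> blend t C D $ i" for i
    using t by (simp add: blend_def roots_def)
  have "norm (blend t C D) = 1"
    using C(1) DS sumeq by (simp add: orthant_sphere_def norm_eq_1_iff)
  moreover have "0 < blend t C D $ i \<longleftrightarrow> i \<in> G" for i
  proof -
    have "0 < blend t C D $ i \<longleftrightarrow> 0 < (1 - t) * (C $ i)\<^sup>2 + t * (D $ i)\<^sup>2"
      by (simp add: blend_def roots_def)
    also have "\<dots> \<longleftrightarrow> i \<in> G"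
    proof (cases "i \<in> G")
      case True
      then have "0 < D $ i" using D by (simp add: open_face_def)
      then show ?thesis using True t by (simp add: add_nonneg_pos)
    next
      case False
      then show ?thesis using C(2) open_face_zero[OF D] by simp
    qed
    finally show ?thesis .
  qed
  ultimately show ?thesis using nn by (simp add: open_face_def orthant_sphere_def)
qed

lemma closed_closed_face:
  "closed {C :: real^'n. C \<in> orthant_sphere \<and> (\<forall>i. i \<notin> G \<longrightarrow> C $ i = 0)}"
proof -
  have eq: "{C :: real^'n. C \<in> orthant_sphere \<and> (\<forall>i. i \<notin> G \<longrightarrow> C $ i = 0)} =
      orthant_sphere \<inter> (\<Inter>i\<in>- G. {C. C $ i = 0})" by auto
  show ?thesis unfolding eq
    by (intro closed_Int closed_orthant_sphere closed_INT ballI closed_Collect_eq continuous_intros)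
qed

lemma squares_open_face:
  "squares ` open_face G = face_plane G \<inter> {u. \<forall>i\<in>G. 0 < u $ i}"
proof (intro set_eqI iffI)
  fix u assume "u \<in> squares ` open_face G"
  then have u: "u \<in> prob_simplex" "roots u \<in> open_face G"
    using mem_squares_image[of "open_face G" u] by (auto simp: open_face_def)
  then have "0 < u $ i \<longleftrightarrow> i \<in> G" for i by (simp add: open_face_def roots_def)
  moreover have "0 \<le> u $ i" for i using u by (simp add: prob_simplex_def)
  ultimately show "u \<in> face_plane G \<inter> {u. \<forall>i\<in>G. 0 < u $ i}"
    using u(1) by (force simp: face_plane_def prob_simplex_def less_le)
next
  fix u assume u: "u \<in> face_plane G \<inter> {u. \<forall>i\<in>G. 0 < u $ i}"
  have pos: "0 < u $ i \<longleftrightarrow> i \<in> G" for i using u by (cases "i \<in> G") (auto simp: face_plane_def)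
  have nn: "0 \<le> u $ i" for i using u by (cases "i \<in> G") (auto simp: face_plane_def less_imp_le)
  have p: "u \<in> prob_simplex" using u nn by (simp add: face_plane_def prob_simplex_def)
  then have "roots u \<in> orthant_sphere" using homeomorphism_image2[OF homeomorphism_squares] by blast
  then have "roots u \<in> open_face G" using pos by (simp add: open_face_def roots_def)
  then show "u \<in> squares ` open_face G"
    using p mem_squares_image[of "open_face G" u] by (auto simp: open_face_def)
qed

lemma open_pos_coords: "open {u :: real^'n. \<forall>i\<in>G. 0 < u $ i}"
proof -
  have "{u :: real^'n. \<forall>i\<in>G. 0 < u $ i} = (\<Inter>i\<in>G. {u. 0 < u $ i})" by auto
  then show ?thesis by (auto intro!: open_INT open_Collect_less continuous_intros)
qed

lemma convex_pos_coords: "convex {u :: real^'n. \<forall>i\<in>G. 0 < u $ i}"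
proof -
  have "{u :: real^'n. \<forall>i\<in>G. 0 < u $ i} = (\<Inter>i\<in>G. {u. axis i 1 \<bullet> u > 0})"
    by (auto simp: inner_axis')
  then show ?thesis by (auto intro!: convex_INT convex_halfspace_gt)
qed

text \<open>
  The simplex spanned by \<open>S\<close> is cut by the hyperplane \<open>\<Sum> \<beta> i * u i =
  0\<close>, which has vertices of the simplex strictly on both sides.
\<close>
locale simplex_cut =
  fixes \<beta> :: "'n::finite \<Rightarrow> real" and S :: "'n set"
  assumes pos_index: "\<exists>i\<in>S. 0 < \<beta> i" and neg_index: "\<exists>i\<in>S. \<beta> i < 0"
begin

definition form :: "real^'n \<Rightarrow> real" where
  "form C = (\<Sum>i\<in>UNIV. \<beta> i * (C $ i)\<^sup>2)"

definition cut :: "(real^'n) set" where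
  "cut = {C \<in> orthant_sphere. (\<forall>i. i \<notin> S \<longrightarrow> C $ i = 0) \<and> 0 \<le> form C}"

definition nonneg_indices :: "'n set" where "nonneg_indices = {i\<in>S. 0 \<le> \<beta> i}"

definition pos_part :: "'n set \<Rightarrow> (real^'n) set" where
  "pos_part G = {C \<in> open_face G. 0 < form C}"

definition zero_part :: "'n set \<Rightarrow> (real^'n) set" where
  "zero_part G = {C \<in> open_face G. form C = 0}"

text \<open>
  These are the faces of the simplex whose relative interior is divided by the hyperplane.
\<close>
definition straddles :: "'n set \<Rightarrow> bool" where
  "straddles G \<longleftrightarrow> G \<subseteq> S \<and> (\<exists>i\<in>G. 0 < \<beta> i) \<and> (\<exists>i\<in>G. \<beta> i < 0)"

text \<open>
  A face with a vertex where \<open>\<beta>\<close> is negative and no vertex where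
  \<open>\<beta>\<close> is positive has its relative interior strictly on the negative side
  (\<open>form_neg\<close>) and contributes nothing.
\<close>
definition cut_cells :: "(real^'n) set set" where
  "cut_cells = open_face ` {G. G \<noteq> {} \<and> G \<subseteq> nonneg_indices} \<union>
     pos_part ` {G. straddles G} \<union> zero_part ` {G. straddles G}"

lemma cut_cells_cases:
  assumes "e \<in> cut_cells"
  obtains (face) G where "G \<noteq> {}" "G \<subseteq> nonneg_indices" "e = open_face G"
  | (pos) G where "straddles G" "e = pos_part G"
  | (zero) G where "straddles G" "e = zero_part G"
  using assms by (auto simp: cut_cells_def)

lemma form_open_face: "C \<in> open_face G \<Longrightarrow> form C = (\<Sum>i\<in>G. \<beta> i * (C $ i)\<^sup>2)"
  unfolding form_def by (rule sum.mono_neutral_right) (auto simp: open_face_zero)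

lemma form_blend: "0 \<le> t \<Longrightarrow> t \<le> 1 \<Longrightarrow> form (blend t C D) = (1 - t) * form C + t * form D"
  unfolding form_def sum_distrib_left sum.distrib[symmetric]
  by (rule sum.cong) (simp_all add: blend_nth_sq algebra_simps)

lemma continuous_on_form: "continuous_on A form"
  unfolding form_def by (intro continuous_intros)

lemma closed_form: "closed {C. 0 \<le> form C}" "closed {C. form C = 0}"
  using continuous_on_form[of UNIV] by (auto intro!: closed_Collect_le closed_Collect_eq continuous_intros)

lemma exists_in_open_face:
  assumes w: "\<And>i. 0 < w $ i \<longleftrightarrow> i \<in> G" "\<And>i. i \<notin> G \<Longrightarrow> w $ i = 0" and G: "G \<noteq> {}"
  obtains C where "C \<in> open_face G" "form C = (\<Sum>i\<in>UNIV. \<beta> i * w $ i) / (\<Sum>i\<in>UNIV. w $ i)"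
    "0 < (\<Sum>i\<in>UNIV. w $ i)"
proof -
  let ?W = "\<Sum>i\<in>UNIV. w $ i"
  have nn: "0 \<le> w $ i" for i using w[of i] by (cases "i \<in> G") auto
  obtain j where j: "j \<in> G" using G by blast
  then have W: "0 < ?W" using w(1)[of j] nn by (intro sum_pos2[of UNIV j]) auto
  define u where "u = w /\<^sub>R ?W"
  have "u \<in> prob_simplex" using nn W
    by (simp add: u_def prob_simplex_def flip: sum_distrib_left)
  then have r: "roots u \<in> orthant_sphere" "squares (roots u) = u"
    using homeomorphism_image2[OF homeomorphism_squares] homeomorphism_apply2[OF homeomorphism_squares] by blast+
  have "0 < roots u $ i \<longleftrightarrow> i \<in> G" for i using W w(1)[of i] by (simp add: roots_def u_def zero_less_mult_iff)
  then have 1: "roots u \<in> open_face G" using r(1) by (simp add: open_face_def)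
  have "(roots u $ i)\<^sup>2 = w $ i / ?W" for i
    using r(2) squares_nth[of "roots u" i] by (simp add: u_def field_simps)
  then have "form (roots u) = (\<Sum>i\<in>UNIV. \<beta> i * w $ i) / ?W"
    by (simp add: form_def sum_divide_distrib)
  then show ?thesis using that 1 W by blast
qed

lemma open_face_nonempty: "G \<noteq> {} \<Longrightarrow> open_face (G :: 'n set) \<noteq> {}"
  by (rule exists_in_open_face[of "\<chi> i. if i \<in> G then 1 else 0" G]) auto

text \<open>
  Starting with equal weights on \<open>G\<close>, additional weight at a vertex with positive or
  negative \<open>\<beta>\<close> makes the form positive, or balances it to zero.
\<close>
lemma parts_nonempty:
  assumes G: "straddles G" shows "pos_part G \<noteq> {}" "zero_part G \<noteq> {}"
proof -
  obtain p n where pn: "p \<in> G" "0 < \<beta> p" "n \<in> G" "\<beta> n < 0" using G by (auto simp: straddles_def)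
  have ne: "G \<noteq> {}" using pn by auto
  have weighted: "\<exists>C\<in>open_face G. sgn (form C) = sgn ((\<Sum>i\<in>G. \<beta> i) + x * \<beta> p + y * \<beta> n)"
    if xy: "0 \<le> x" "0 \<le> y" for x y :: real
  proof -
    define w :: "real^'n" where
      "w = (\<chi> i. (if i \<in> G then 1 else 0) + (if i = p then x else 0) + (if i = n then y else 0))"
    have "(\<Sum>i\<in>UNIV. \<beta> i * w $ i) = (\<Sum>i\<in>G. \<beta> i) + x * \<beta> p + y * \<beta> n"
      by (simp add: w_def distrib_left sum.distrib if_distrib[of "\<lambda>z. _ * z"] sum.If_cases mult.commute cong: if_cong)
    moreover obtain C where "C \<in> open_face G" "form C = (\<Sum>i\<in>UNIV. \<beta> i * w $ i) / (\<Sum>i\<in>UNIV. w $ i)"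
      "0 < (\<Sum>i\<in>UNIV. w $ i)"
    proof (rule exists_in_open_face[of w G])
      fix i show "0 < w $ i \<longleftrightarrow> i \<in> G" using xy pn by (auto simp: w_def)
      show "i \<notin> G \<Longrightarrow> w $ i = 0" using pn by (auto simp: w_def)
    qed (use ne in auto)
    ultimately show ?thesis by (intro bexI[of _ C]) (simp_all add: sgn_divide)
  qed
  let ?v = "\<Sum>i\<in>G. \<beta> i"
  have "?v + ((\<bar>?v\<bar> + 1) / \<beta> p) * \<beta> p + 0 * \<beta> n > 0" using pn by simp
  then have "\<exists>C\<in>open_face G. sgn (form C) = 1"
    using weighted[of "(\<bar>?v\<bar> + 1) / \<beta> p" 0] pn by auto
  then show "pos_part G \<noteq> {}" by (auto simp: pos_part_def sgn_1_pos)
  have "\<exists>C\<in>open_face G. sgn (form C) = 0"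
  proof (cases "0 \<le> ?v")
    case True
    then have "0 \<le> ?v / - \<beta> n" using pn by (intro divide_nonneg_pos) auto
    from weighted[OF order_refl this] show ?thesis using pn by simp
  next
    case False
    then have "0 \<le> - ?v / \<beta> p" using pn by (intro divide_nonneg_pos) auto
    from weighted[OF this order_refl] show ?thesis using pn by simp
  qed
  then show "zero_part G \<noteq> {}" by (auto simp: zero_part_def sgn_eq_0_iff)
qed

text \<open>
  Blending with an interior point makes every coordinate in \<open>G\<close> positive.
\<close>
lemma closure_open_face:
  fixes G :: "'n set"
  assumes "G \<noteq> {}"
  shows "closure (open_face G) = {C \<in> orthant_sphere. \<forall>i. i \<notin> G \<longrightarrow> C $ i = (0::real)}"
proof
  show "closure (open_face G) \<subseteq> {C \<in> orthant_sphere. \<forall>i. i \<notin> G \<longrightarrow> C $ i = 0}"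
    by (intro closure_minimal closed_closed_face) (auto simp: open_face_zero, simp add: open_face_def)
  obtain D :: "real^'n" where D: "D \<in> open_face G" using open_face_nonempty[OF assms] by blast
  show "{C \<in> orthant_sphere. \<forall>i. i \<notin> G \<longrightarrow> C $ i = 0} \<subseteq> closure (open_face G)"
    using D by (auto intro!: blend_tendsto[of _ D] blend_open_face)
qed

lemma closure_pos_part:
  assumes G: "straddles G"
  shows "closure (pos_part G) = {C \<in> orthant_sphere. (\<forall>i. i \<notin> G \<longrightarrow> C $ i = 0) \<and> 0 \<le> form C}"
proof
  have cl: "closed ({C \<in> orthant_sphere. \<forall>i. i \<notin> G \<longrightarrow> C $ i = 0} \<inter> {C. 0 \<le> form C})"
    by (intro closed_Int closed_closed_face closed_form)
  have "closure (pos_part G) \<subseteq> {C \<in> orthant_sphere. \<forall>i. i \<notin> G \<longrightarrow> C $ i = 0} \<inter> {C. 0 \<le> form C}"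
    by (rule closure_minimal[OF _ cl]) (auto simp: pos_part_def open_face_zero, simp add: open_face_def)
  then show "closure (pos_part G) \<subseteq> {C \<in> orthant_sphere. (\<forall>i. i \<notin> G \<longrightarrow> C $ i = 0) \<and> 0 \<le> form C}" by auto
  obtain D where D: "D \<in> open_face G" "0 < form D" using parts_nonempty(1)[OF G] by (auto simp: pos_part_def)
  have "blend t C D \<in> pos_part G"
    if "C \<in> orthant_sphere" "\<forall>i. i \<notin> G \<longrightarrow> C $ i = 0" "0 \<le> form C" "0 < t" "t \<le> 1" for C t
    using that D by (auto simp: pos_part_def form_blend intro!: blend_open_face add_nonneg_pos)
  then show "{C \<in> orthant_sphere. (\<forall>i. i \<notin> G \<longrightarrow> C $ i = 0) \<and> 0 \<le> form C} \<subseteq> closure (pos_part G)"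
    by (auto intro!: blend_tendsto[of _ D])
qed

lemma closure_zero_part:
  assumes G: "straddles G"
  shows "closure (zero_part G) = {C \<in> orthant_sphere. (\<forall>i. i \<notin> G \<longrightarrow> C $ i = 0) \<and> form C = 0}"
proof
  have cl: "closed ({C \<in> orthant_sphere. \<forall>i. i \<notin> G \<longrightarrow> C $ i = 0} \<inter> {C. form C = 0})"
    by (intro closed_Int closed_closed_face closed_form)
  have "closure (zero_part G) \<subseteq> {C \<in> orthant_sphere. \<forall>i. i \<notin> G \<longrightarrow> C $ i = 0} \<inter> {C. form C = 0}"
    by (rule closure_minimal[OF _ cl]) (auto simp: zero_part_def open_face_zero, simp add: open_face_def)
  then show "closure (zero_part G) \<subseteq> {C \<in> orthant_sphere. (\<forall>i. i \<notin> G \<longrightarrow> C $ i = 0) \<and> form C = 0}" by auto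
  obtain D where D: "D \<in> open_face G" "form D = 0" using parts_nonempty(2)[OF G] by (auto simp: zero_part_def)
  have "blend t C D \<in> zero_part G"
    if "C \<in> orthant_sphere" "\<forall>i. i \<notin> G \<longrightarrow> C $ i = 0" "form C = 0" "0 < t" "t \<le> 1" for C t
    using that D by (auto simp: zero_part_def form_blend intro!: blend_open_face)
  then show "{C \<in> orthant_sphere. (\<forall>i. i \<notin> G \<longrightarrow> C $ i = 0) \<and> form C = 0} \<subseteq> closure (zero_part G)"
    by (auto intro!: blend_tendsto[of _ D])
qed

lemma form_roots: "u \<in> prob_simplex \<Longrightarrow> form (roots u) = (\<chi> i. \<beta> i) \<bullet> u"
  by (simp add: form_def roots_def prob_simplex_def inner_vec_def)

lemma squares_parts:
  "squares ` pos_part G = face_plane G \<inter> ({u. \<forall>i\<in>G. 0 < u $ i} \<inter> {u. (\<chi> i. \<beta> i) \<bullet> u > 0})"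
  "squares ` zero_part G = (face_plane G \<inter> {u. (\<chi> i. \<beta> i) \<bullet> u = 0}) \<inter> {u. \<forall>i\<in>G. 0 < u $ i}"
proof -
  have sub: "open_face G \<subseteq> orthant_sphere" "pos_part G \<subseteq> orthant_sphere" "zero_part G \<subseteq> orthant_sphere"
    by (auto simp: open_face_def pos_part_def zero_part_def)
  have "u \<in> squares ` pos_part G \<longleftrightarrow> u \<in> squares ` open_face G \<and> (\<chi> i. \<beta> i) \<bullet> u > 0"
    "u \<in> squares ` zero_part G \<longleftrightarrow> u \<in> squares ` open_face G \<and> (\<chi> i. \<beta> i) \<bullet> u = 0" for u
    unfolding mem_squares_image[OF sub(1)] mem_squares_image[OF sub(2)] mem_squares_image[OF sub(3)]
    by (auto simp: pos_part_def zero_part_def form_roots)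
  then show "squares ` pos_part G = face_plane G \<inter> ({u. \<forall>i\<in>G. 0 < u $ i} \<inter> {u. (\<chi> i. \<beta> i) \<bullet> u > 0})"
    "squares ` zero_part G = (face_plane G \<inter> {u. (\<chi> i. \<beta> i) \<bullet> u = 0}) \<inter> {u. \<forall>i\<in>G. 0 < u $ i}"
    unfolding squares_open_face by auto
qed

lemma cell_shape_face:
  fixes G :: "'n set"
  assumes "G \<noteq> {}"
  shows "convex (squares ` open_face G)" "rel_interior (squares ` open_face G) = squares ` open_face G"
    "card G = cell_dim (open_face G) + 1"
proof -
  have ne: "face_plane G \<inter> {u. \<forall>i\<in>G. 0 < u $ i} \<noteq> {}"
    using open_face_nonempty[OF assms] unfolding squares_open_face[symmetric] by simp
  note ro = rel_open_affine_Int_open[OF affine_face_plane open_pos_coords ne]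
  show "convex (squares ` open_face G)" unfolding squares_open_face
    by (intro convex_Int convex_pos_coords affine_imp_convex affine_face_plane)
  show "rel_interior (squares ` open_face G) = squares ` open_face G"
    unfolding squares_open_face by (rule ro(1))
  have "card G > 0" using assms by (simp add: card_gt_0_iff)
  then show "card G = cell_dim (open_face G) + 1"
    unfolding cell_dim_def squares_open_face ro(2) aff_dim_face_plane[OF assms] by simp
qed

lemma cell_shape_pos:
  assumes G: "straddles G"
  shows "convex (squares ` pos_part G)" "rel_interior (squares ` pos_part G) = squares ` pos_part G"
    "card G = cell_dim (pos_part G) + 1"
proof -
  have G0: "G \<noteq> {}" using G by (auto simp: straddles_def)
  have ne: "face_plane G \<inter> ({u. \<forall>i\<in>G. 0 < u $ i} \<inter> {u. (\<chi> i. \<beta> i) \<bullet> u > 0}) \<noteq> {}"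
    using parts_nonempty(1)[OF G] unfolding squares_parts[symmetric] by simp
  have op: "open ({u. \<forall>i\<in>G. 0 < u $ i} \<inter> {u. (\<chi> i. \<beta> i) \<bullet> u > 0})"
    by (intro open_Int open_pos_coords open_halfspace_gt)
  note ro = rel_open_affine_Int_open[OF affine_face_plane op ne]
  show "convex (squares ` pos_part G)" unfolding squares_parts
    by (intro convex_Int convex_pos_coords affine_imp_convex affine_face_plane convex_halfspace_gt)
  show "rel_interior (squares ` pos_part G) = squares ` pos_part G"
    unfolding squares_parts by (rule ro(1))
  have "card G > 0" using G0 by (simp add: card_gt_0_iff)
  then show "card G = cell_dim (pos_part G) + 1"
    unfolding cell_dim_def squares_parts ro(2) aff_dim_face_plane[OF G0] by simp
qed

text \<open>
  The hyperplane does not contain the plane of the face, so the dimension drops by one while the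
  number of circles stays the same.
\<close>
lemma cell_shape_zero:
  assumes G: "straddles G"
  shows "convex (squares ` zero_part G)" "rel_interior (squares ` zero_part G) = squares ` zero_part G"
    "card G = cell_dim (zero_part G) + 2"
proof -
  have G0: "G \<noteq> {}" using G by (auto simp: straddles_def)
  let ?H = "face_plane G \<inter> {u. (\<chi> i. \<beta> i) \<bullet> u = 0}"
  have ne: "?H \<inter> {u. \<forall>i\<in>G. 0 < u $ i} \<noteq> {}"
    using parts_nonempty(2)[OF G] unfolding squares_parts[symmetric] by simp
  have H: "affine ?H" by (intro affine_Int affine_face_plane affine_hyperplane)
  note ro = rel_open_affine_Int_open[OF H open_pos_coords ne]
  show "convex (squares ` zero_part G)" unfolding squares_parts
    by (intro convex_Int convex_pos_coords affine_imp_convex affine_face_plane convex_hyperplane)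
  show "rel_interior (squares ` zero_part G) = squares ` zero_part G"
    unfolding squares_parts by (rule ro(1))
  obtain p n where pn: "p \<in> G" "0 < \<beta> p" "n \<in> G" "\<beta> n < 0" using G by (auto simp: straddles_def)
  have "\<not> face_plane G \<subseteq> {u. (\<chi> i. \<beta> i) \<bullet> u = 0}"
  proof
    assume "face_plane G \<subseteq> {u. (\<chi> i. \<beta> i) \<bullet> u = 0}"
    then have "(\<chi> i. \<beta> i) \<bullet> axis p 1 = 0" using axis_in_face_plane[OF pn(1)] by blast
    then show False using pn(2) by (simp add: inner_axis)
  qed
  then have d: "aff_dim ?H = int (card G) - 1 - 1"
    using aff_dim_affine_Int_hyperplane[OF affine_face_plane, of G "\<chi> i. \<beta> i" 0] ne
      aff_dim_face_plane[OF G0] by auto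
  have "card {p, n} \<le> card G" using pn by (intro card_mono) auto
  moreover have "p \<noteq> n" using pn by auto
  ultimately show "card G = cell_dim (zero_part G) + 2"
    unfolding cell_dim_def squares_parts ro(2) d by simp
qed

lemma support_parts:
  "G \<noteq> {} \<Longrightarrow> support (open_face (G :: 'n set)) = G" "straddles G \<Longrightarrow> support (pos_part G) = G"
  "straddles G \<Longrightarrow> support (zero_part G) = G"
proof -
  have eq: "support e = G" if e: "e \<subseteq> open_face G" "e \<noteq> {}" for e and G :: "'n set"
  proof
    show "support e \<subseteq> G" using e(1) open_face_zero[of _ G] by (auto simp: support_def)
    obtain C where "C \<in> e" using e(2) by blast
    moreover have "C $ i \<noteq> 0" if "i \<in> G" "C \<in> open_face G" for i
      using open_face_nonzero that by blast
    ultimately show "G \<subseteq> support e" using e(1) by (auto simp: support_def)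
  qed
  show "G \<noteq> {} \<Longrightarrow> support (open_face (G :: 'n set)) = G" by (rule eq[OF order_refl open_face_nonempty])
  show "straddles G \<Longrightarrow> support (pos_part G) = G"
    using parts_nonempty(1) by (intro eq) (auto simp: pos_part_def)
  show "straddles G \<Longrightarrow> support (zero_part G) = G"
    using parts_nonempty(2) by (intro eq) (auto simp: zero_part_def)
qed

lemma cell_in_open_face:
  assumes "e \<in> cut_cells"
  shows "e \<subseteq> open_face (support e)" "support e \<subseteq> S" "e \<noteq> {}" "support e \<noteq> {}"
proof -
  from assms have "e \<subseteq> open_face (support e) \<and> support e \<subseteq> S \<and> e \<noteq> {} \<and> support e \<noteq> {}"
  proof (cases rule: cut_cells_cases)
    case (face G)
    then show ?thesis using support_parts(1) open_face_nonempty by (auto simp: nonneg_indices_def)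
  next
    case (pos G)
    then show ?thesis using support_parts(2) parts_nonempty(1) by (auto simp: pos_part_def straddles_def)
  next
    case (zero G)
    then show ?thesis using support_parts(3) parts_nonempty(2) by (auto simp: zero_part_def straddles_def)
  qed
  then show "e \<subseteq> open_face (support e)" "support e \<subseteq> S" "e \<noteq> {}" "support e \<noteq> {}" by auto
qed

lemma form_nonneg_face: "G \<subseteq> nonneg_indices \<Longrightarrow> C \<in> open_face G \<Longrightarrow> 0 \<le> form C"
  by (auto simp: form_open_face nonneg_indices_def intro!: sum_nonneg)

lemma form_neg:
  assumes C: "C \<in> open_face G" and n: "n \<in> G" "\<beta> n < 0" and le: "\<forall>i\<in>G. \<beta> i \<le> 0"
  shows "form C < 0"
proof -
  have "\<beta> i * (C $ i)\<^sup>2 \<le> 0" if "i \<in> G" for i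
    using that le by (auto intro!: mult_nonpos_nonneg)
  moreover have "\<beta> n * (C $ n)\<^sup>2 < 0"
    using n open_face_nonzero[OF C n(1)] by (auto intro!: mult_neg_pos)
  ultimately have "(\<Sum>i\<in>G. \<beta> i * (C $ i)\<^sup>2) < (\<Sum>i\<in>G. 0)"
    using n(1) by (intro sum_strict_mono_ex1) auto
  then show ?thesis using form_open_face[OF C] by simp
qed

lemma cell_subset_cut:
  assumes "e \<in> cut_cells" shows "e \<subseteq> cut"
proof
  fix C assume C: "C \<in> e"
  have f: "C \<in> open_face (support e)" using cell_in_open_face(1)[OF assms] C by blast
  have "C $ i = 0" if "i \<notin> S" for i
    using open_face_zero[OF f] cell_in_open_face(2)[OF assms] that by blast
  moreover have "0 \<le> form C"
    using assms C by (cases rule: cut_cells_cases) (auto simp: form_nonneg_face pos_part_def zero_part_def)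
  ultimately show "C \<in> cut" using f by (auto simp: cut_def open_face_def)
qed

lemma cut_cells_partition: "partition_on cut cut_cells"
proof -
  have "\<exists>e\<in>cut_cells. C \<in> e" if C: "C \<in> cut" for C
  proof -
    define G where "G = {i. 0 < C $ i}"
    have CG: "C \<in> open_face G" using C by (simp add: cut_def open_face_def G_def)
    have GS: "G \<subseteq> S" using C by (auto simp: G_def cut_def)
    have nn: "0 \<le> form C" using C by (simp add: cut_def)
    have "G \<noteq> {}"
    proof
      assume "G = {}"
      then have "C = 0" using open_face_zero[OF CG] by (simp add: vec_eq_iff)
      then show False using CG by (simp add: open_face_def orthant_sphere_def)
    qed
    show ?thesis
    proof (cases "G \<subseteq> nonneg_indices")
      case True
      then show ?thesis using CG \<open>G \<noteq> {}\<close> by (auto simp: cut_cells_def)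
    next
      case False
      then obtain n where n: "n \<in> G" "n \<notin> nonneg_indices" by blast
      then have n: "n \<in> G" "\<beta> n < 0" using GS by (auto simp: nonneg_indices_def)
      have "\<exists>i\<in>G. 0 < \<beta> i"
        using form_neg[OF CG n] nn by fastforce
      then have "straddles G" using GS n by (auto simp: straddles_def)
      moreover have "C \<in> pos_part G \<or> C \<in> zero_part G"
        using CG nn by (auto simp: pos_part_def zero_part_def)
      ultimately show ?thesis by (auto simp: cut_cells_def)
    qed
  qed
  then have "\<Union> cut_cells = cut" using cell_subset_cut by blast
  moreover have "{} \<notin> cut_cells" using cell_in_open_face(3) by blast
  moreover have "disjoint cut_cells"
  proof (rule disjointI)
    fix e e' assume e: "e \<in> cut_cells" "e' \<in> cut_cells" "e \<noteq> e'"
    show "e \<inter> e' = {}"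
    proof (rule ccontr)
      assume "e \<inter> e' \<noteq> {}"
      then obtain C where C: "C \<in> e" "C \<in> e'" by blast
      have "C \<in> open_face (support e)" "C \<in> open_face (support e')"
        using C cell_in_open_face(1) e by blast+
      then have G: "support e = support e'" by (auto simp: open_face_def)
      have sep: "\<not> G \<subseteq> nonneg_indices" if "straddles G" for G
        using that by (auto simp: straddles_def nonneg_indices_def)
      have shape: "(support c \<subseteq> nonneg_indices \<and> c = open_face (support c)) \<or>
          (straddles (support c) \<and> (0 < form C \<and> c = pos_part (support c) \<or>
           form C = 0 \<and> c = zero_part (support c)))" if "c \<in> cut_cells" "C \<in> c" for c
        using that(1)
      proof (cases rule: cut_cells_cases)
        case (face G) then show ?thesis by (simp add: support_parts)
      next
        case (pos G) then show ?thesis using that(2) by (simp add: support_parts) (simp add: pos_part_def)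
      next
        case (zero G) then show ?thesis using that(2) by (simp add: support_parts) (simp add: zero_part_def)
      qed
      show False using shape[OF e(1) C(1)] shape[OF e(2) C(2)] sep[of "support e'"] e(3) unfolding G by force
    qed
  qed
  ultimately show ?thesis by (simp add: partition_on_def)
qed

text \<open>
  The support of a cell that meets the closure of \<open>e\<close> is contained in the support of
  \<open>e\<close>. If \<open>e\<close> lies in the hyperplane, there is a point of
  \<open>e'\<close> where the form vanishes. On a face without negative \<open>\<beta>\<close> this
  means that \<open>\<beta>\<close> vanishes at all its vertices, so the whole of \<open>e'\<close>
  lies in the hyperplane.
\<close>
lemma cut_cells_frontier:
  assumes e: "e \<in> cut_cells" "e' \<in> cut_cells" and meet: "e' \<inter> closure e \<noteq> {}"
  shows "e' \<subseteq> closure e"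
proof -
  obtain C where C: "C \<in> e'" "C \<in> closure e" using meet by blast
  have C': "C \<in> open_face (support e')" using C(1) cell_in_open_face(1)[OF e(2)] by blast
  have sup: "C $ i = 0" if "i \<notin> support e" for i
  proof -
    have "closure e \<subseteq> {C. C $ i = 0}"
      using that by (intro closure_minimal closed_Collect_eq continuous_intros) (auto simp: support_def)
    then show ?thesis using C(2) by blast
  qed
  then have G: "support e' \<subseteq> support e" using C' by (force simp: open_face_def)
  have D: "D \<in> orthant_sphere" "D $ i = 0" if "D \<in> e'" "i \<notin> support e" for D i
    using that cell_in_open_face(1)[OF e(2)] open_face_zero[of D "support e'" i] G
    by (auto simp: open_face_def)
  have D1: "D \<in> orthant_sphere" "0 \<le> form D" if "D \<in> e'" for D
    using that cell_subset_cut[OF e(2)] by (auto simp: cut_def)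
  from e(1) show ?thesis
  proof (cases rule: cut_cells_cases)
    case (face H)
    have H: "support e = H" unfolding face(3) by (rule support_parts(1)[OF face(1)])
    show ?thesis unfolding face(3) closure_open_face[OF face(1)] using D(2)[unfolded H] D1 by auto
  next
    case (pos H)
    have H: "support e = H" unfolding pos(2) by (rule support_parts(2)[OF pos(1)])
    show ?thesis unfolding pos(2) closure_pos_part[OF pos(1)] using D(2)[unfolded H] D1 by auto
  next
    case (zero H)
    have H: "support e = H" unfolding zero(2) by (rule support_parts(3)[OF zero(1)])
    have C0: "form C = 0" using C(2) unfolding zero(2) closure_zero_part[OF zero(1)] by simp
    have "form D = 0" if "D \<in> e'" for D
      using e(2)
    proof (cases rule: cut_cells_cases)
      case (face G)
      have "C \<in> open_face G" "D \<in> open_face G" using C(1) that face by auto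
      have "0 \<le> \<beta> i * (C $ i)\<^sup>2" if "i \<in> G" for i
        using face(2) that by (auto simp: nonneg_indices_def)
      then have "\<forall>i\<in>G. \<beta> i * (C $ i)\<^sup>2 = 0"
        using C0 form_open_face[OF \<open>C \<in> open_face G\<close>]
          sum_nonneg_eq_0_iff[of G "\<lambda>i. \<beta> i * (C $ i)\<^sup>2"] by auto
      then have "\<beta> i = 0" if "i \<in> G" for i
        using that open_face_nonzero[OF \<open>C \<in> open_face G\<close> that] by auto
      then show ?thesis by (simp add: form_open_face[OF \<open>D \<in> open_face G\<close>])
    next
      case (pos G)
      then show ?thesis using C0 C(1) by (simp add: pos_part_def)
    next
      case (zero G)
      then show ?thesis using that by (simp add: zero_part_def)
    qed
    then show ?thesis unfolding zero(2) closure_zero_part[OF zero(1)] using D(2)[unfolded H] D1 by auto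
  qed
qed

lemma straddles_S: "straddles S"
  using pos_index neg_index by (auto simp: straddles_def)

lemma cut_eq_closure: "cut = closure (pos_part S)"
  unfolding closure_pos_part[OF straddles_S] by (simp add: cut_def)

lemma compact_cut: "compact cut"
proof -
  have "cut \<subseteq> orthant_sphere" by (auto simp: cut_def)
  then show ?thesis unfolding cut_eq_closure
    by (metis closed_closure closed_Int_compact compact_orthant_sphere inf.absorb_iff1)
qed

lemma cut_nonempty: "cut \<noteq> {}"
  unfolding cut_eq_closure using parts_nonempty(1)[OF straddles_S] by simp

lemma toral_cells_cut:
  assumes "continuous_on cut \<rho>" "\<And>C. C \<in> cut \<Longrightarrow> 0 < \<rho> C"
  shows "toral_cells cut cut_cells \<rho>"
proof
  show "finite cut_cells" by (simp add: cut_cells_def)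
  show "partition_on cut cut_cells" by (rule cut_cells_partition)
  show "compact cut" by (rule compact_cut)
  show "cut \<subseteq> orthant_sphere" by (auto simp: cut_def)
  fix e assume e: "e \<in> cut_cells"
  have "convex (squares ` e) \<and> rel_interior (squares ` e) = squares ` e \<and>
      card (support e) \<in> {cell_dim e + 1, cell_dim e + 2}"
    using e
  proof (cases rule: cut_cells_cases)
    case (face G)
    show ?thesis unfolding face(3) support_parts(1)[OF face(1)]
      using cell_shape_face[OF face(1)] by simp
  next
    case (pos G)
    show ?thesis unfolding pos(2) support_parts(2)[OF pos(1)]
      using cell_shape_pos[OF pos(1)] by simp
  next
    case (zero G)
    show ?thesis unfolding zero(2) support_parts(3)[OF zero(1)]
      using cell_shape_zero[OF zero(1)] by simp
  qed
  then show "convex (squares ` e)" "rel_interior (squares ` e) = squares ` e"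
    "card (support e) \<in> {cell_dim e + 1, cell_dim e + 2}" by auto
  show "\<And>e'. e' \<in> cut_cells \<Longrightarrow> e' \<inter> closure e \<noteq> {} \<Longrightarrow> e' \<subseteq> closure e"
    by (rule cut_cells_frontier[OF e])
  show "\<And>C i. C \<in> e \<Longrightarrow> i \<in> support e \<Longrightarrow> C $ i \<noteq> 0"
    using cell_in_open_face(1)[OF e] by (force simp: open_face_def)
qed (use assms in auto)

end

section \<open>The invariant toral manifold\<close>

lemma growth_solution_scale:
  fixes u :: "real \<Rightarrow> (real \<times> real)^'n::{finite,linorder}"
  assumes u: "\<And>i. norm (u t $ i) = x t * norm (u 0 $ i)"
  shows "growth a \<nu> (u t) = \<nu> + (x t)\<^sup>2 * quad a (u 0) + x t ^ 4 * quart a (u 0)"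
proof -
  have "0 \<le> x t \<or> u 0 = 0"
  proof (cases "u 0 = 0")
    case False
    then obtain i where "u 0 $ i \<noteq> 0" by (auto simp: vec_eq_iff)
    then show ?thesis using u[of i] norm_ge_zero[of "u t $ i"] by (simp add: zero_le_mult_iff)
  qed simp
  then have "growth a \<nu> (u t) = growth a \<nu> (x t *\<^sub>R u 0)"
    using u by (intro growth_cong) auto
  then show ?thesis by (simp add: growth_scaleR)
qed

text \<open>
  Along a solution the growth rate is a polynomial in the scaling factor \<open>x\<close> with
  \<open>x' = x * growth\<close>; so its derivative is a multiple of itself.
\<close>
lemma solution_growth_sign:
  fixes u :: "real \<Rightarrow> (real \<times> real)^'n::{finite,linorder}"
  assumes sol: "solution_on (normal_form \<omega> a \<nu>) {0..T} u" and T: "0 \<le> T"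
  obtains m where "m > 0" "growth a \<nu> (u T) = m * growth a \<nu> (u 0)"
proof -
  obtain x where x: "x 0 = 1" "\<And>t. t \<in> {0..T} \<Longrightarrow> 0 < x t"
    "\<And>t. t \<in> {0..T} \<Longrightarrow> (x has_real_derivative x t * growth a \<nu> (u t)) (at t within {0..T})"
    "\<And>t i. t \<in> {0..T} \<Longrightarrow> norm (u t $ i) = x t * norm (u 0 $ i)"
    using solution_norms[OF sol] by metis
  let ?y = "\<lambda>t. \<nu> + (x t)\<^sup>2 * quad a (u 0) + x t ^ 4 * quart a (u 0)"
  let ?c = "\<lambda>t. 2 * (x t)\<^sup>2 * quad a (u 0) + 4 * x t ^ 4 * quart a (u 0)"
  have y: "growth a \<nu> (u t) = ?y t" if "t \<in> {0..T}" for t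
    using x(4)[OF that] by (rule growth_solution_scale)
  have xd: "(x has_real_derivative x t * ?y t) (at t within {0..T})" if "t \<in> {0..T}" for t
    using x(3)[OF that] y[OF that] by simp
  have "(?y has_real_derivative ?c t * ?y t) (at t within {0..T})" if "t \<in> {0..T}" for t
    by (rule derivative_eq_intros xd[OF that] refl)+ (simp add: algebra_simps power2_eq_square power4_eq_xxxx eval_nat_numeral)
  moreover have "continuous_on {0..T} ?c"
    using DERIV_continuous_on[OF x(3)] by (intro continuous_intros)
  ultimately have "?y T = exp (integral {0..T} ?c) * ?y 0"
    using T by (intro linear_ode_unique[of T ?c ?y T]) auto
  then show ?thesis using that[of "exp (integral {0..T} ?c)"] y[of T] y[of 0] T by simp
qed

lemma direction_scale:
  fixes p q :: "('b::real_normed_vector)^'n"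
  assumes "\<And>i. norm (q $ i) = x * norm (p $ i)" "0 < x"
  shows "direction q = direction p"
proof -
  have "norm q = x * norm p" using assms by (intro norm_vec_scale) auto
  then show ?thesis using assms by (simp add: direction_def vec_eq_iff)
qed

lemma solution_direction:
  assumes sol: "solution_on (normal_form \<omega> a \<nu>) {0..T} u" and T: "0 \<le> T"
  shows "direction (u T) = direction (u 0)" "u T = 0 \<longleftrightarrow> u 0 = 0"
proof -
  obtain x where x: "\<And>t. t \<in> {0..T} \<Longrightarrow> 0 < x t"
    "\<And>t i. t \<in> {0..T} \<Longrightarrow> norm (u t $ i) = x t * norm (u 0 $ i)"
    using solution_norms[OF sol] by metis
  have T': "T \<in> {0..T}" using T by simp
  show "direction (u T) = direction (u 0)" by (rule direction_scale[OF x(2)[OF T'] x(1)[OF T']])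
  have "norm (u T) = x T * norm (u 0)" using x(1)[OF T'] x(2)[OF T'] by (intro norm_vec_scale) auto
  then show "u T = 0 \<longleftrightarrow> u 0 = 0" using x(1)[OF T'] by (metis mult_eq_0_iff norm_eq_zero less_irrefl)
qed

lemma growth_direction: "growth a \<nu> p = growth a \<nu> (norm p *\<^sub>R direction p)"
  by (rule growth_cong) (cases "p = 0"; simp add: direction_def)

lemma direction_twist [simp]: "direction (twist \<theta> p) = direction p"
  by (simp add: direction_def)

lemma interval_segment:
  assumes "is_interval I" "b \<in> I" "c \<in> I" shows "{b..c :: real} \<subseteq> I"
proof
  fix x assume "x \<in> {b..c}"
  then show "x \<in> I" using mem_is_interval_1_I[OF assms, of x] by simp
qed

text \<open>
  The equivalence covers negative times as well: a point in the past is the initial point of a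
  segment that ends in \<open>X\<close>.
\<close>
lemma flow_invariantI:
  assumes iff: "\<And>T u. solution_on F {0..T} u \<Longrightarrow> 0 \<le> T \<Longrightarrow> u 0 \<in> X \<longleftrightarrow> u T \<in> X"
  shows "flow_invariant F X"
  unfolding flow_invariant_def
proof (intro allI impI, elim conjE, intro image_subsetI)
  fix I u t assume sol: "solution_on F I u" and I: "0 \<in> I" and u0: "u 0 \<in> X" and t: "t \<in> I"
  have int: "is_interval I" using sol by (simp add: solution_on_def)
  show "u t \<in> X"
  proof (cases "0 \<le> t")
    case True
    have "solution_on F {0..t} u"
      using interval_segment[OF int I t] by (intro solution_on_subset[OF sol]) (auto simp: is_interval_cc)
    then show ?thesis using iff[OF _ True] u0 by blast
  next
    case False
    \<comment> \<open>The segment that ends at time 0 is shifted so that it starts at time 0.\<close>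
    have "solution_on F {0..- t} (\<lambda>r. u (r + t))"
      using interval_segment[OF int t I]
      by (intro solution_on_shift[OF sol]) (auto simp: is_interval_cc subset_iff)
    from iff[OF this] show ?thesis using False u0 by simp
  qed
qed

text \<open>
  The indices in \<open>S\<close> are the nonzero coordinates of the cell, and \<open>s\<close> is
  the common sign of the quartic coefficients on it. With \<open>\<beta> i = s * a (unit_mi
  i)\<close> the set \<open>cut\<close> is the closure of \<open>\<Gamma>\<^sup>+\<close>.
\<close>
locale normal_form_cut =
  fixes a :: "nat^'n::{finite,linorder} \<Rightarrow> real" and S :: "'n set" and s :: real
  assumes s: "s = 1 \<or> s = - 1"
    and quartic_sign: "\<And>i j. i \<in> S \<Longrightarrow> j \<in> S \<Longrightarrow> 0 < s * a (unit_mi i + unit_mi j)"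
    and pos_coeff: "\<exists>i\<in>S. 0 < s * a (unit_mi i)" and neg_coeff: "\<exists>i\<in>S. s * a (unit_mi i) < 0"

sublocale normal_form_cut \<subseteq> simplex_cut "\<lambda>i. s * a (unit_mi i)" S
  by unfold_locales (rule pos_coeff neg_coeff)+

context normal_form_cut begin

lemma form_eq: "form C = s * quad a C"
  by (simp add: form_def quad_def sum_distrib_left mult.assoc)

definition qform :: "real^'n::{finite,linorder} \<Rightarrow> real" where "qform C = s * quart a C"

lemma s_sq [simp]: "s * s = 1" "s * (s * x) = x" using s by auto

lemma growth_ray: "s * growth a \<nu> (r *\<^sub>R C) = s * \<nu> + r\<^sup>2 * form C + r ^ 4 * qform C"
  by (simp add: growth_scaleR form_eq qform_def algebra_simps)

lemma qform_pos:
  assumes C: "C \<in> cut" shows "0 < qform C"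
proof -
  have z: "C $ i = 0" if "i \<notin> S" for i using C that by (simp add: cut_def)
  have t: "0 \<le> s * a (unit_mi i + unit_mi j) * (norm (C $ i))\<^sup>2 * (norm (C $ j))\<^sup>2" for i j
    using quartic_sign[of i j] z[of i] z[of j] by (cases "i \<in> S \<and> j \<in> S") (auto simp: less_imp_le)
  have "C \<noteq> 0" using C by (auto simp: cut_def orthant_sphere_def)
  then obtain i where i: "C $ i \<noteq> 0" by (auto simp: vec_eq_iff)
  have eq: "qform C = (\<Sum>(i, j)\<in>{(i, j). i \<le> j}. s * a (unit_mi i + unit_mi j) * (norm (C $ i))\<^sup>2 * (norm (C $ j))\<^sup>2)"
    unfolding qform_def quart_def sum_distrib_left by (rule sum.cong) (auto simp: mult.assoc)
  show ?thesis unfolding eq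
  proof (rule sum_pos2)
    show "(i, i) \<in> {(i, j). i \<le> j}" by simp
    have "i \<in> S" using i z by blast
    then have "0 < s * a (unit_mi i + unit_mi i)" by (intro quartic_sign)
    then show "0 < (case (i, i) of (i, j) \<Rightarrow> s * a (unit_mi i + unit_mi j) * (norm (C $ i))\<^sup>2 * (norm (C $ j))\<^sup>2)"
      using i by simp
  qed (use t in auto)
qed

lemma form_nonneg: "C \<in> cut \<Longrightarrow> 0 \<le> form C" by (simp add: cut_def)

lemma continuous_on_qform: "continuous_on A qform"
  unfolding qform_def quart_def case_prod_unfold by (intro continuous_intros)

text \<open>
  The square of the radius is the positive root of \<open>s \<nu> + form C * V + qform C * V\<^sup>2
  = 0\<close>.
\<close>
definition radius :: "real \<Rightarrow> real^'n::{finite,linorder} \<Rightarrow> real" where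
  "radius \<nu> C = sqrt ((sqrt ((form C)\<^sup>2 - 4 * (s * \<nu>) * qform C) - form C) / (2 * qform C))"

lemma radius_props:
  assumes \<nu>: "s * \<nu> < 0" and C: "C \<in> cut"
  shows "0 < radius \<nu> C" "s * \<nu> + (radius \<nu> C)\<^sup>2 * form C + radius \<nu> C ^ 4 * qform C = 0"
proof -
  note W = qform_pos[OF C] and Q = form_nonneg[OF C]
  let ?D = "(form C)\<^sup>2 - 4 * (s * \<nu>) * qform C"
  have "(s * \<nu>) * qform C < 0" by (rule mult_neg_pos[OF \<nu> W])
  then have D: "(form C)\<^sup>2 < ?D" by linarith
  then have "form C < sqrt ?D" by (rule real_less_rsqrt)
  then have V: "0 < (sqrt ?D - form C) / (2 * qform C)" (is "0 < ?V") using W by simp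
  then show "0 < radius \<nu> C" by (simp add: radius_def)
  have D0: "0 \<le> ?D" using D zero_le_power2[of "form C"] by linarith
  have r2: "(radius \<nu> C)\<^sup>2 = ?V" unfolding radius_def using V by (simp only: real_sqrt_pow2 less_imp_le)
  have r4: "radius \<nu> C ^ 4 = ?V\<^sup>2" unfolding r2[symmetric] by (simp add: power2_eq_square power4_eq_xxxx)
  define R where "R = sqrt ?D"
  have R: "R\<^sup>2 = ?D" using D0 by (simp add: R_def)
  have "s * \<nu> + ((R - form C) / (2 * qform C)) * form C + ((R - form C) / (2 * qform C))\<^sup>2 * qform C
      = s * \<nu> + (R\<^sup>2 - (form C)\<^sup>2) / (4 * qform C)"
    using W by (simp add: field_simps power2_eq_square)
  also have "\<dots> = 0" unfolding R using W by (simp add: field_simps)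
  finally show "s * \<nu> + (radius \<nu> C)\<^sup>2 * form C + radius \<nu> C ^ 4 * qform C = 0"
    unfolding r4 r2 R_def .
qed

lemma continuous_on_radius: "continuous_on cut (radius \<nu>)"
  unfolding radius_def
  by (intro continuous_intros continuous_on_form continuous_on_qform) (use qform_pos in force)

text \<open>
  Both coefficients of the polynomial in \<open>r\<close> are nonnegative on \<open>cut\<close>, and
  the quartic one is positive.
\<close>
lemma growth_radius_less:
  assumes C: "C \<in> cut" and r: "0 \<le> r" "r < r'"
  shows "s * growth a \<nu> (r *\<^sub>R C) < s * growth a \<nu> (r' *\<^sub>R C)"
proof -
  have "r\<^sup>2 * form C \<le> r'\<^sup>2 * form C"
    using r form_nonneg[OF C] by (intro mult_right_mono power_mono) auto
  moreover have "r ^ 4 * qform C < r' ^ 4 * qform C"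
    using r qform_pos[OF C] by (intro mult_strict_right_mono power_strict_mono) auto
  ultimately show ?thesis unfolding growth_ray by linarith
qed

lemma growth_radius_0:
  assumes "s * \<nu> < 0" "C \<in> cut" shows "growth a \<nu> (radius \<nu> C *\<^sub>R C) = 0"
proof -
  have "s * growth a \<nu> (radius \<nu> C *\<^sub>R C) = 0" unfolding growth_ray by (rule radius_props(2)[OF assms])
  then show ?thesis using s by auto
qed

lemma growth_sign:
  assumes \<nu>: "s * \<nu> < 0" and C: "C \<in> cut" and r: "0 \<le> r"
  shows "s * growth a \<nu> (r *\<^sub>R C) < 0 \<longleftrightarrow> r < radius \<nu> C"
    "s * growth a \<nu> (r *\<^sub>R C) > 0 \<longleftrightarrow> radius \<nu> C < r"
    "growth a \<nu> (r *\<^sub>R C) = 0 \<longleftrightarrow> r = radius \<nu> C"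
proof -
  have z: "s * growth a \<nu> (radius \<nu> C *\<^sub>R C) = 0" using growth_radius_0[OF \<nu> C] by simp
  have R: "0 < radius \<nu> C" by (rule radius_props(1)[OF \<nu> C])
  have lt: "s * growth a \<nu> (r *\<^sub>R C) < 0" if "r < radius \<nu> C"
    using growth_radius_less[OF C r that, of \<nu>] unfolding z .
  have gt: "s * growth a \<nu> (r *\<^sub>R C) > 0" if "radius \<nu> C < r"
    using growth_radius_less[OF C less_imp_le[OF R] that, of \<nu>] unfolding z .
  have eq: "s * growth a \<nu> (r *\<^sub>R C) = 0" if "r = radius \<nu> C" using z that by simp
  show "s * growth a \<nu> (r *\<^sub>R C) < 0 \<longleftrightarrow> r < radius \<nu> C"
    "s * growth a \<nu> (r *\<^sub>R C) > 0 \<longleftrightarrow> radius \<nu> C < r"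
    using lt gt eq by (cases r "radius \<nu> C" rule: linorder_cases; linarith)+
  have "growth a \<nu> (r *\<^sub>R C) = 0 \<longleftrightarrow> s * growth a \<nu> (r *\<^sub>R C) = 0" using s by auto
  then show "growth a \<nu> (r *\<^sub>R C) = 0 \<longleftrightarrow> r = radius \<nu> C"
    using lt gt eq by (cases r "radius \<nu> C" rule: linorder_cases) auto
qed

definition toral_manifold :: "real \<Rightarrow> ((real \<times> real)^'n::{finite,linorder}) set" where
  "toral_manifold \<nu> = torus_bundle (radius \<nu>) cut"

lemma toral_manifold_iff:
  assumes "s * \<nu> < 0"
  shows "p \<in> toral_manifold \<nu> \<longleftrightarrow> p \<noteq> 0 \<and> direction p \<in> cut \<and> growth a \<nu> p = 0"
  unfolding toral_manifold_def torus_bundle_def growth_direction[of a \<nu> p]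
  using growth_sign(3)[OF assms, of "direction p" "norm p"] by auto

lemma flow_invariant_toral_manifold:
  assumes \<nu>: "s * \<nu> < 0" shows "flow_invariant (normal_form \<omega> a \<nu>) (toral_manifold \<nu>)"
proof (rule flow_invariantI)
  fix T u assume sol: "solution_on (normal_form \<omega> a \<nu>) {0..T} u" "0 \<le> T"
  obtain m where "m > 0" "growth a \<nu> (u T) = m * growth a \<nu> (u 0)"
    by (rule solution_growth_sign[OF sol])
  then show "u 0 \<in> toral_manifold \<nu> \<longleftrightarrow> u T \<in> toral_manifold \<nu>"
    using solution_direction[OF sol] unfolding toral_manifold_iff[OF \<nu>] by simp
qed

lemma toral_cells_radius:
  assumes "s * \<nu> < 0" shows "toral_cells cut cut_cells (radius \<nu>)"
  using toral_cells_cut[OF continuous_on_radius] radius_props(1)[OF assms] by blast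

lemma invariant_toral_complex_manifold:
  assumes \<nu>: "s * \<nu> < 0"
  shows "invariant_toral_complex (normal_form \<omega> a \<nu>) cut cut_cells (toral_manifold \<nu>) (torus_bundle (radius \<nu>))"
proof -
  have "p \<in> leaf (snd (trivialization (support e) p))" if "e \<in> cut_cells" "p \<in> torus_bundle (radius \<nu>) e" for e p
  proof -
    have p: "p \<noteq> 0" using that(2) by (simp add: torus_bundle_def)
    then show ?thesis
      using leaf_iff_direction[OF direction_in_orthant_sphere[OF p]] by (simp add: trivialization_def)
  qed
  then show ?thesis
    unfolding invariant_toral_complex_def toral_manifold_def
    using flow_invariant_toral_manifold[OF \<nu>, of \<omega>] toral_cells.toral_CW_bundle[OF toral_cells_radius[OF \<nu>]]
    unfolding toral_manifold_def by blast
qed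

lemma cut_leaf_growth:
  assumes \<nu>: "0 \<le> s * \<nu>" and C: "C \<in> cut" and r: "0 < r"
  shows "0 < s * growth a \<nu> (r *\<^sub>R C)"
proof -
  have "0 \<le> s * growth a \<nu> (0 *\<^sub>R C)" unfolding growth_ray using \<nu> by simp
  then show ?thesis using growth_radius_less[OF C order_refl r, of \<nu>] by linarith
qed

lemma no_compact_invariant_subset:
  assumes \<nu>: "0 \<le> s * \<nu>" and C: "C \<in> cut" and H: "compact H" "H \<noteq> {}" "H \<subseteq> leaf C"
  shows "\<not> flow_invariant (normal_form \<omega> a \<nu>) H"
proof
  assume inv: "flow_invariant (normal_form \<omega> a \<nu>) H"
  have "C \<noteq> 0" using C by (auto simp: cut_def orthant_sphere_def)
  then show False
    using no_compact_invariant_set[where \<kappa> = s and C = C, OF cut_leaf_growth[OF \<nu> C] _ _ H inv] s by auto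
qed

text \<open>
  A hypertorus is compact and nonempty.
\<close>
lemma no_hypertorus:
  assumes \<nu>: "0 \<le> s * \<nu>" and C: "C \<in> cut"
  shows "\<not> (\<exists>H. H \<subseteq> leaf C \<and> hypertorus H \<and> flow_invariant (normal_form \<omega> a \<nu>) H)"
proof
  assume "\<exists>H. H \<subseteq> leaf C \<and> hypertorus H \<and> flow_invariant (normal_form \<omega> a \<nu>) H"
  then obtain H m where H: "H \<subseteq> leaf C" "flow_invariant (normal_form \<omega> a \<nu>) H"
    and m: "top_of_set H homeomorphic_space torus {1..m::nat}" unfolding hypertorus_def by blast
  have "compact_space (torus {1..m})"
    unfolding torus_def by (auto simp: compact_space_product_topology compact_space_subtopology)
  then have "compact_space (top_of_set H)" using homeomorphic_compact_space[OF m] by blast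
  then have "compact H" by (simp add: compact_space_def compactin_subtopology)
  moreover have "H \<noteq> {}"
  proof
    assume "H = {}"
    then have "torus {1..m} = trivial_topology" using homeomorphic_empty_space[OF m] by simp
    then have "topspace (torus {1..m}) = {}" by simp
    moreover have "(\<lambda>i\<in>{1..m}. 1) \<in> topspace (torus {1..m})" by (auto simp: torus_def)
    ultimately show False by blast
  qed
  ultimately show False using no_compact_invariant_subset[OF \<nu> C _ _ H(1)] H(2) by blast
qed

lemma flow_invariant_Int_leaf:
  assumes inv: "flow_invariant (normal_form \<omega> a \<nu>) X" and C: "C \<in> orthant_sphere"
  shows "flow_invariant (normal_form \<omega> a \<nu>) (X \<inter> leaf C)"
proof -
  have "flow_invariant (normal_form \<omega> a \<nu>) (leaf C)"
  proof (rule flow_invariantI)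
    fix T u assume sol: "solution_on (normal_form \<omega> a \<nu>) {0..T} u" "0 \<le> T"
    show "u 0 \<in> leaf C \<longleftrightarrow> u T \<in> leaf C"
      unfolding leaf_iff_direction[OF C] using solution_direction[OF sol] by simp
  qed
  note leaf = this
  show ?thesis
    unfolding flow_invariant_def
  proof (intro allI impI)
    fix I u assume u: "solution_on (normal_form \<omega> a \<nu>) I u \<and> 0 \<in> I \<and> u 0 \<in> X \<inter> leaf C"
    have "u ` I \<subseteq> X" using inv[unfolded flow_invariant_def, rule_format, of I u] u by simp
    moreover have "u ` I \<subseteq> leaf C" using leaf[unfolded flow_invariant_def, rule_format, of I u] u by simp
    ultimately show "u ` I \<subseteq> X \<inter> leaf C" by simp
  qed
qed

text \<open>
  The trivialization of a toral cell records the leaf. So over a direction \<open>C\<close> the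
  complex meets the leaf of \<open>C\<close> exactly in the torus fiber over \<open>C\<close>, which
  is compact; but for \<open>s * \<nu> \<ge> 0\<close> the leaf contains no compact invariant set.
\<close>
lemma invariant_toral_complex_imp:
  assumes "invariant_toral_complex (normal_form \<omega> a \<nu>) cut E X c"
  shows "s * \<nu> < 0"
proof (rule ccontr)
  assume "\<not> s * \<nu> < 0"
  then have \<nu>: "0 \<le> s * \<nu>" by simp
  obtain J :: "(real, 'n) vec set \<Rightarrow> 'n set" and g d \<phi> where inv: "flow_invariant (normal_form \<omega> a \<nu>) X"
    and cw: "toral_CW_complex (top_of_set X) c J g (top_of_set cut) E d \<phi>"
    and leaf: "\<And>e p. e \<in> E \<Longrightarrow> p \<in> c e \<Longrightarrow> p \<in> leaf (snd (g e p))"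
    using assms unfolding invariant_toral_complex_def by blast
  have part: "partition_on cut E" and partX: "partition_on X (c ` E)"
    using cw by (auto simp: toral_CW_complex_def regular_CW_complex_def)
  obtain C where C: "C \<in> cut" using cut_nonempty by blast
  then obtain e where e: "e \<in> E" "C \<in> e" using part by (auto simp: partition_on_def)
  have sub: "c e \<subseteq> X" "e \<subseteq> cut" using part partX e(1) by (auto simp: partition_on_def)
  have "homeomorphic_map (subtopology (top_of_set X) (c e))
      (prod_topology (torus (J e)) (subtopology (top_of_set cut) e)) (g e)"
    using cw e(1) unfolding toral_CW_complex_def by blast
  then have "homeomorphic_map (top_of_set (c e)) (prod_topology (torus (J e)) (top_of_set e)) (g e)"
    using sub by (simp add: subtopology_subtopology Int_absorb1)
  then obtain h where h: "homeomorphic_maps (top_of_set (c e)) (prod_topology (torus (J e)) (top_of_set e)) (g e) h"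
    by (auto simp: homeomorphic_map_maps)
  let ?F = "topspace (torus (J e)) \<times> {C}"
  have CS: "C \<in> orthant_sphere" using C by (simp add: cut_def)
  have "compact_space (torus (J e))"
    unfolding torus_def by (auto simp: compact_space_product_topology compact_space_subtopology)
  then have "compactin (prod_topology (torus (J e)) (top_of_set e)) ?F"
    using e(2) by (simp add: compactin_Times compact_space_def)
  moreover have hc: "continuous_map (prod_topology (torus (J e)) (top_of_set e)) (top_of_set (c e)) h"
    using h by (simp add: homeomorphic_maps_def)
  ultimately have "compactin (top_of_set (c e)) (h ` ?F)" by (rule image_compactin)
  then have comp: "compact (h ` ?F)" by (simp add: compactin_subtopology)
  have hg: "h x \<in> c e" "g e (h x) = x" if "x \<in> ?F" for x
    using that e(2) h hc by (auto simp: homeomorphic_maps_def continuous_map_def Pi_iff)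
  have "h ` ?F = X \<inter> leaf C"
  proof (intro set_eqI iffI)
    fix p assume "p \<in> h ` ?F"
    then obtain x where x: "x \<in> ?F" "p = h x" by blast
    then have "snd (g e p) = C" using hg by auto
    then show "p \<in> X \<inter> leaf C" using leaf[OF e(1) hg(1)[OF x(1)]] x sub(1) hg(1) by auto
  next
    fix p assume p: "p \<in> X \<inter> leaf C"
    then obtain e' where e': "e' \<in> E" "p \<in> c e'" using partX by (auto simp: partition_on_def)
    have hm: "homeomorphic_map (subtopology (top_of_set X) (c e'))
      (prod_topology (torus (J e')) (subtopology (top_of_set cut) e')) (g e')"
      using cw e'(1) unfolding toral_CW_complex_def by blast
    have sub': "c e' \<subseteq> X" "e' \<subseteq> cut" using part partX e'(1) by (auto simp: partition_on_def)
    have "g e' p \<in> topspace (torus (J e')) \<times> e'"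
    proof -
      have "p \<in> topspace (subtopology (top_of_set X) (c e'))" using e'(2) sub'(1) by auto
      then have "g e' p \<in> topspace (prod_topology (torus (J e')) (subtopology (top_of_set cut) e'))"
        using homeomorphic_imp_surjective_map[OF hm] by blast
      then show ?thesis using sub'(2) by auto
    qed
    then have D: "snd (g e' p) \<in> e'" by auto
    then have DS: "snd (g e' p) \<in> orthant_sphere" using sub'(2) by (auto simp: cut_def)
    have "snd (g e' p) = C"
      using leaf[OF e'] p leaf_iff_direction[OF DS, of p] leaf_iff_direction[OF CS, of p] by simp
    then have "C \<in> e'" using D by simp
    then have "e' = e" using part e e'(1) by (auto simp: partition_on_def disjoint_def)
    then have pc: "p \<in> c e" and gp: "g e p \<in> ?F"
      using e' \<open>g e' p \<in> topspace (torus (J e')) \<times> e'\<close> \<open>snd (g e' p) = C\<close> by (auto simp: mem_Times_iff)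
    have "h (g e p) = p" using h pc by (simp add: homeomorphic_maps_def)
    then show "p \<in> h ` ?F" using gp by (metis image_eqI)
  qed
  moreover have "h ` ?F \<noteq> {}"
  proof -
    have "(\<lambda>i\<in>J e. 1) \<in> topspace (torus (J e))" by (auto simp: torus_def)
    then show ?thesis by blast
  qed
  ultimately show False
    using no_compact_invariant_subset[OF \<nu> C comp] flow_invariant_Int_leaf[OF inv CS] by (metis inf_le2)
qed


section \<open>Stability, size and instability\<close>

lemma leaves_iff: "p \<in> (\<Union>C\<in>cut. leaf C) \<longleftrightarrow> p \<noteq> 0 \<and> direction p \<in> cut"
proof -
  have "p \<in> leaf C \<longleftrightarrow> p \<noteq> 0 \<and> direction p = C" if "C \<in> cut" for C
    using that leaf_iff_direction[of C p] by (simp add: cut_def)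
  then show ?thesis by auto
qed

lemma compact_toral_manifold: "s * \<nu> < 0 \<Longrightarrow> compact (toral_manifold \<nu>)"
  unfolding toral_manifold_def by (rule toral_cells.compact_bundle[OF toral_cells_radius])

lemma point_on_manifold:
  assumes \<nu>: "s * \<nu> < 0" and C: "C \<in> cut"
  obtains p where "p \<in> toral_manifold \<nu>" "norm p = radius \<nu> C" "direction p = C"
proof (rule that)
  let ?p = "embed_torus (radius \<nu>) (\<lambda>_. 1, C)"
  have C': "0 < radius \<nu> C" "C \<in> orthant_sphere" using radius_props(1)[OF \<nu> C] C by (auto simp: cut_def)
  show "?p \<in> toral_manifold \<nu>" unfolding toral_manifold_def
    by (rule embed_torus_bundle(3)) (use C' C in auto)
  show "norm ?p = radius \<nu> C" by (rule embed_torus_bundle(2)) (use C' in auto)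
  show "direction ?p = C" by (rule embed_torus_bundle(1)) (use C' in auto)
qed

lemma toral_manifold_nonempty:
  assumes \<nu>: "s * \<nu> < 0" shows "toral_manifold \<nu> \<noteq> {}"
proof -
  obtain C where C: "C \<in> cut" using cut_nonempty by blast
  obtain p where "p \<in> toral_manifold \<nu>" "norm p = radius \<nu> C" "direction p = C"
    by (rule point_on_manifold[OF \<nu> C])
  then show ?thesis by blast
qed

lemma growth_scaled_point:
  assumes "0 \<le> x" shows "growth a \<nu> (x *\<^sub>R p) = growth a \<nu> ((x * norm p) *\<^sub>R direction p)"
  by (rule growth_cong) (use assms in \<open>cases "p = 0"; simp add: direction_def abs_mult\<close>)

text \<open>
  The distance between \<open>p\<close> and the manifold along the leaf is continuous and vanishes
  on the compact manifold; so it is small in a uniform neighbourhood.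
\<close>
lemma radial_defect_small:
  assumes \<nu>: "s * \<nu> < 0" and \<epsilon>: "0 < \<epsilon>"
  shows "\<exists>\<delta>>0. \<forall>p. p \<noteq> 0 \<longrightarrow> direction p \<in> cut \<longrightarrow> infdist p (toral_manifold \<nu>) < \<delta> \<longrightarrow>
      \<bar>norm p - radius \<nu> (direction p)\<bar> < \<epsilon>"
proof -
  let ?W = "{p :: (real \<times> real, 'n) vec. p \<noteq> 0 \<and> direction p \<in> cut}"
  let ?D = "\<lambda>p. \<bar>norm p - radius \<nu> (direction p)\<bar>"
  have d: "continuous_on ?W direction" by (intro continuous_on_direction) simp
  have "continuous_on ?W (\<lambda>p. radius \<nu> (direction p))"
    by (rule continuous_on_compose2[OF continuous_on_radius d]) auto
  then have "continuous_on ?W ?D" by (intro continuous_intros)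
  then have "openin (top_of_set ?W) (?W \<inter> ?D -` {..<\<epsilon>})"
    by (rule continuous_openin_preimage_gen) simp
  then obtain U where U: "open U" "?W \<inter> ?D -` {..<\<epsilon>} = ?W \<inter> U" by (auto simp: openin_open)
  have XW: "toral_manifold \<nu> \<subseteq> ?W \<inter> ?D -` {..<\<epsilon>}"
    using \<epsilon> by (auto simp: toral_manifold_def torus_bundle_def)
  then have "toral_manifold \<nu> \<subseteq> U" using U(2) by blast
  then obtain \<delta> where \<delta>: "0 < \<delta>" "(\<Union>x\<in>toral_manifold \<nu>. ball x \<delta>) \<subseteq> U"
    using compact_subset_open_imp_ball_epsilon_subset[OF compact_toral_manifold[OF \<nu>] U(1)] by blast
  show ?thesis
  proof (intro exI[of _ \<delta>] conjI allI impI \<delta>(1))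
    fix p :: "(real \<times> real, 'n) vec"
    assume p: "p \<noteq> 0" "direction p \<in> cut" "infdist p (toral_manifold \<nu>) < \<delta>"
    obtain x where x: "x \<in> toral_manifold \<nu>" "infdist p (toral_manifold \<nu>) = dist p x"
      using infdist_attains_inf[OF compact_imp_closed[OF compact_toral_manifold[OF \<nu>]] toral_manifold_nonempty[OF \<nu>]]
      by blast
    have "p \<in> ball x \<delta>" using p(3) x(2) by (simp add: dist_commute)
    then have "p \<in> U" using \<delta>(2) x(1) by blast
    then have "p \<in> ?W \<inter> ?D -` {..<\<epsilon>}" using U(2) p by blast
    then show "?D p < \<epsilon>" by simp
  qed
qed

text \<open>
  For \<open>s = -1\<close> the growth rate is positive inside and negative outside the manifold.
  The solution approaches the manifold monotonically along its leaf, and the radial distance bounds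
  the distance to the manifold.
\<close>
lemma attracted_solution:
  assumes \<nu>: "s * \<nu> < 0" and s1: "s = - 1" and p: "p \<noteq> 0" "direction p \<in> cut"
  obtains u where "solution_on (normal_form \<omega> a \<nu>) {0..} u" "u 0 = p"
    "\<forall>t\<ge>0. infdist (u t) (toral_manifold \<nu>) \<le> \<bar>norm p - radius \<nu> (direction p)\<bar>"
    "((\<lambda>t. infdist (u t) (toral_manifold \<nu>)) \<longlongrightarrow> 0) at_top"
proof -
  let ?R = "radius \<nu> (direction p)"
  define b where "b = ?R / norm p"
  have np: "0 < norm p" using p(1) by simp
  have R: "0 < ?R" by (rule radius_props(1)[OF \<nu> p(2)])
  have b: "0 < b" "b * norm p = ?R" using np R by (auto simp: b_def)
  have less: "x < b \<longleftrightarrow> x * norm p < ?R" "b < x \<longleftrightarrow> ?R < x * norm p" for x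
    using np by (auto simp: b_def field_simps)
  have up: "growth a \<nu> (x *\<^sub>R p) > 0" if "0 \<le> x" "x < b" for x
    using growth_sign(1)[OF \<nu> p(2), of "x * norm p"] that less(1)[of x] s1
      growth_scaled_point[of x \<nu> p] by simp
  have down: "growth a \<nu> (x *\<^sub>R p) < 0" if "b < x" for x
    using growth_sign(2)[OF \<nu> p(2), of "x * norm p"] that less(2)[of x] s1 b(1)
      growth_scaled_point[of x \<nu> p] by simp
  have zero: "growth a \<nu> (b *\<^sub>R p) = 0"
    using growth_radius_0[OF \<nu> p(2)] b growth_scaled_point[of b \<nu> p] by simp
  obtain x where x: "x 0 = (1::real)" "\<And>t. t \<ge> 0 \<Longrightarrow> 0 < x t \<and> \<bar>x t - b\<bar> \<le> \<bar>1 - b\<bar>" "(x \<longlongrightarrow> b) at_top"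
    "\<And>\<omega>. solution_on (normal_form \<omega> a \<nu>) {0..} (\<lambda>t. twist (\<lambda>i. \<omega> i * t) (x t *\<^sub>R p))"
    by (rule radial_solution_towards[of b a \<nu> p]) (use b zero up down in auto)
  let ?u = "\<lambda>t. twist (\<lambda>i. \<omega> i * t) (x t *\<^sub>R p)"
  have onX: "twist \<theta> (b *\<^sub>R p) \<in> toral_manifold \<nu>" for \<theta>
  proof -
    have "twist \<theta> (b *\<^sub>R p) \<noteq> 0"
    proof
      assume "twist \<theta> (b *\<^sub>R p) = 0"
      then have "norm (b *\<^sub>R p) = 0" by (metis norm_twist norm_zero)
      then show False using p(1) b(1) by simp
    qed
    moreover have "direction (b *\<^sub>R p) = direction p" by (rule direction_scale[OF _ b(1)]) (use b(1) in simp)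
    ultimately show ?thesis unfolding toral_manifold_iff[OF \<nu>] using zero p(2) by simp
  qed
  have dist: "infdist (?u t) (toral_manifold \<nu>) \<le> \<bar>x t - b\<bar> * norm p" for t
  proof -
    have "?u t - twist (\<lambda>i. \<omega> i * t) (b *\<^sub>R p) = twist (\<lambda>i. \<omega> i * t) ((x t - b) *\<^sub>R p)"
      by (simp add: vec_eq_iff rot_scaleR flip: scaleR_diff_left)
    then have "dist (?u t) (twist (\<lambda>i. \<omega> i * t) (b *\<^sub>R p)) = \<bar>x t - b\<bar> * norm p"
      by (simp only: dist_norm norm_twist norm_scaleR)
    then show ?thesis using infdist_le[OF onX[of "\<lambda>i. \<omega> i * t"], of "?u t"] by simp
  qed
  show ?thesis
  proof (rule that[of ?u])
    show "solution_on (normal_form \<omega> a \<nu>) {0..} ?u" by (rule x(4))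
    show "?u 0 = p" using x(1) by (simp add: vec_eq_iff)
    show "\<forall>t\<ge>0. infdist (?u t) (toral_manifold \<nu>) \<le> \<bar>norm p - ?R\<bar>"
    proof (intro allI impI)
      fix t :: real assume t: "0 \<le> t"
      have "\<bar>x t - b\<bar> * norm p \<le> \<bar>1 - b\<bar> * norm p" using x(2)[OF t] by (intro mult_right_mono) auto
      also have "\<dots> = \<bar>(1 - b) * norm p\<bar>" by (simp add: abs_mult)
      also have "\<dots> = \<bar>norm p - ?R\<bar>" using b(2) by (simp add: left_diff_distrib)
      finally show "infdist (?u t) (toral_manifold \<nu>) \<le> \<bar>norm p - ?R\<bar>" using dist[of t] by linarith
    qed
  next
    have "((\<lambda>t. \<bar>x t - b\<bar> * norm p) \<longlongrightarrow> \<bar>b - b\<bar> * norm p) at_top" by (intro tendsto_intros x(3))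
    then have "((\<lambda>t. \<bar>x t - b\<bar> * norm p) \<longlongrightarrow> 0) at_top" by simp
    then show "((\<lambda>t. infdist (?u t) (toral_manifold \<nu>)) \<longlongrightarrow> 0) at_top"
      by (rule Lim_null_comparison[rotated]) (use dist in \<open>simp add: infdist_nonneg\<close>)
  qed
qed

lemma asymptotically_stable_manifold:
  assumes \<nu>: "s * \<nu> < 0" and s1: "s = - 1"
  shows "asymptotically_stable_within (\<Union>C\<in>cut. leaf C) (normal_form \<omega> a \<nu>) (toral_manifold \<nu>)"
  unfolding asymptotically_stable_within_def stable_within_def
proof (intro conjI allI impI)
  fix \<epsilon> :: real assume "0 < \<epsilon>"
  from radial_defect_small[OF \<nu> this]
  obtain \<delta> where \<delta>1: "0 < \<delta>" and \<delta>2: "\<forall>p. p \<noteq> 0 \<longrightarrow> direction p \<in> cut \<longrightarrow> infdist p (toral_manifold \<nu>) < \<delta> \<longrightarrow>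
      \<bar>norm p - radius \<nu> (direction p)\<bar> < \<epsilon>" by (elim exE conjE)
  note \<delta> = \<delta>1 \<delta>2[rule_format]
  show "\<exists>\<delta>>0. \<forall>p\<in>\<Union>C\<in>cut. leaf C. infdist p (toral_manifold \<nu>) < \<delta> \<longrightarrow>
      (\<exists>u. solution_on (normal_form \<omega> a \<nu>) {0..} u \<and> u 0 = p \<and> (\<forall>t\<ge>0. infdist (u t) (toral_manifold \<nu>) < \<epsilon>))"
  proof (intro exI[of _ \<delta>] conjI ballI impI \<delta>(1))
    fix p assume p: "p \<in> (\<Union>C\<in>cut. leaf C)" "infdist p (toral_manifold \<nu>) < \<delta>"
    have p': "p \<noteq> 0" "direction p \<in> cut" using p(1)[unfolded leaves_iff] by blast+
    obtain u where u: "solution_on (normal_form \<omega> a \<nu>) {0..} u" "u 0 = p"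
      "\<forall>t\<ge>0. infdist (u t) (toral_manifold \<nu>) \<le> \<bar>norm p - radius \<nu> (direction p)\<bar>"
      "((\<lambda>t. infdist (u t) (toral_manifold \<nu>)) \<longlongrightarrow> 0) at_top"
      by (rule attracted_solution[where \<omega> = \<omega>, OF \<nu> s1 p'])
    have "infdist (u t) (toral_manifold \<nu>) < \<epsilon>" if "0 \<le> t" for t
      using u(3)[rule_format, OF that] \<delta>(2)[OF p' p(2)] by linarith
    then show "\<exists>u. solution_on (normal_form \<omega> a \<nu>) {0..} u \<and> u 0 = p \<and> (\<forall>t\<ge>0. infdist (u t) (toral_manifold \<nu>) < \<epsilon>)"
      using u(1,2) by blast
  qed
next
  have "\<exists>u. solution_on (normal_form \<omega> a \<nu>) {0..} u \<and> u 0 = p \<and>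
      ((\<lambda>t. infdist (u t) (toral_manifold \<nu>)) \<longlongrightarrow> 0) at_top" if p: "p \<in> (\<Union>C\<in>cut. leaf C)" for p
  proof -
    have p': "p \<noteq> 0" "direction p \<in> cut" using p[unfolded leaves_iff] by blast+
    obtain u where "solution_on (normal_form \<omega> a \<nu>) {0..} u" "u 0 = p"
      "\<forall>t\<ge>0. infdist (u t) (toral_manifold \<nu>) \<le> \<bar>norm p - radius \<nu> (direction p)\<bar>"
      "((\<lambda>t. infdist (u t) (toral_manifold \<nu>)) \<longlongrightarrow> 0) at_top"
      by (rule attracted_solution[where \<omega> = \<omega>, OF \<nu> s1 p'])
    then show ?thesis by blast
  qed
  then show "\<exists>\<delta>>0. \<forall>p\<in>\<Union>C\<in>cut. leaf C. infdist p (toral_manifold \<nu>) < \<delta> \<longrightarrow>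
      (\<exists>u. solution_on (normal_form \<omega> a \<nu>) {0..} u \<and> u 0 = p \<and>
        ((\<lambda>t. infdist (u t) (toral_manifold \<nu>)) \<longlongrightarrow> 0) at_top)"
    by (intro exI[of _ 1]) simp
qed

text \<open>
  If the growth rate is positive initially, it stays positive, so the norm increases; for \<open>s =
  1\<close> the growth rate increases with the norm. Hence it never falls below its initial value,
  and the norm increases at least linearly.
\<close>
lemma escaping_solution:
  fixes u :: "real \<Rightarrow> (real \<times> real, 'n) vec"
  assumes sol: "solution_on (normal_form \<omega> a \<nu>) {0..} u" and s1: "s = 1"
    and dir: "direction (u 0) \<in> cut" and g: "0 < growth a \<nu> (u 0)" and T: "0 \<le> T"
  shows "(1 + growth a \<nu> (u 0) * T) * norm (u 0) \<le> norm (u T)"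
proof -
  have solT: "solution_on (normal_form \<omega> a \<nu>) {0..t} u" for t
    by (intro solution_on_subset[OF sol]) (auto simp: is_interval_cc)
  obtain x where x: "x 0 = 1" "\<And>t. t \<in> {0..T} \<Longrightarrow> 0 < x t"
    "\<And>t. t \<in> {0..T} \<Longrightarrow> (x has_real_derivative x t * growth a \<nu> (u t)) (at t within {0..T})"
    "\<And>t i. t \<in> {0..T} \<Longrightarrow> norm (u t $ i) = x t * norm (u 0 $ i)"
    using solution_norms[OF solT[of T]] by metis
  have xc: "continuous_on {0..T} x" by (rule DERIV_continuous_on[OF x(3)])
  have gpos: "0 < growth a \<nu> (u t)" if t: "0 \<le> t" for t
  proof -
    obtain m where "m > 0" "growth a \<nu> (u t) = m * growth a \<nu> (u 0)"
      by (rule solution_growth_sign[OF solT t])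
    then show ?thesis using g by simp
  qed
  have ge1: "1 \<le> x t" if "t \<in> {0..T}" for t
  proof -
    have "x 0 \<le> x t"
    proof (rule DERIV_nonneg_imp_increasing_open[where f = x])
      show "0 \<le> t" using that by simp
      show "continuous_on {0..t} x" using that by (intro continuous_on_subset[OF xc]) auto
      fix r assume r: "0 < r" "r < t"
      then have "(x has_real_derivative x r * growth a \<nu> (u r)) (at r)"
        using x(3)[of r] that by (simp add: at_within_Icc_at)
      moreover have "0 \<le> x r * growth a \<nu> (u r)" using x(2)[of r] gpos[of r] r that by simp
      ultimately show "\<exists>y. (x has_real_derivative y) (at r) \<and> 0 \<le> y" by blast
    qed
    then show ?thesis using x(1) by simp
  qed
  let ?c = "growth a \<nu> (u 0)"
  have gle: "?c \<le> growth a \<nu> (u t)" if t: "t \<in> {0..T}" for t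
  proof -
    have "growth a \<nu> (x t *\<^sub>R u 0) = growth a \<nu> (u t)"
      using x(4)[OF t] x(2)[OF t] by (intro growth_cong) simp
    moreover have "growth a \<nu> (1 *\<^sub>R u 0) \<le> growth a \<nu> (x t *\<^sub>R u 0)"
    proof (cases "x t = 1")
      case False
      then have "1 < x t" using ge1[OF t] by simp
      moreover have "0 \<le> norm (u 0)" by simp
      ultimately have "norm (u 0) \<le> x t * norm (u 0)" by (simp add: mult_left_le_one_le mult_le_cancel_right1)
      then have "s * growth a \<nu> (norm (u 0) *\<^sub>R direction (u 0)) \<le> s * growth a \<nu> ((x t * norm (u 0)) *\<^sub>R direction (u 0))"
        using growth_radius_less[OF dir norm_ge_zero, of "u 0" "x t * norm (u 0)" \<nu>] by (cases "norm (u 0) = x t * norm (u 0)") auto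
      then show ?thesis
        using x(2)[OF t] s1 growth_scaled_point[of 1 \<nu> "u 0"] growth_scaled_point[of "x t" \<nu> "u 0"] by simp
    qed simp
    ultimately show ?thesis by simp
  qed
  have "x 0 - ?c * 0 \<le> x T - ?c * T"
  proof (rule DERIV_nonneg_imp_increasing_open[where f = "\<lambda>t. x t - ?c * t"])
    show "continuous_on {0..T} (\<lambda>t. x t - ?c * t)" by (intro continuous_intros xc)
    fix r assume r: "0 < r" "r < T"
    then have "(x has_real_derivative x r * growth a \<nu> (u r)) (at r)"
      using x(3)[of r] by (simp add: at_within_Icc_at)
    then have "((\<lambda>t. x t - ?c * t) has_real_derivative x r * growth a \<nu> (u r) - ?c) (at r)"
      by (auto intro!: derivative_eq_intros)
    moreover have "1 * ?c \<le> x r * growth a \<nu> (u r)"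
      using ge1[of r] gle[of r] g r by (intro mult_mono) auto
    ultimately show "\<exists>y. ((\<lambda>t. x t - ?c * t) has_real_derivative y) (at r) \<and> 0 \<le> y" by force
  qed (use T in auto)
  then have "1 + ?c * T \<le> x T" using x(1) by simp
  then have "(1 + ?c * T) * norm (u 0) \<le> x T * norm (u 0)" by (intro mult_right_mono) auto
  also have "\<dots> = norm (u T)"
    using x(4)[of T] x(2)[of T] T by (intro norm_vec_scale[symmetric]) auto
  finally show ?thesis .
qed

text \<open>
  Points slightly outside the manifold on a leaf have positive growth rate. Their solutions leave
  every bounded set.
\<close>
lemma unstable_manifold:
  assumes \<nu>: "s * \<nu> < 0" and s1: "s = 1"
  shows "\<not> stable_within (\<Union>C\<in>cut. leaf C) (normal_form \<omega> a \<nu>) (toral_manifold \<nu>)"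
proof
  assume "stable_within (\<Union>C\<in>cut. leaf C) (normal_form \<omega> a \<nu>) (toral_manifold \<nu>)"
  from mp[OF spec[OF this[unfolded stable_within_def]] zero_less_one]
  obtain \<delta> where \<delta>1: "0 < \<delta>" and \<delta>2: "\<forall>p\<in>\<Union>C\<in>cut. leaf C. infdist p (toral_manifold \<nu>) < \<delta> \<longrightarrow>
        (\<exists>u. solution_on (normal_form \<omega> a \<nu>) {0..} u \<and> u 0 = p \<and> (\<forall>t\<ge>0. infdist (u t) (toral_manifold \<nu>) < 1))"
    by (elim exE conjE)
  obtain q where q: "q \<in> toral_manifold \<nu>" using toral_manifold_nonempty[OF \<nu>] by blast
  then have q': "q \<noteq> 0" "direction q \<in> cut" "norm q = radius \<nu> (direction q)"
    by (auto simp: toral_manifold_def torus_bundle_def)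
  have nq: "0 < norm q" using q'(1) by simp
  define \<eta> where "\<eta> = \<delta> / (2 * norm q)"
  have \<eta>: "0 < \<eta>" "\<eta> * norm q < \<delta>" using \<delta>1 nq by (auto simp: \<eta>_def)
  define p where "p = (1 + \<eta>) *\<^sub>R q"
  have np: "norm p = (1 + \<eta>) * norm q" using \<eta> by (simp add: p_def)
  have dir: "direction p = direction q"
    by (rule direction_scale[where x = "1 + \<eta>"]) (use \<eta> in \<open>auto simp: p_def\<close>)
  have p0: "p \<noteq> 0" using np nq \<eta> by auto
  have "dist p q = \<eta> * norm q" using \<eta> by (simp add: p_def dist_norm scaleR_add_left)
  then have inf: "infdist p (toral_manifold \<nu>) < \<delta>" using infdist_le[OF q, of p] \<eta>(2) by simp
  have "p \<in> (\<Union>C\<in>cut. leaf C)" unfolding leaves_iff using p0 dir q'(2) by simp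
  from mp[OF bspec[OF \<delta>2 this] inf]
  obtain u where u: "solution_on (normal_form \<omega> a \<nu>) {0..} u" "u 0 = p"
    and near: "\<forall>t\<ge>0. infdist (u t) (toral_manifold \<nu>) < 1" by (elim exE conjE)
  have "radius \<nu> (direction p) < norm p" using np q'(3) dir \<eta>(1) nq by simp
  then have "0 < s * growth a \<nu> (norm p *\<^sub>R direction p)"
    using growth_sign(2)[OF \<nu>, of "direction p" "norm p"] q'(2) dir by simp
  then have g: "0 < growth a \<nu> (u 0)" using s1 u(2) growth_direction[of a \<nu> p] by simp
  have X: "compact (toral_manifold \<nu>)" by (rule compact_toral_manifold[OF \<nu>])
  then obtain B where B: "\<And>y. y \<in> toral_manifold \<nu> \<Longrightarrow> norm y \<le> B"
    using compact_imp_bounded bounded_iff by metis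
  have bound: "norm (u t) \<le> B + 1" if t: "0 \<le> t" for t
  proof -
    obtain y where y: "y \<in> toral_manifold \<nu>" "infdist (u t) (toral_manifold \<nu>) = dist (u t) y"
      using infdist_attains_inf[OF compact_imp_closed[OF X] toral_manifold_nonempty[OF \<nu>]] by blast
    have "norm (u t) \<le> norm y + dist (u t) y" by (simp add: dist_norm norm_triangle_sub)
    then show ?thesis using B[OF y(1)] near[rule_format, OF t] y(2) by linarith
  qed
  \<comment> \<open>At time \<open>T\<close> the linear lower bound exceeds \<open>B + 1\<close>,
    the bound near the manifold.\<close>
  define T where "T = (\<bar>B\<bar> + 1) / (growth a \<nu> (u 0) * norm (u 0))"
  have n0: "0 < norm (u 0)" using u(2) p0 by simp
  have T: "0 \<le> T" using g n0 by (simp add: T_def)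
  have "growth a \<nu> (u 0) * T * norm (u 0) = \<bar>B\<bar> + 1" using g n0 by (simp add: T_def)
  then have "(1 + growth a \<nu> (u 0) * T) * norm (u 0) = norm (u 0) + \<bar>B\<bar> + 1" by (simp add: distrib_right)
  moreover have "(1 + growth a \<nu> (u 0) * T) * norm (u 0) \<le> norm (u T)"
    using dir q'(2) u(2) by (intro escaping_solution[OF u(1) s1 _ g T]) simp
  ultimately show False using bound[OF T] n0 by linarith
qed

text \<open>
  The equation of the radius gives \<open>\<bar>\<nu>\<bar> \<ge> qform C * \<rho>\<^sup>4\<close>,
  and \<open>qform\<close> has a positive minimum on the compact set \<open>cut\<close>.
\<close>
lemma toral_manifold_shrinks:
  assumes "0 < \<epsilon>"
  shows "\<exists>\<delta>>0. \<forall>\<nu>. s * \<nu> < 0 \<longrightarrow> \<bar>\<nu>\<bar> < \<delta> \<longrightarrow> toral_manifold \<nu> \<subseteq> ball 0 \<epsilon>"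
proof -
  obtain D where D: "D \<in> cut" "\<And>C. C \<in> cut \<Longrightarrow> qform D \<le> qform C"
    using continuous_attains_inf[OF compact_cut cut_nonempty continuous_on_qform] by blast
  have W: "0 < qform D" by (rule qform_pos[OF D(1)])
  show ?thesis
  proof (intro exI[of _ "\<epsilon> ^ 4 * qform D"] conjI allI impI)
    show "0 < \<epsilon> ^ 4 * qform D" using assms W by simp
    fix \<nu> assume \<nu>: "s * \<nu> < 0" "\<bar>\<nu>\<bar> < \<epsilon> ^ 4 * qform D"
    have abs\<nu>: "\<bar>\<nu>\<bar> = - (s * \<nu>)" using \<nu>(1) s by auto
    show "toral_manifold \<nu> \<subseteq> ball 0 \<epsilon>"
    proof
      fix p assume p: "p \<in> toral_manifold \<nu>"
      then have C: "direction p \<in> cut" and n: "norm p = radius \<nu> (direction p)"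
        by (auto simp: toral_manifold_def torus_bundle_def)
      have "norm p ^ 4 * qform D \<le> norm p ^ 4 * qform (direction p)" using D(2)[OF C] by (intro mult_left_mono) auto
      moreover have "0 \<le> (norm p)\<^sup>2 * form (direction p)" using form_nonneg[OF C] by simp
      ultimately have "norm p ^ 4 * qform D \<le> \<bar>\<nu>\<bar>"
        using radius_props(2)[OF \<nu>(1) C] abs\<nu> unfolding n by linarith
      then have "norm p ^ 4 * qform D < \<epsilon> ^ 4 * qform D" using \<nu>(2) by linarith
      then have "norm p ^ 4 < \<epsilon> ^ 4" using W by simp
      then have "norm p < \<epsilon>" by (rule power_less_imp_less_base) (use assms in simp)
      then show "p \<in> ball 0 \<epsilon>" by simp
    qed
  qed
qed

text \<open>
  On a fixed leaf, a bound for the radius gives a bound for \<open>\<bar>\<nu>\<bar>\<close>.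
\<close>
lemma toral_manifold_unbounded:
  "\<exists>N. \<forall>\<nu>. N \<le> \<bar>\<nu>\<bar> \<and> s * \<nu> < 0 \<longrightarrow> \<not> toral_manifold \<nu> \<subseteq> cball 0 R"
proof -
  obtain C where C: "C \<in> cut" using cut_nonempty by blast
  show ?thesis
  proof (intro exI[of _ "R\<^sup>2 * form C + R ^ 4 * qform C + 1"] allI impI, elim conjE)
    fix \<nu> assume N: "R\<^sup>2 * form C + R ^ 4 * qform C + 1 \<le> \<bar>\<nu>\<bar>" and \<nu>: "s * \<nu> < 0"
    obtain p where p: "p \<in> toral_manifold \<nu>" "norm p = radius \<nu> C" by (rule point_on_manifold[OF \<nu> C])
    have abs\<nu>: "\<bar>\<nu>\<bar> = - (s * \<nu>)" using \<nu> s by auto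
    show "\<not> toral_manifold \<nu> \<subseteq> cball 0 R"
    proof
      assume "toral_manifold \<nu> \<subseteq> cball 0 R"
      then have R: "radius \<nu> C \<le> R" "0 \<le> radius \<nu> C" using p radius_props(1)[OF \<nu> C] by auto
      have "(radius \<nu> C)\<^sup>2 * form C \<le> R\<^sup>2 * form C" "radius \<nu> C ^ 4 * qform C \<le> R ^ 4 * qform C"
        using R form_nonneg[OF C] qform_pos[OF C] by (auto intro!: mult_right_mono power_mono)
      then show False using N radius_props(2)[OF \<nu> C] abs\<nu> by linarith
    qed
  qed
qed

end

section \<open>Shuffles and the toral decomposition\<close>

lemma shuffle_image_complement:
  fixes \<sigma> :: "nat \<Rightarrow> 'n::{finite,linorder}"
  assumes \<sigma>: "\<sigma> \<in> shuffles_S k" and l: "l \<le> CARD('n)"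
  shows "\<sigma> ` {l<..CARD('n)} = - \<sigma> ` {1..l}" "inj_on \<sigma> {1..l}" "card (\<sigma> ` {1..l}) = l"
proof -
  have b: "bij_betw \<sigma> {1..CARD('n)} UNIV" using \<sigma> by (simp add: shuffles_S_def)
  then have inj: "inj_on \<sigma> {1..CARD('n)}" and im: "\<sigma> ` {1..CARD('n)} = UNIV" by (auto simp: bij_betw_def)
  show i: "inj_on \<sigma> {1..l}" by (rule inj_on_subset[OF inj]) (use l in auto)
  then show "card (\<sigma> ` {1..l}) = l" by (simp add: card_image)
  have "{l<..CARD('n)} = {1..CARD('n)} - {1..l}" using l by auto
  then have "\<sigma> ` {l<..CARD('n)} = \<sigma> ` {1..CARD('n)} - \<sigma> ` {1..l}"
    using inj_on_image_set_diff[OF inj, of "{1..CARD('n)}" "{1..l}"] l by auto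
  then show "\<sigma> ` {l<..CARD('n)} = - \<sigma> ` {1..l}" unfolding im by auto
qed

text \<open>
  A shuffle lists a set in increasing order, followed by its complement in increasing order.
\<close>
lemma shuffle_exists:
  fixes G :: "'n::{finite,linorder} set"
  obtains \<gamma> where "\<gamma> \<in> shuffles_S (card G)" "\<gamma> ` {1..card G} = G"
proof -
  define xs where "xs = sorted_list_of_set G"
  define ys where "ys = sorted_list_of_set (- G)"
  have xs: "set xs = G" "distinct xs" "length xs = card G" "sorted_wrt (<) xs" by (simp_all add: xs_def)
  have ys: "set ys = - G" "distinct ys" "sorted_wrt (<) ys" by (simp_all add: ys_def)
  let ?zs = "xs @ ys"
  have d: "distinct ?zs" using xs ys by auto
  have st: "set ?zs = UNIV" using xs ys by auto
  have len: "length ?zs = CARD('n)" using distinct_card[OF d] st by simp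
  define \<gamma> where "\<gamma> = (\<lambda>i\<in>{1..CARD('n)}. ?zs ! (i - 1))"
  have nth: "\<gamma> i = ?zs ! (i - 1)" if "1 \<le> i" "i \<le> CARD('n)" for i using that by (simp add: \<gamma>_def)
  have cG: "card G \<le> CARD('n)" using card_mono[of UNIV G] by simp
  have shift: "bij_betw (\<lambda>i. i - 1) {1..CARD('n)} {..<CARD('n)}"
    by (rule bij_betwI[where g = Suc]) auto
  have "bij_betw ((!) ?zs) {..<CARD('n)} UNIV" using bij_betw_nth[OF d] len st by simp
  from bij_betw_trans[OF shift this] have "bij_betw ((!) ?zs \<circ> (\<lambda>i. i - 1)) {1..CARD('n)} UNIV" .
  then have b: "bij_betw \<gamma> {1..CARD('n)} UNIV"
    by (rule bij_betw_cong[THEN iffD1, rotated]) (simp add: nth)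
  have low: "\<gamma> i = xs ! (i - 1)" if i: "1 \<le> i" "i \<le> card G" for i
  proof -
    have "i - 1 < length xs" using i xs(3) by linarith
    then have "?zs ! (i - 1) = xs ! (i - 1)" by (simp only: nth_append if_True)
    moreover have "i \<le> CARD('n)" using i cG by linarith
    ultimately show ?thesis using nth[OF i(1)] by simp
  qed
  have high: "\<gamma> i = ys ! (i - 1 - card G)" if i: "card G < i" "i \<le> CARD('n)" for i
  proof -
    have "\<not> i - 1 < length xs" using i xs(3) by linarith
    then have "?zs ! (i - 1) = ys ! (i - 1 - card G)" by (simp only: nth_append if_False xs(3))
    moreover have "1 \<le> i" using i by linarith
    ultimately show ?thesis using nth[OF _ i(2)] by simp
  qed
  have im: "\<gamma> ` {1..card G} = G"
  proof -
    have "\<gamma> ` {1..card G} = (\<lambda>i. xs ! (i - 1)) ` {1..card G}" by (rule image_cong) (auto simp: low)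
    also have "\<dots> = (!) xs ` {..<card G}"
    proof -
      have "{..<card G} = (\<lambda>i. i - 1) ` {1..card G}" by (auto simp: image_iff intro!: bexI[of _ "Suc _"])
      then show ?thesis by (simp add: image_image)
    qed
    also have "\<dots> = G" using xs by (auto simp: set_conv_nth)
    finally show ?thesis .
  qed
  have "\<gamma> \<in> shuffles_S (card G)"
    unfolding shuffles_S_def
  proof (intro CollectI conjI allI impI)
    show "\<gamma> \<in> extensional {1..CARD('n)}" by (simp add: \<gamma>_def)
    fix i j
    { assume "1 \<le> i \<and> i < j \<and> j \<le> card G"
      then show "\<gamma> i < \<gamma> j" using low xs(3,4) by (auto simp: sorted_wrt_iff_nth_less)
    next
      assume ij: "card G < i \<and> i < j \<and> j \<le> CARD('n)"
      then have "i - 1 - card G < j - 1 - card G" "j - 1 - card G < length ys" using len xs(3) by auto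
      then show "\<gamma> i < \<gamma> j" using high[of i] high[of j] ij ys(3) by (auto simp: sorted_wrt_iff_nth_less) }
  qed (rule b)
  then show ?thesis using im that by blast
qed

text \<open>
  In terms of the sets of nonzero coordinates, the relation between shuffles is inclusion.
\<close>
lemma subshuffles_iff:
  fixes \<sigma> :: "nat \<Rightarrow> 'n::{finite,linorder}"
  assumes \<sigma>: "\<sigma> \<in> shuffles_S k" and k: "k \<le> CARD('n)"
  shows "\<gamma> \<in> subshuffles_S j k \<sigma> \<longleftrightarrow> \<gamma> \<in> shuffles_S j \<and> j \<le> k \<and> \<gamma> ` {1..j} \<subseteq> \<sigma> ` {1..k}"
proof -
  have "\<sigma> ` {k<..CARD('n)} \<subseteq> \<gamma> ` {j<..CARD('n)} \<longleftrightarrow> \<gamma> ` {1..j} \<subseteq> \<sigma> ` {1..k}"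
    if "\<gamma> \<in> shuffles_S j" "j \<le> k"
    using shuffle_image_complement(1)[OF \<sigma> k] shuffle_image_complement(1)[OF that(1), of j] that(2) k by auto
  then show ?thesis by (auto simp: subshuffles_S_def)
qed

lemma pos_sphere_eq_open_face:
  fixes \<gamma> :: "nat \<Rightarrow> 'n::{finite,linorder}"
  assumes \<gamma>: "\<gamma> \<in> shuffles_S l" and l: "l \<le> CARD('n)"
  shows "pos_sphere l \<gamma> = open_face (\<gamma> ` {1..l})"
proof (rule set_eqI)
  fix C
  note im = shuffle_image_complement[OF \<gamma> l]
  let ?G = "\<gamma> ` {1..l}"
  have "C \<in> pos_sphere l \<gamma> \<longleftrightarrow> (\<Sum>i\<in>?G. (C $ i)\<^sup>2) = 1 \<and> (\<forall>i\<in>?G. C $ i > 0) \<and> (\<forall>i\<in>- ?G. C $ i = 0)"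
  proof -
    have "(\<Sum>i\<in>?G. (C $ i)\<^sup>2) = (\<Sum>i\<in>{1..l}. (C $ \<gamma> i)\<^sup>2)"
      by (simp only: sum.reindex[OF im(2)] o_def)
    then show ?thesis unfolding pos_sphere_def im(1)[symmetric] by simp
  qed
  also have "\<dots> \<longleftrightarrow> C \<in> open_face ?G"
  proof
    assume A: "(\<Sum>i\<in>?G. (C $ i)\<^sup>2) = 1 \<and> (\<forall>i\<in>?G. C $ i > 0) \<and> (\<forall>i\<in>- ?G. C $ i = 0)"
    have "(\<Sum>i\<in>UNIV. (C $ i)\<^sup>2) = (\<Sum>i\<in>?G. (C $ i)\<^sup>2)"
      by (rule sum.mono_neutral_right) (use A in auto)
    moreover have "0 \<le> C $ i \<and> (0 < C $ i \<longleftrightarrow> i \<in> ?G)" for i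
    proof (cases "i \<in> ?G")
      case True
      then have "0 < C $ i" using A by blast
      then show ?thesis using True by simp
    next
      case False
      then have "C $ i = 0" using A by blast
      then show ?thesis using False by simp
    qed
    ultimately show "C \<in> open_face ?G" using A by (simp add: open_face_def orthant_sphere_def norm_eq_1_iff)
  next
    assume C: "C \<in> open_face ?G"
    have z: "\<forall>i\<in>- ?G. C $ i = 0" using open_face_zero[OF C] by simp
    have "(\<Sum>i\<in>UNIV. (C $ i)\<^sup>2) = (\<Sum>i\<in>?G. (C $ i)\<^sup>2)"
      by (rule sum.mono_neutral_right) (use z in auto)
    then show "(\<Sum>i\<in>?G. (C $ i)\<^sup>2) = 1 \<and> (\<forall>i\<in>?G. C $ i > 0) \<and> (\<forall>i\<in>- ?G. C $ i = 0)"
      using C z by (simp add: open_face_def orthant_sphere_def norm_eq_1_iff)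
  qed
  finally show "C \<in> pos_sphere l \<gamma> \<longleftrightarrow> C \<in> open_face ?G" .
qed

lemma diag_a_form:
  assumes "\<And>i. i \<notin> \<sigma> ` {1..k} \<Longrightarrow> C $ i = 0"
  shows "(diag_a a k \<sigma> *v C) \<bullet> C = quad a C"
proof -
  have "(diag_a a k \<sigma> *v C) $ i = (if i \<in> \<sigma> ` {1..k} then a (unit_mi i) else 0) * C $ i" for i
    by (simp add: matrix_vector_mult_def diag_a_def if_distrib[of "\<lambda>z. z * _"] cong: if_cong)
  then have "(diag_a a k \<sigma> *v C) \<bullet> C = (\<Sum>i\<in>UNIV. (if i \<in> \<sigma> ` {1..k} then a (unit_mi i) else 0) * C $ i * C $ i)"
    by (simp add: inner_vec_def)
  also have "\<dots> = quad a C"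
    unfolding quad_def by (rule sum.cong) (use assms in \<open>auto simp: power2_eq_square\<close>)
  finally show ?thesis .
qed

text \<open>
  A point of the coordinate subspace is approached by filling its zero coordinates with a small
  common value.
\<close>
lemma closure_cell_M:
  fixes \<sigma> :: "nat \<Rightarrow> 'n::{finite,linorder}"
  assumes \<sigma>: "\<sigma> \<in> shuffles_S k" and k: "k \<le> CARD('n)"
  shows "closure (cell_M k \<sigma>) = {p. \<forall>i. i \<notin> \<sigma> ` {1..k} \<longrightarrow> p $ i = 0}" (is "_ = ?M")
proof
  have cell: "p \<in> cell_M k \<sigma> \<longleftrightarrow> (\<forall>i\<in>\<sigma> ` {1..k}. p $ i \<noteq> 0) \<and> (\<forall>i\<in>- \<sigma> ` {1..k}. p $ i = 0)" for p
    unfolding cell_M_def shuffle_image_complement(1)[OF \<sigma> k, symmetric] by simp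
  have eq: "?M = (\<Inter>i\<in>- \<sigma> ` {1..k}. {p. p $ i = 0})" by auto
  have "closed ?M" unfolding eq by (intro closed_INT ballI closed_Collect_eq continuous_intros)
  then show "closure (cell_M k \<sigma>) \<subseteq> ?M" by (rule closure_minimal[rotated]) (auto simp: cell)
  show "?M \<subseteq> closure (cell_M k \<sigma>)"
  proof
    fix p assume p: "p \<in> ?M"
    define P where "P m = (\<chi> i. if i \<in> \<sigma> ` {1..k} \<and> p $ i = 0 then (1 / real (Suc m), 0) else p $ i)" for m
    have "P m \<in> cell_M k \<sigma>" for m using p by (auto simp: cell P_def zero_prod_def)
    moreover have "P \<longlonglongrightarrow> p"
    proof (rule vec_tendstoI)
      fix i
      have "(\<lambda>m. (1 / real (Suc m), 0 :: real)) \<longlonglongrightarrow> (0, 0)"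
        using LIMSEQ_inverse_real_of_nat by (intro tendsto_Pair tendsto_const) (simp add: inverse_eq_divide)
      then show "(\<lambda>m. P m $ i) \<longlonglongrightarrow> p $ i"
        by (cases "i \<in> \<sigma> ` {1..k} \<and> p $ i = 0") (auto simp: P_def zero_prod_def)
    qed
    ultimately show "p \<in> closure (cell_M k \<sigma>)" unfolding closure_sequential by (intro exI[of _ P]) simp
  qed
qed

lemma continuous_map_torus_reindex:
  assumes "\<And>i. i \<in> B \<Longrightarrow> h i \<in> A"
  shows "continuous_map (torus A) (torus B) (\<lambda>s. \<lambda>i\<in>B. s (h i))"
  unfolding torus_def continuous_map_componentwise
proof (intro conjI ballI)
  fix k assume k: "k \<in> B"
  have "continuous_map (product_topology (\<lambda>_. top_of_set (sphere 0 (1::real) :: complex set)) A)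
      (top_of_set (sphere 0 1)) (\<lambda>s. s (h k))"
    by (rule continuous_map_product_projection[OF assms[OF k]])
  then show "continuous_map (product_topology (\<lambda>_. top_of_set (sphere 0 (1::real) :: complex set)) A)
      (top_of_set (sphere 0 1)) (\<lambda>s. (\<lambda>i\<in>B. s (h i)) k)" using k by simp
qed auto

lemma homeomorphic_torus_times:
  assumes b: "bij_betw f I J"
  shows "prod_topology (torus J) Y homeomorphic_space prod_topology (torus I) Y"
proof -
  define g where "g = inv_into I f"
  have f: "f i \<in> J" "g (f i) = i" if "i \<in> I" for i
    using b that by (auto simp: bij_betw_def g_def)
  have g: "g j \<in> I" "f (g j) = j" if "j \<in> J" for j
    using b that by (auto simp: bij_betw_def g_def inv_into_into f_inv_into_f)
  have "homeomorphic_maps (torus J) (torus I) (\<lambda>s. \<lambda>i\<in>I. s (f i)) (\<lambda>s. \<lambda>j\<in>J. s (g j))"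
    unfolding homeomorphic_maps_def
  proof (intro conjI ballI)
    show "continuous_map (torus J) (torus I) (\<lambda>s. \<lambda>i\<in>I. s (f i))"
      by (rule continuous_map_torus_reindex) (rule f(1))
    show "continuous_map (torus I) (torus J) (\<lambda>s. \<lambda>j\<in>J. s (g j))"
      by (rule continuous_map_torus_reindex) (rule g(1))
    show "(\<lambda>j\<in>J. (\<lambda>i\<in>I. s (f i)) (g j)) = s" if "s \<in> topspace (torus J)" for s
      using that g by (auto simp: torus_def PiE_iff extensional_def fun_eq_iff)
    show "(\<lambda>i\<in>I. (\<lambda>j\<in>J. s (g j)) (f i)) = s" if "s \<in> topspace (torus I)" for s
      using that f by (auto simp: torus_def PiE_iff extensional_def fun_eq_iff)
  qed
  then have "homeomorphic_maps (prod_topology (torus J) Y) (prod_topology (torus I) Y)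
      (\<lambda>(s, y). (\<lambda>i\<in>I. s (f i), id y)) (\<lambda>(s, y). (\<lambda>j\<in>J. s (g j), id y))"
    using homeomorphic_maps_id[of Y Y] by (simp only: homeomorphic_maps_prod) simp
  then show ?thesis unfolding homeomorphic_space_def by blast
qed

context normal_form_cut begin

lemma straddles_not_subset:
  assumes "straddles G" shows "\<not> G \<subseteq> nonneg_indices" "\<not> G \<subseteq> S - nonneg_indices"
proof -
  obtain p n where "p \<in> G" "0 < s * a (unit_mi p)" "n \<in> G" "s * a (unit_mi n) < 0"
    using assms by (auto simp: straddles_def)
  moreover have "p \<in> S" using assms \<open>p \<in> G\<close> by (auto simp: straddles_def)
  ultimately show "\<not> G \<subseteq> nonneg_indices" "\<not> G \<subseteq> S - nonneg_indices"
    unfolding nonneg_indices_def by force+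
qed

lemma Gamma_parts:
  fixes \<gamma> :: "nat \<Rightarrow> 'n"
  assumes \<gamma>: "\<gamma> \<in> shuffles_S l" "l \<le> CARD('n)" and sub: "\<gamma> ` {1..l} \<subseteq> \<sigma> ` {1..k}"
    and sgn: "sgn (a (unit_mi (\<sigma> 1) + unit_mi (\<sigma> 1))) = s"
  shows "Gamma_sign a k \<sigma> 1 l \<gamma> = pos_part (\<gamma> ` {1..l})" "Gamma_zero a k \<sigma> l \<gamma> = zero_part (\<gamma> ` {1..l})"
proof -
  have q: "(diag_a a k \<sigma> *v C) \<bullet> C = quad a C" if "C \<in> open_face (\<gamma> ` {1..l})" for C
    by (rule diag_a_form) (use open_face_zero[OF that] sub in blast)
  have "sgn (a (unit_mi (\<sigma> 1) + unit_mi (\<sigma> 1)) * quad a C) = 1 \<longleftrightarrow> 0 < form C" for C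
    unfolding sgn_mult sgn form_eq using s by (auto simp: sgn_if split: if_splits)
  then show "Gamma_sign a k \<sigma> 1 l \<gamma> = pos_part (\<gamma> ` {1..l})"
    unfolding Gamma_sign_def pos_part_def pos_sphere_eq_open_face[OF \<gamma>] using q by auto
  have "quad a C = 0 \<longleftrightarrow> form C = 0" for C unfolding form_eq using s by auto
  then show "Gamma_zero a k \<sigma> l \<gamma> = zero_part (\<gamma> ` {1..l})"
    unfolding Gamma_zero_def zero_part_def pos_sphere_eq_open_face[OF \<gamma>] using q by auto
qed

text \<open>
  A shuffle that is a subshuffle neither of \<open>\<gamma>p\<close> nor of \<open>\<gamma>m\<close>
  enumerates a face with a vertex where the linear form is negative and a vertex where it is
  nonnegative. If the form is positive at no vertex, both parts of the face are empty; otherwise the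
  face straddles the hyperplane.
\<close>
lemma toral_decomposition_iff:
  fixes \<sigma> \<gamma>p \<gamma>m :: "nat \<Rightarrow> 'n"
  assumes \<sigma>: "\<sigma> \<in> shuffles_S k" "k \<le> CARD('n)" "S = \<sigma> ` {1..k}"
    and sgn: "sgn (a (unit_mi (\<sigma> 1) + unit_mi (\<sigma> 1))) = s"
    and \<gamma>p: "\<gamma>p \<in> shuffles_S l" "l \<le> k" "\<gamma>p ` {1..l} = nonneg_indices"
    and \<gamma>m: "\<gamma>m \<in> shuffles_S (k - l)" "\<gamma>m ` {1..k - l} = S - nonneg_indices"
  shows "(j, e) \<in> toral_decomposition a k \<sigma> l \<gamma>p \<gamma>m \<longleftrightarrow> e \<in> cut_cells \<and> j = card (support e)"
proof -
  have lN: "l \<le> CARD('n)" "k - l \<le> CARD('n)" using \<gamma>p(2) \<sigma>(2) by auto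
  have sub_p: "\<gamma> \<in> subshuffles_S i l \<gamma>p \<longleftrightarrow> \<gamma> \<in> shuffles_S i \<and> i \<le> l \<and> \<gamma> ` {1..i} \<subseteq> nonneg_indices" for \<gamma> i
    using subshuffles_iff[OF \<gamma>p(1) lN(1)] \<gamma>p(3) by simp
  have sub_m: "\<gamma> \<in> subshuffles_S i (k - l) \<gamma>m \<longleftrightarrow> \<gamma> \<in> shuffles_S i \<and> i \<le> k - l \<and> \<gamma> ` {1..i} \<subseteq> S - nonneg_indices" for \<gamma> i
    using subshuffles_iff[OF \<gamma>m(1) lN(2)] \<gamma>m(2) by simp
  have sub_k: "\<gamma> \<in> subshuffles_S i k \<sigma> \<longleftrightarrow> \<gamma> \<in> shuffles_S i \<and> i \<le> k \<and> \<gamma> ` {1..i} \<subseteq> S" for \<gamma> i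
    using subshuffles_iff[OF \<sigma>(1,2)] \<sigma>(3) by simp
  have cS: "card S = k" using shuffle_image_complement(3)[OF \<sigma>(1,2)] \<sigma>(3) by simp
  have cA: "card nonneg_indices = l" using shuffle_image_complement(3)[OF \<gamma>p(1) lN(1)] \<gamma>p(3) by simp
  have img: "card (\<gamma> ` {1..i}) = i" if "\<gamma> \<in> shuffles_S i" "i \<le> k" for \<gamma> :: "nat \<Rightarrow> 'n" and i
    using shuffle_image_complement(3)[OF that(1)] that(2) \<sigma>(2) by simp
  show ?thesis
  proof
    assume "(j, e) \<in> toral_decomposition a k \<sigma> l \<gamma>p \<gamma>m"
    then have e: "e \<noteq> {}" and "(j \<in> {1..l} \<and> (\<exists>\<gamma>\<in>subshuffles_S j l \<gamma>p. e = pos_sphere j \<gamma>)) \<or>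
        (j \<in> {1..k} \<and>
          (\<exists>\<gamma>\<in>subshuffles_S j k \<sigma> - (subshuffles_S j l \<gamma>p \<union> subshuffles_S j (k - l) \<gamma>m).
             e = Gamma_sign a k \<sigma> 1 j \<gamma> \<or> e = Gamma_zero a k \<sigma> j \<gamma>))"
      by (auto simp: toral_decomposition_def)
    then consider
        (face) \<gamma> where "j \<in> {1..l}" "\<gamma> \<in> subshuffles_S j l \<gamma>p" "e = pos_sphere j \<gamma>"
      | (part) \<gamma> where "j \<in> {1..k}" "\<gamma> \<in> subshuffles_S j k \<sigma>" "\<gamma> \<notin> subshuffles_S j l \<gamma>p"
          "\<gamma> \<notin> subshuffles_S j (k - l) \<gamma>m" "e = Gamma_sign a k \<sigma> 1 j \<gamma> \<or> e = Gamma_zero a k \<sigma> j \<gamma>"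
      by blast
    then show "e \<in> cut_cells \<and> j = card (support e)"
    proof cases
      case face
      let ?G = "\<gamma> ` {1..j}"
      have \<gamma>: "\<gamma> \<in> shuffles_S j" "j \<le> CARD('n)" "?G \<subseteq> nonneg_indices" using face lN sub_p by auto
      have eG: "e = open_face ?G" unfolding face(3) by (rule pos_sphere_eq_open_face[OF \<gamma>(1,2)])
      have ne: "?G \<noteq> {}" using face(1) by auto
      have "e \<in> cut_cells" unfolding eG cut_cells_def using \<gamma>(3) ne by blast
      moreover have "card (support e) = j" unfolding eG support_parts(1)[OF ne]
        using img[OF \<gamma>(1)] face(1) \<gamma>p(2) by auto
      ultimately show ?thesis by simp
    next
      case part
      let ?G = "\<gamma> ` {1..j}"
      have \<gamma>: "\<gamma> \<in> shuffles_S j" "j \<le> k" "?G \<subseteq> S" using part(2) sub_k by auto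
      have jN: "j \<le> CARD('n)" using \<gamma>(2) \<sigma>(2) by simp
      have cG: "card ?G = j" by (rule img[OF \<gamma>(1,2)])
      have notA: "\<not> ?G \<subseteq> nonneg_indices"
      proof
        assume "?G \<subseteq> nonneg_indices"
        moreover from card_mono[OF finite this] have "j \<le> l" using cG cA by simp
        ultimately show False using part(3) sub_p \<gamma>(1) by blast
      qed
      have notB: "\<not> ?G \<subseteq> S - nonneg_indices"
      proof
        assume B: "?G \<subseteq> S - nonneg_indices"
        have "card (S - nonneg_indices) = k - l"
          using shuffle_image_complement(3)[OF \<gamma>m(1) lN(2)] \<gamma>m(2) by simp
        then have "j \<le> k - l" using card_mono[OF finite B] cG by simp
        then show False using B part(4) sub_m \<gamma>(1) by blast
      qed
      obtain n where "n \<in> ?G" "n \<notin> nonneg_indices" using notA by blast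
      then have n: "n \<in> ?G" "s * a (unit_mi n) < 0"
        using subsetD[OF \<gamma>(3)] by (simp_all add: nonneg_indices_def)
      have eG: "e = pos_part ?G \<or> e = zero_part ?G"
        using part(5) Gamma_parts[where \<gamma> = \<gamma> and \<sigma> = \<sigma> and k = k and l = j, OF \<gamma>(1) jN _ sgn] \<gamma>(3) \<sigma>(3) by auto
      have "\<exists>i\<in>?G. 0 < s * a (unit_mi i)"
      proof (rule ccontr)
        assume "\<not> (\<exists>i\<in>?G. 0 < s * a (unit_mi i))"
        then have le: "\<forall>i\<in>?G. s * a (unit_mi i) \<le> 0" by (simp add: not_less)
        obtain C where "C \<in> e" using e by blast
        then have "C \<in> open_face ?G" "0 \<le> form C" using eG by (auto simp: pos_part_def zero_part_def)
        then show False using form_neg[OF _ n le] by fastforce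
      qed
      then have str: "straddles ?G" unfolding straddles_def using \<gamma>(3) n by blast
      then have "e \<in> cut_cells" using eG by (auto simp: cut_cells_def)
      moreover have "support e = ?G" using eG support_parts(2,3)[OF str] by auto
      ultimately show ?thesis using cG by simp
    qed
  next
    assume e: "e \<in> cut_cells \<and> j = card (support e)"
    obtain \<gamma> where \<gamma>: "\<gamma> \<in> shuffles_S (card (support e))" "\<gamma> ` {1..card (support e)} = support e"
      by (rule shuffle_exists)
    have j: "\<gamma> \<in> shuffles_S j" "\<gamma> ` {1..j} = support e" "j = card (support e)" using \<gamma> e by auto
    have supS: "support e \<subseteq> S" "e \<noteq> {}" "support e \<noteq> {}" using cell_in_open_face(2-4) e by auto
    have jk: "j \<le> k" using card_mono[OF finite supS(1)] cS j(3) by simp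
    have j1: "1 \<le> j" using supS(3) j(3) by (simp add: Suc_le_eq card_gt_0_iff)
    have jN: "j \<le> CARD('n)" using jk \<sigma>(2) by simp
    have "(j \<in> {1..l} \<and> (\<exists>\<gamma>\<in>subshuffles_S j l \<gamma>p. e = pos_sphere j \<gamma>)) \<or>
        (j \<in> {1..k} \<and>
          (\<exists>\<gamma>\<in>subshuffles_S j k \<sigma> - (subshuffles_S j l \<gamma>p \<union> subshuffles_S j (k - l) \<gamma>m).
             e = Gamma_sign a k \<sigma> 1 j \<gamma> \<or> e = Gamma_zero a k \<sigma> j \<gamma>))"
      using conjunct1[OF e]
    proof (cases rule: cut_cells_cases)
      case (face G)
      have G: "support e = G" unfolding face(3) by (rule support_parts(1)[OF face(1)])
      have "j \<le> l" using card_mono[OF finite face(2)] cA j(3) G by simp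
      moreover have "e = pos_sphere j \<gamma>"
        unfolding pos_sphere_eq_open_face[OF j(1) jN] j(2) G by (rule face(3))
      moreover have "\<gamma> \<in> subshuffles_S j l \<gamma>p" unfolding sub_p using j(1,2) G face(2) \<open>j \<le> l\<close> by simp
      ultimately show ?thesis using j1 by auto
    next
      case (pos G)
      have G: "support e = G" unfolding pos(2) by (rule support_parts(2)[OF pos(1)])
      have m: "\<gamma> \<in> subshuffles_S j k \<sigma> - (subshuffles_S j l \<gamma>p \<union> subshuffles_S j (k - l) \<gamma>m)"
        using straddles_not_subset[OF pos(1)] j(1,2) jk supS(1) G
        unfolding Diff_iff Un_iff sub_p sub_m sub_k by simp
      have "e = Gamma_sign a k \<sigma> 1 j \<gamma>"
        using Gamma_parts(1)[where \<gamma> = \<gamma> and \<sigma> = \<sigma> and k = k and l = j, OF j(1) jN _ sgn] supS(1) \<sigma>(3) j(2) G pos(2) by simp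
      then show ?thesis using m j1 jk by auto
    next
      case (zero G)
      have G: "support e = G" unfolding zero(2) by (rule support_parts(3)[OF zero(1)])
      have m: "\<gamma> \<in> subshuffles_S j k \<sigma> - (subshuffles_S j l \<gamma>p \<union> subshuffles_S j (k - l) \<gamma>m)"
        using straddles_not_subset[OF zero(1)] j(1,2) jk supS(1) G
        unfolding Diff_iff Un_iff sub_p sub_m sub_k by simp
      have "e = Gamma_zero a k \<sigma> j \<gamma>"
        using Gamma_parts(2)[where \<gamma> = \<gamma> and \<sigma> = \<sigma> and k = k and l = j, OF j(1) jN _ sgn] supS(1) \<sigma>(3) j(2) G zero(2) by simp
      then show ?thesis using m j1 jk by auto
    qed
    then show "(j, e) \<in> toral_decomposition a k \<sigma> l \<gamma>p \<gamma>m"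
      using supS(2) by (simp add: toral_decomposition_def)
  qed
qed

lemma torus_bundle_cell_homeomorphic:
  assumes \<nu>: "s * \<nu> < 0" and e: "e \<in> cut_cells"
  shows "top_of_set (torus_bundle (radius \<nu>) e) homeomorphic_space
    prod_topology (torus {1..card (support e)}) (top_of_set e)"
proof -
  have 1: "prod_topology (torus (support e)) (top_of_set e) homeomorphic_space top_of_set (torus_bundle (radius \<nu>) e)"
    using toral_cells.bundle_maps[OF toral_cells_radius[OF \<nu>] e] unfolding homeomorphic_space_def by blast
  obtain f where "bij_betw f {1..card (support e)} (support e)"
    using finite_same_card_bij[of "{1..card (support e)}" "support e"] by auto
  then have 2: "prod_topology (torus (support e)) (top_of_set e) homeomorphic_space
      prod_topology (torus {1..card (support e)}) (top_of_set e)"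
    by (rule homeomorphic_torus_times)
  show ?thesis
    by (rule homeomorphic_space_trans[OF homeomorphic_space_sym[THEN iffD1, OF 1] 2])
qed

lemma bifurcates_from_origin_manifold:
  assumes P: "P = {\<nu>. s * \<nu> < 0}" shows "bifurcates_from_origin toral_manifold P 0"
  unfolding bifurcates_from_origin_def
proof (intro conjI ballI allI impI)
  show "0 islimpt P"
    unfolding islimpt_approachable
  proof (intro allI impI)
    fix \<epsilon> :: real assume "0 < \<epsilon>"
    then show "\<exists>\<nu>\<in>P. \<nu> \<noteq> 0 \<and> dist \<nu> 0 < \<epsilon>"
      using s unfolding P by (intro bexI[of _ "- (s * (\<epsilon> / 2))"]) auto
  qed
  show "toral_manifold \<nu> \<noteq> {}" if "\<nu> \<in> P" for \<nu> using that toral_manifold_nonempty unfolding P by blast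
  show "0 \<notin> toral_manifold \<nu>" for \<nu> by (simp add: toral_manifold_def torus_bundle_def)
  fix \<epsilon> :: real assume "0 < \<epsilon>"
  from toral_manifold_shrinks[OF this]
  show "\<exists>\<delta>>0. \<forall>\<nu>\<in>P. \<bar>\<nu> - 0\<bar> < \<delta> \<longrightarrow> toral_manifold \<nu> \<subseteq> ball 0 \<epsilon>"
    unfolding P by simp
qed

end


section \<open>The theorem\<close>

theorem theorem6p11:
  fixes a :: "nat^'n::{finite,linorder} \<Rightarrow> real"
    and \<omega> :: "'n \<Rightarrow> real"
    and \<sigma> :: "nat \<Rightarrow> 'n"
    and k :: nat
  assumes k: "2 \<le> k" "k \<le> CARD('n)"
    and \<sigma>: "\<sigma> \<in> shuffles_S k"
    and \<omega>: "\<forall>i. \<omega> i \<noteq> 0" "\<forall>i j. i < j \<longrightarrow> \<omega> i / \<omega> j \<notin> \<rat>"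
    and mixed: "\<exists>i j. 1 \<le> i \<and> i < j \<and> j \<le> k \<and>
      sgn (a (unit_mi (\<sigma> j)) * a (unit_mi (\<sigma> i))) = - 1"
    and definite: "\<forall>i\<^sub>1 i\<^sub>2 j\<^sub>1 j\<^sub>2. 1 \<le> i\<^sub>1 \<and> i\<^sub>1 \<le> i\<^sub>2 \<and> i\<^sub>2 \<le> k \<and> 1 \<le> j\<^sub>1 \<and> j\<^sub>1 \<le> j\<^sub>2 \<and> j\<^sub>2 \<le> k \<longrightarrow>
      sgn (a (unit_mi (\<sigma> i\<^sub>1) + unit_mi (\<sigma> i\<^sub>2))) *
      sgn (a (unit_mi (\<sigma> j\<^sub>1) + unit_mi (\<sigma> j\<^sub>2))) = 1"
  shows
    "primary_bifurcation_variety (closure (cell_M k \<sigma>)) (normal_form \<omega> a) = {\<nu>. \<nu> = 0} \<and>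
     (\<forall>\<nu>. (\<exists>E X c. invariant_toral_complex (normal_form \<omega> a \<nu>)
              (closure (Gamma_sign a k \<sigma> 1 k \<sigma>)) E X c)
          \<longleftrightarrow> \<nu> * a (unit_mi (\<sigma> k) + unit_mi (\<sigma> k)) < 0) \<and>
     (\<exists>l \<gamma>\<^sub>p \<gamma>\<^sub>m. 1 \<le> l \<and> l < k \<and> \<gamma>\<^sub>p \<in> subshuffles_S l k \<sigma> \<and> \<gamma>\<^sub>m \<in> subshuffles_S (k - l) k \<sigma> \<and>
       (\<exists>X c.
         (\<forall>\<nu>. \<nu> * a (unit_mi (\<sigma> k) + unit_mi (\<sigma> k)) < 0 \<longrightarrow>
            invariant_toral_complex (normal_form \<omega> a \<nu>) (closure (Gamma_sign a k \<sigma> 1 k \<sigma>))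
              (snd ` toral_decomposition a k \<sigma> l \<gamma>\<^sub>p \<gamma>\<^sub>m) (X \<nu>) (c \<nu>) \<and>
            (\<forall>(j, e)\<in>toral_decomposition a k \<sigma> l \<gamma>\<^sub>p \<gamma>\<^sub>m.
               top_of_set (c \<nu> e) homeomorphic_space
               prod_topology (torus {1..j}) (top_of_set e)) \<and>
            (if a (unit_mi (\<sigma> k) + unit_mi (\<sigma> k)) < 0
             then asymptotically_stable_within
                    (\<Union>C\<in>closure (Gamma_sign a k \<sigma> 1 k \<sigma>). leaf C) (normal_form \<omega> a \<nu>) (X \<nu>)
             else \<not> stable_within
                    (\<Union>C\<in>closure (Gamma_sign a k \<sigma> 1 k \<sigma>). leaf C) (normal_form \<omega> a \<nu>) (X \<nu>))) \<and>
         bifurcates_from_origin X {\<nu>. \<nu> * a (unit_mi (\<sigma> k) + unit_mi (\<sigma> k)) < 0} 0 \<and>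
         (\<forall>R. \<exists>N. \<forall>\<nu>. N \<le> \<bar>\<nu>\<bar> \<and> \<nu> * a (unit_mi (\<sigma> k) + unit_mi (\<sigma> k)) < 0 \<longrightarrow>
            \<not> X \<nu> \<subseteq> cball 0 R))) \<and>
     (\<forall>\<nu>. \<nu> * a (unit_mi (\<sigma> k) + unit_mi (\<sigma> k)) \<ge> 0 \<longrightarrow>
        (\<forall>C\<in>closure (Gamma_sign a k \<sigma> 1 k \<sigma>).
           \<not> (\<exists>H. H \<subseteq> leaf C \<and> hypertorus H \<and> flow_invariant (normal_form \<omega> a \<nu>) H)))"
proof -
  define S where "S = \<sigma> ` {1..k}"
  define A where "A = a (unit_mi (\<sigma> k) + unit_mi (\<sigma> k))"
  \<comment> \<open>By definiteness every quartic coefficient of the cell has the sign of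
    \<open>A\<close>; this applies in particular to \<open>\<sigma> 1\<close>, which normalizes the
    sets \<open>\<Gamma>\<close>.\<close>
  define s where "s = sgn A"
  have AA: "sgn A * sgn A = 1" using definite[rule_format, of k k k k] k(1) by (simp add: A_def)
  then have A0: "A \<noteq> 0" by auto
  then have s: "s = 1 \<or> s = - 1" by (auto simp: s_def sgn_if)
  have coeff: "sgn (a (unit_mi (\<sigma> i) + unit_mi (\<sigma> j))) = s" if ij: "1 \<le> i" "i \<le> j" "j \<le> k" for i j
  proof -
    have "sgn (a (unit_mi (\<sigma> i) + unit_mi (\<sigma> j))) * s = 1"
      using definite[rule_format, of i j k k] ij k(1) by (simp add: s_def A_def)
    then show ?thesis using s by auto
  qed
  have coeff': "sgn (a (unit_mi p + unit_mi q)) = s" if pq: "p \<in> S" "q \<in> S" for p q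
  proof -
    obtain i j where ij: "p = \<sigma> i" "q = \<sigma> j" "i \<in> {1..k}" "j \<in> {1..k}" using pq unfolding S_def by blast
    show ?thesis
    proof (cases "i \<le> j")
      case True then show ?thesis using coeff[of i j] ij by simp
    next
      case False then show ?thesis using coeff[of j i] ij by (simp add: add.commute)
    qed
  qed
  have sign: "0 < s * a (unit_mi p + unit_mi q)" if "p \<in> S" "q \<in> S" for p q
    using coeff'[OF that] s by (auto simp: sgn_if split: if_splits)
  obtain i j where ij: "1 \<le> i" "i < j" "j \<le> k" "sgn (a (unit_mi (\<sigma> j)) * a (unit_mi (\<sigma> i))) = - 1"
    using mixed by blast
  have prod_neg: "a (unit_mi (\<sigma> j)) * a (unit_mi (\<sigma> i)) < 0" using ij(4) by (simp only: sgn_1_neg)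
  have ijS: "\<sigma> i \<in> S" "\<sigma> j \<in> S" using ij(1-3) by (auto simp: S_def)
  obtain p q where pq: "p \<in> S" "q \<in> S" "0 < a (unit_mi p)" "a (unit_mi q) < 0"
    using prod_neg ijS by (auto simp: mult_less_0_iff)
  have ex: "\<exists>i\<in>S. 0 < s * a (unit_mi i)" "\<exists>i\<in>S. s * a (unit_mi i) < 0"
    using s pq by auto
  interpret nf: normal_form_cut a S s
    by unfold_locales (use s sign ex in auto)
  have sA: "A = s * \<bar>A\<bar>" by (simp add: s_def mult_sgn_abs)
  have cond: "\<nu> * A < 0 \<longleftrightarrow> s * \<nu> < 0" "0 \<le> \<nu> * A \<longleftrightarrow> 0 \<le> s * \<nu>" for \<nu>
    using s A0 sA by (auto simp: mult_less_0_iff zero_le_mult_iff)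
  have Aneg: "A < 0 \<longleftrightarrow> s = - 1" using A0 by (auto simp: s_def sgn_if)
  have sgn1: "sgn (a (unit_mi (\<sigma> 1) + unit_mi (\<sigma> 1))) = s" using coeff[of 1 1] k(1) by simp
  have "Gamma_sign a k \<sigma> 1 k \<sigma> = nf.pos_part S"
    using nf.Gamma_parts(1)[where \<gamma> = \<sigma> and \<sigma> = \<sigma> and k = k and l = k, OF \<sigma> k(2) order_refl sgn1]
    unfolding S_def[symmetric] .
  then have K: "closure (Gamma_sign a k \<sigma> 1 k \<sigma>) = nf.cut" by (simp only: nf.cut_eq_closure)

  have bif: "primary_bifurcation_variety (closure (cell_M k \<sigma>)) (normal_form \<omega> a) = {\<nu>. \<nu> = 0}"
    unfolding closure_cell_M[OF \<sigma> k(2)] S_def[symmetric]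
  proof (rule primary_bifurcation_variety_eq[where i = p])
    show "\<omega> i \<noteq> 0" for i using \<omega>(1) by blast
    show "twist \<theta> x \<in> {x. \<forall>i. i \<notin> S \<longrightarrow> x $ i = 0}" if "x \<in> {x. \<forall>i. i \<notin> S \<longrightarrow> x $ i = 0}" for x \<theta>
      using that by (auto simp: rot_def zero_prod_def)
    show "(\<chi> j. if j = p then (c, 0) else 0) \<in> {x. \<forall>i. i \<notin> S \<longrightarrow> x $ i = 0}" for c
      using pq(1) by auto
  qed (use pq(3) in auto)

  have iff: "(\<exists>E X c. invariant_toral_complex (normal_form \<omega> a \<nu>) nf.cut E X c) \<longleftrightarrow> \<nu> * A < 0" for \<nu>
    unfolding cond(1) using nf.invariant_toral_complex_imp nf.invariant_toral_complex_manifold by blast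

  \<comment> \<open>Indices with vanishing quadratic coefficient belong to \<open>\<gamma>p\<close>:
    the faces spanned by them lie in the closure of \<open>\<Gamma>\<^sup>+\<close>.\<close>
  define l where "l = card nf.nonneg_indices"
  obtain \<gamma>p where \<gamma>p: "\<gamma>p \<in> shuffles_S l" "\<gamma>p ` {1..l} = nf.nonneg_indices"
    unfolding l_def by (rule shuffle_exists)
  have AS: "nf.nonneg_indices \<subseteq> S" by (auto simp: nf.nonneg_indices_def)
  have cS: "card S = k" unfolding S_def by (rule shuffle_image_complement(3)[OF \<sigma> k(2)])
  have cB: "card (S - nf.nonneg_indices) = k - l" using AS cS by (simp add: card_Diff_subset l_def)
  obtain \<gamma>m where \<gamma>m: "\<gamma>m \<in> shuffles_S (k - l)" "\<gamma>m ` {1..k - l} = S - nf.nonneg_indices"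
    unfolding cB[symmetric] by (rule shuffle_exists)
  have l: "1 \<le> l" "l < k"
  proof -
    have "nf.nonneg_indices \<noteq> {}" using ex(1) by (force simp: nf.nonneg_indices_def)
    then show "1 \<le> l" by (simp add: l_def Suc_le_eq card_gt_0_iff)
    have "nf.nonneg_indices \<subset> S" using AS ex(2) by (force simp: nf.nonneg_indices_def)
    from psubset_card_mono[OF _ this] show "l < k" using cS by (simp add: l_def)
  qed
  have \<gamma>sub: "\<gamma>p \<in> subshuffles_S l k \<sigma>" "\<gamma>m \<in> subshuffles_S (k - l) k \<sigma>"
    unfolding subshuffles_iff[OF \<sigma> k(2)] S_def[symmetric] using \<gamma>p \<gamma>m l AS by auto
  note dec = nf.toral_decomposition_iff[OF \<sigma> k(2) S_def sgn1 \<gamma>p(1) less_imp_le[OF l(2)] \<gamma>p(2) \<gamma>m]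
  have cells: "snd ` toral_decomposition a k \<sigma> l \<gamma>p \<gamma>m = nf.cut_cells"
  proof (intro set_eqI iffI)
    fix e assume "e \<in> snd ` toral_decomposition a k \<sigma> l \<gamma>p \<gamma>m"
    then show "e \<in> nf.cut_cells" using dec by auto
  next
    fix e assume "e \<in> nf.cut_cells"
    then have "(card (support e), e) \<in> toral_decomposition a k \<sigma> l \<gamma>p \<gamma>m" using dec by blast
    then show "e \<in> snd ` toral_decomposition a k \<sigma> l \<gamma>p \<gamma>m" by force
  qed

  have per_parameter: "invariant_toral_complex (normal_form \<omega> a \<nu>) nf.cut
        (snd ` toral_decomposition a k \<sigma> l \<gamma>p \<gamma>m) (nf.toral_manifold \<nu>) (torus_bundle (nf.radius \<nu>)) \<and>
      (\<forall>(j, e)\<in>toral_decomposition a k \<sigma> l \<gamma>p \<gamma>m.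
         top_of_set (torus_bundle (nf.radius \<nu>) e) homeomorphic_space
         prod_topology (torus {1..j}) (top_of_set e)) \<and>
      (if A < 0
       then asymptotically_stable_within (\<Union>C\<in>nf.cut. leaf C) (normal_form \<omega> a \<nu>) (nf.toral_manifold \<nu>)
       else \<not> stable_within (\<Union>C\<in>nf.cut. leaf C) (normal_form \<omega> a \<nu>) (nf.toral_manifold \<nu>))"
    if \<nu>: "\<nu> * A < 0" for \<nu>
  proof (intro conjI)
    have s\<nu>: "s * \<nu> < 0" using \<nu> cond(1) by simp
    show "invariant_toral_complex (normal_form \<omega> a \<nu>) nf.cut
        (snd ` toral_decomposition a k \<sigma> l \<gamma>p \<gamma>m) (nf.toral_manifold \<nu>) (torus_bundle (nf.radius \<nu>))"
      unfolding cells by (rule nf.invariant_toral_complex_manifold[OF s\<nu>])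
    show "\<forall>(j, e)\<in>toral_decomposition a k \<sigma> l \<gamma>p \<gamma>m.
         top_of_set (torus_bundle (nf.radius \<nu>) e) homeomorphic_space
         prod_topology (torus {1..j}) (top_of_set e)"
    proof (intro ballI, clarify)
      fix j e assume "(j, e) \<in> toral_decomposition a k \<sigma> l \<gamma>p \<gamma>m"
      then have "e \<in> nf.cut_cells" "j = card (support e)" using dec by auto
      then show "top_of_set (torus_bundle (nf.radius \<nu>) e) homeomorphic_space
         prod_topology (torus {1..j}) (top_of_set e)"
        using nf.torus_bundle_cell_homeomorphic[OF s\<nu>] by simp
    qed
    show "if A < 0
       then asymptotically_stable_within (\<Union>C\<in>nf.cut. leaf C) (normal_form \<omega> a \<nu>) (nf.toral_manifold \<nu>)
       else \<not> stable_within (\<Union>C\<in>nf.cut. leaf C) (normal_form \<omega> a \<nu>) (nf.toral_manifold \<nu>)"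
    proof (cases "A < 0")
      case True
      then show ?thesis using nf.asymptotically_stable_manifold[OF s\<nu>] Aneg by simp
    next
      case False
      then have "s = 1" using s Aneg by auto
      then show ?thesis using nf.unstable_manifold[OF s\<nu>] False by simp
    qed
  qed

  have emanates: "bifurcates_from_origin nf.toral_manifold {\<nu>. \<nu> * A < 0} 0"
    by (rule nf.bifurcates_from_origin_manifold) (simp add: cond(1))
  have unbounded: "\<forall>R. \<exists>N. \<forall>\<nu>. N \<le> \<bar>\<nu>\<bar> \<and> \<nu> * A < 0 \<longrightarrow> \<not> nf.toral_manifold \<nu> \<subseteq> cball 0 R"
    unfolding cond(1) using nf.toral_manifold_unbounded by (rule allI)
  have none: "\<forall>\<nu>. 0 \<le> \<nu> * A \<longrightarrow> (\<forall>C\<in>nf.cut.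
      \<not> (\<exists>H. H \<subseteq> leaf C \<and> hypertorus H \<and> flow_invariant (normal_form \<omega> a \<nu>) H))"
    unfolding cond(2) using nf.no_hypertorus by blast

  show ?thesis
    unfolding K A_def[symmetric]
  proof (rule conjI[OF bif conjI[OF allI[OF iff] conjI[OF _ none]]])
    show "\<exists>l \<gamma>\<^sub>p \<gamma>\<^sub>m. 1 \<le> l \<and> l < k \<and> \<gamma>\<^sub>p \<in> subshuffles_S l k \<sigma> \<and> \<gamma>\<^sub>m \<in> subshuffles_S (k - l) k \<sigma> \<and>
       (\<exists>X c.
         (\<forall>\<nu>. \<nu> * A < 0 \<longrightarrow>
            invariant_toral_complex (normal_form \<omega> a \<nu>) nf.cut
              (snd ` toral_decomposition a k \<sigma> l \<gamma>\<^sub>p \<gamma>\<^sub>m) (X \<nu>) (c \<nu>) \<and>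
            (\<forall>(j, e)\<in>toral_decomposition a k \<sigma> l \<gamma>\<^sub>p \<gamma>\<^sub>m.
               top_of_set (c \<nu> e) homeomorphic_space prod_topology (torus {1..j}) (top_of_set e)) \<and>
            (if A < 0
             then asymptotically_stable_within (\<Union>C\<in>nf.cut. leaf C) (normal_form \<omega> a \<nu>) (X \<nu>)
             else \<not> stable_within (\<Union>C\<in>nf.cut. leaf C) (normal_form \<omega> a \<nu>) (X \<nu>))) \<and>
         bifurcates_from_origin X {\<nu>. \<nu> * A < 0} 0 \<and>
         (\<forall>R. \<exists>N. \<forall>\<nu>. N \<le> \<bar>\<nu>\<bar> \<and> \<nu> * A < 0 \<longrightarrow> \<not> X \<nu> \<subseteq> cball 0 R))"
      by (rule exI[of _ l], rule exI[of _ \<gamma>p], rule exI[of _ \<gamma>m],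
          rule conjI[OF l(1) conjI[OF l(2) conjI[OF \<gamma>sub(1) conjI[OF \<gamma>sub(2)]]]],
          rule exI[of _ nf.toral_manifold], rule exI[of _ "\<lambda>\<nu>. torus_bundle (nf.radius \<nu>)"],
          rule conjI[OF allI[OF impI[OF per_parameter]] conjI[OF emanates unbounded]])
  qed
qed

end
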